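(* Let $X$ be a tree. Then the following holds. (1) Let $n>1$ be an integer with no prime divisors less than $End(X)+1$. If a continuous map $f:X\to X$ has a cycle of period $n$, then $f$ has cycles of all periods greater than $2\,End(X)(n-1)$. Moreover, $h(f)\ge \dfrac{\ln 2}{n\,End(X)-1}$. (2) Let $1\le n\le End(X)$ and let $E$ be the set of all periods of cycles of some continuous interval map $[0,1]\to[0,1]$. Then there exists a continuous map $f:X\to X$ such that the set of all periods of cycles of $f$ is $\{1\}\cup nE$, where $nE=\{nk: k\in E\}$.
   Context: A graph is a compact one-dimensional branched manifold (a finite topological graph); a tree is a connected graph containing no subset homeomorphic to the circle. $End(X)$ denotes the number of endpoints of the tree $X$. A cycle is the orbit of a periodic point, and its period is the number of points in it (the least period). $h(f)$ is the topological entropy of $f$. *)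

theory Defs
  imports
    "HOL-Analysis.Analysis"
    "HOL-Computational_Algebra.Primes"
    "HOL-Combinatorics.Orbits"
begin

section \<open>Graphs and trees\<close>

text \<open>
  Spaces are subsets of a Hausdorff type, with the subspace topology. A graph is a finite union
  of arcs that meet only in common endpoints; vertices are not recorded. Loops and multiple edges
  are no loss, since edges may be subdivided. Isolated points are excluded, since a graph is
  one-dimensional.
\<close>

definition topological_graph :: "'a::t2_space set \<Rightarrow> bool" where
  "topological_graph X \<longleftrightarrow>
    (\<exists>G. finite G \<and> (\<forall>g\<in>G. arc g) \<and> X = (\<Union>g\<in>G. path_image g) \<and>
      (\<forall>g\<in>G. \<forall>h\<in>G. g \<noteq> h \<longrightarrow>
        path_image g \<inter> path_image h
          \<subseteq> {pathstart g, pathfinish g} \<inter> {pathstart h, pathfinish h}))"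

definition topological_tree :: "'a::t2_space set \<Rightarrow> bool" where
  "topological_tree X \<longleftrightarrow>
    topological_graph X \<and> X \<noteq> {} \<and> connected X \<and>
    \<not> (\<exists>S\<subseteq>X. S homeomorphic sphere (0::complex) 1)"

text \<open>
  An endpoint is a point of valence one: it has an open neighbourhood in the space that looks
  like a half-open interval with the point at its closed end.
\<close>

definition endpoints :: "'a::t2_space set \<Rightarrow> 'a set" where
  "endpoints X = {x \<in> X. \<exists>U h k. openin (top_of_set X) U \<and> x \<in> U \<and>
      homeomorphism U {0..<1::real} h k \<and> h x = 0}"

definition End :: "'a::t2_space set \<Rightarrow> nat" where
  "End X = card (endpoints X)"


section \<open>Cycles\<close>

text \<open>
  The library's \<open>orbit f x\<close> consists of the points \<open>(f ^^ k) x\<close> with \<open>k > 0\<close>, so it contains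
  \<open>x\<close> exactly when \<open>x\<close> is periodic, and then it has as many elements as the least period of \<open>x\<close>.
  Hence \<open>cyclic_on f C\<close> says that \<open>C\<close> is the orbit of a periodic point.
\<close>

definition cycle_periods :: "'a set \<Rightarrow> ('a \<Rightarrow> 'a) \<Rightarrow> nat set" where
  "cycle_periods X f = {card C | C. C \<subseteq> X \<and> cyclic_on f C}"


section \<open>Topological entropy\<close>

text \<open>
  The Adler--Konheim--McAndrew definition by open covers, meant for compact \<open>X\<close> and continuous
  \<open>f\<close> mapping \<open>X\<close> to itself.
\<close>

definition open_covers :: "'a::topological_space set \<Rightarrow> 'a set set set" where
  "open_covers X = {\<U>. (\<forall>U\<in>\<U>. openin (top_of_set X) U) \<and> \<Union>\<U> = X}"

definition min_subcover_card :: "'a set \<Rightarrow> 'a set set \<Rightarrow> nat" where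
  "min_subcover_card X \<U> = (LEAST k. \<exists>\<V>\<subseteq>\<U>. finite \<V> \<and> card \<V> = k \<and> X \<subseteq> \<Union>\<V>)"

text \<open>
  The common refinement of the preimages of \<open>\<U>\<close> under \<open>f ^^ i\<close> for \<open>i < n\<close>.
\<close>

definition iterated_join :: "'a set \<Rightarrow> ('a \<Rightarrow> 'a) \<Rightarrow> 'a set set \<Rightarrow> nat \<Rightarrow> 'a set set" where
  "iterated_join X f \<U> n =
    {{x \<in> X. \<forall>i<n. (f ^^ i) x \<in> A i} | A :: nat \<Rightarrow> 'a set. \<forall>i<n. A i \<in> \<U>}"

text \<open>
  By subadditivity the upper limit below is a limit, so it is the usual entropy relative to a
  cover. The topological entropy may be infinite.
\<close>

definition cover_entropy :: "'a set \<Rightarrow> ('a \<Rightarrow> 'a) \<Rightarrow> 'a set set \<Rightarrow> ereal" where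
  "cover_entropy X f \<U> =
    limsup (\<lambda>n. ereal (ln (real (min_subcover_card X (iterated_join X f \<U> n))) / real n))"

definition topological_entropy :: "'a::topological_space set \<Rightarrow> ('a \<Rightarrow> 'a) \<Rightarrow> ereal" where
  "topological_entropy X f = (SUP \<U>\<in>open_covers X. cover_entropy X f \<U>)"

end

theory Submission
  imports Defs "HOL-Number_Theory.Cong"
begin

text \<open>
  In a tree \<open>X\<close> two points \<open>x\<close>, \<open>y\<close> are joined by exactly one arc, the segment \<open>[x,y]\<close>. It consists of
  the points that lie in every connected subset of \<open>X\<close> containing \<open>x\<close> and \<open>y\<close>. Once this is known
  (\<open>uniquely_arc_connected_tree\<close>), almost everything below is an argument about connected sets.

  Large periods and entropy. Let \<open>P\<close> be a cycle of period \<open>n\<close>. There is a point \<open>a\<close> outside \<open>P\<close> that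
  lies between two points of \<open>P\<close> and satisfies \<open>a \<in> [f a, x]\<close> for all \<open>x \<in> P\<close>
  (\<open>separating_point\<close>); it plays the role of a fixed point. Order \<open>X\<close> by letting \<open>x\<close> be below \<open>y\<close> if
  \<open>x \<in> [a,y]\<close>. For \<open>x \<in> P\<close> the image of \<open>[a,x]\<close> runs over \<open>[a, f x]\<close> from \<open>a\<close> outwards, and so over
  \<open>[a,x']\<close> for every \<open>x'\<close> below \<open>f x\<close>. The minimal points of \<open>P\<close> form an antichain, so there are at most
  \<open>End X\<close> of them (\<open>card_antichain_le_End\<close>). Sending a minimal point \<open>y\<close> to the minimal point below
  \<open>f y\<close> is a self-map of this set; it has a periodic point, and its orbit \<open>y\<^sub>1, \<dots>, y\<^sub>l\<close> gives a loop of
  segments \<open>[a,y\<^sub>1] \<rightarrow> \<dots> \<rightarrow> [a,y\<^sub>l] \<rightarrow> [a,y\<^sub>1]\<close> of length \<open>l \<le> End X\<close>. All prime divisors of \<open>n\<close> exceed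
  \<open>End X\<close>, so \<open>l\<close> and \<open>n\<close> are coprime. If, for all \<open>i\<close>, the points \<open>f y\<^sub>i\<close> and \<open>y\<^sub>i\<^sub>+\<^sub>1\<close> stayed on the same side of
  \<open>a\<close> at all later times, then so would \<open>f\<^sup>l y\<^sub>1\<close> and \<open>y\<^sub>1\<close>, and by coprimality any two points of \<open>P\<close>, which
  contradicts the choice of \<open>a\<close>. Hence for some \<open>i\<close> the points \<open>y = y\<^sub>i\<^sub>+\<^sub>1\<close> and \<open>v = f y\<^sub>i\<close> are separated by
  \<open>a\<close> after \<open>k < n\<close> steps, and some \<open>u \<in> [y,v]\<close> is mapped to \<open>a\<close> by \<open>f\<^sup>k\<close>. This is a second loop
  \<open>[a,y\<^sub>i] \<rightarrow> [u,v] \<rightarrow> \<dots> \<rightarrow> [a, f\<^sup>k v] \<rightarrow> \<dots> \<rightarrow> [a, f\<^sup>n\<^sup>-\<^sup>1 v] = [a,y\<^sub>i]\<close>, of length \<open>n\<close>, and \<open>[u,v]\<close> is disjoint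
  from all \<open>[a,y\<^sub>j]\<close> (\<open>germ_loop_and_excursion\<close>).

  A map may leave a segment and return, so a loop of segments need not contain a periodic orbit if
  orientations are reversed. All arrows above preserve orientation. Assigning to each point of the
  target the last parameter at which it is visited is then a monotone choice of preimages;
  these choices compose, and a monotone self-map of a segment has a fixed point
  (\<open>pullback_covers\<close>, \<open>pullback_loop_fixpoint\<close>). For \<open>m > 2 End(X) (n - 1)\<close> write \<open>m = s n + t l\<close> with
  \<open>1 \<le> s \<le> l\<close>. Going \<open>s\<close> times round the long loop and then \<open>t\<close> times round the short one gives a point
  fixed by \<open>f\<^sup>m\<close>; its stay near the short loop is so long that a smaller period would carry a visit to
  \<open>[u,v]\<close> into this stay (\<open>all_large_periods\<close>). The words of length \<open>q\<close> in the two loops give \<open>2\<^sup>q\<close>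
  orbits that are pairwise separated within time \<open>q n\<close>, so the entropy is at least
  \<open>ln 2 / n\<close> (\<open>double_loop_entropy\<close>), which is at least the required bound.

  Prescribed periods. Choose \<open>n\<close> endpoints and disjoint collars of them, and a point \<open>c\<close> outside the
  collars. The map \<open>f\<close> sends everything outside the collars to \<open>c\<close>, and carries each collar along a
  path from \<open>c\<close> onto the next collar; on the outer half of the collars this is the
  identity in suitable coordinates, except for one collar, where it is \<open>g\<close>. A cycle other than \<open>{c}\<close> goes
  round the collars, so its period is a multiple of \<open>n\<close>, and \<open>f\<^sup>n\<close> acts on the outer half of the first
  collar as \<open>g\<close> (\<open>conveyor_cycle_periods\<close>, \<open>multiplied_periods\<close>).
\<close>

section \<open>Segments and unique arcs\<close>

text \<open>
  The segment \<open>[x,y]\<close> of the space \<open>X\<close>, described by connected sets. In a tree it is the arc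
  from \<open>x\<close> to \<open>y\<close>; the description makes betweenness a matter of joining connected sets.
\<close>

definition seg :: "'a::t2_space set \<Rightarrow> 'a \<Rightarrow> 'a \<Rightarrow> 'a set" where
  "seg X x y = {z \<in> X. \<forall>C. C \<subseteq> X \<and> connected C \<and> x \<in> C \<and> y \<in> C \<longrightarrow> z \<in> C}"

definition uniquely_arc_connected :: "'a::t2_space set \<Rightarrow> bool" where
  "uniquely_arc_connected X \<longleftrightarrow>
    (\<forall>x\<in>X. \<forall>y\<in>X. x \<noteq> y \<longrightarrow>
      (\<exists>g. arc g \<and> pathstart g = x \<and> pathfinish g = y \<and> path_image g = seg X x y))"

lemma seg_subset_space: "seg X x y \<subseteq> X"
  by (auto simp: seg_def)

lemma segI:
  assumes "z \<in> X" "\<And>C. C \<subseteq> X \<Longrightarrow> connected C \<Longrightarrow> x \<in> C \<Longrightarrow> y \<in> C \<Longrightarrow> z \<in> C"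
  shows "z \<in> seg X x y"
  using assms by (auto simp: seg_def)

lemma segD: "z \<in> seg X x y \<Longrightarrow> C \<subseteq> X \<Longrightarrow> connected C \<Longrightarrow> x \<in> C \<Longrightarrow> y \<in> C \<Longrightarrow> z \<in> C"
  by (auto simp: seg_def)

lemma not_segE:
  assumes "z \<notin> seg X x y" "z \<in> X"
  obtains C where "C \<subseteq> X" "connected C" "x \<in> C" "y \<in> C" "z \<notin> C"
  using assms by (auto simp: seg_def)

lemma seg_commute: "seg X x y = seg X y x"
  by (auto simp: seg_def)

lemma arc_eq_seg:
  assumes "arc g" "path_image g \<subseteq> X" "pathstart g = x" "pathfinish g = y"
    and "\<And>C. C \<subseteq> X \<Longrightarrow> connected C \<Longrightarrow> x \<in> C \<Longrightarrow> y \<in> C \<Longrightarrow> path_image g \<subseteq> C"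
  shows "path_image g = seg X x y"
proof
  show "path_image g \<subseteq> seg X x y"
    using assms(2,5) by (auto simp: seg_def)
  show "seg X x y \<subseteq> path_image g"
  proof
    fix z assume "z \<in> seg X x y"
    then show "z \<in> path_image g"
      using segD[of z X x y "path_image g"] assms arc_imp_path connected_path_image
        pathstart_in_path_image pathfinish_in_path_image by metis
  qed
qed

lemma arc_between_parameters:
  fixes g :: "real \<Rightarrow> 'a::topological_space"
  assumes g: "arc g" and rt: "r \<in> {0..1}" "t \<in> {0..1}" "r \<noteq> t"
  obtains h where "arc h" "pathstart h = g r" "pathfinish h = g t"
    "path_image h = g ` closed_segment r t"
proof
  define \<phi> where "\<phi> = (\<lambda>u. (1 - u) *\<^sub>R r + u *\<^sub>R t)"
  have img: "\<phi> ` {0..1} = closed_segment r t"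
    by (auto simp: \<phi>_def closed_segment_def)
  moreover have seg: "closed_segment r t \<subseteq> {0..1}"
    using rt by (simp add: closed_segment_subset)
  ultimately have \<phi>: "\<phi> u \<in> {0..1}" if "u \<in> {0..1}" for u using that by blast
  have inj: "u = v" if "\<phi> u = \<phi> v" for u v
  proof -
    have "(u - v) * (t - r) = 0" using that by (simp add: \<phi>_def algebra_simps)
    then show ?thesis using rt(3) by simp
  qed
  have "continuous_on {0..1} \<phi>" unfolding \<phi>_def by (intro continuous_intros)
  then have "continuous_on {0..1} (g \<circ> \<phi>)"
    using g img seg by (intro continuous_on_compose)
      (auto simp: arc_def path_def intro: continuous_on_subset)
  then show "arc (g \<circ> \<phi>)"
    using inj \<phi> arcD[OF g] by (auto simp: arc_def path_def inj_on_def)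
  show "pathstart (g \<circ> \<phi>) = g r" "pathfinish (g \<circ> \<phi>) = g t"
    by (auto simp: pathstart_def pathfinish_def \<phi>_def)
  show "path_image (g \<circ> \<phi>) = g ` closed_segment r t"
    unfolding path_image_def img[symmetric] by (rule image_comp[symmetric])
qed

text \<open>
  Pulled back to the parameter interval, a connected subset of an arc is an interval.
\<close>

lemma connected_subset_arc:
  fixes g :: "real \<Rightarrow> 'a::t2_space"
  assumes g: "arc g" and C: "C \<subseteq> path_image g" "connected C"
    and rt: "r \<in> {0..1}" "t \<in> {0..1}" "g r \<in> C" "g t \<in> C"
  shows "g ` closed_segment r t \<subseteq> C"
proof -
  obtain k where k: "homeomorphism {0..1} (path_image g) g k"
    using g homeomorphism_compact[of "{0..1::real}" g "path_image g"]
    by (auto simp: arc_def path_def path_image_def)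
  have "continuous_on C k"
    using k C(1) by (meson continuous_on_subset homeomorphism_def)
  then have "connected (k ` C)" using C(2) by (rule connected_continuous_image)
  then have "convex (k ` C)" by (simp add: is_interval_connected_1 flip: is_interval_convex_1)
  moreover have "k (g r) = r" "k (g t) = t"
    using k rt by (auto simp: homeomorphism_def)
  ultimately have "closed_segment r t \<subseteq> k ` C"
    using rt by (metis closed_segment_subset imageI)
  then have "g ` closed_segment r t \<subseteq> g ` k ` C" by blast
  also have "\<dots> = C"
    using k C(1) by (force simp: homeomorphism_def image_image subset_iff)
  finally show ?thesis .
qed

lemma uniquely_arc_connected_arc:
  assumes g: "arc g"
  shows "uniquely_arc_connected (path_image g)"
  unfolding uniquely_arc_connected_def
proof (intro ballI impI)
  fix x y assume "x \<in> path_image g" "y \<in> path_image g" and ne: "x \<noteq> y"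
  then obtain r t where r: "r \<in> {0..1}" "x = g r" and t: "t \<in> {0..1}" "y = g t"
    by (auto simp: path_image_def)
  obtain h where h: "arc h" "pathstart h = x" "pathfinish h = y"
    "path_image h = g ` closed_segment r t"
    using arc_between_parameters[OF g, of r t] r t ne by metis
  have "path_image h = seg (path_image g) x y"
  proof (rule arc_eq_seg[OF h(1) _ h(2,3)])
    have "closed_segment r t \<subseteq> {0..1}"
      using r t by (simp add: closed_segment_subset)
    then show "path_image h \<subseteq> path_image g"
      unfolding h(4) by (simp only: path_image_def image_mono)
    fix C assume C: "C \<subseteq> path_image g" "connected C" "x \<in> C" "y \<in> C"
    show "path_image h \<subseteq> C"
      unfolding h(4) using connected_subset_arc[OF g C(1,2), of r t] C(3,4) r t by auto
  qed
  then show "\<exists>h. arc h \<and> pathstart h = x \<and> pathfinish h = y \<and> path_image h = seg (path_image g) x y"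
    using h by blast
qed

text \<open>
  The map that collapses \<open>Z\<close> to the common point \<open>s\<close> and fixes \<open>Y\<close> is continuous, and it maps a connected
  set through \<open>s\<close> onto its part in \<open>Y\<close>. A connected set that avoids \<open>s\<close> stays on one side.
\<close>

lemma connected_one_point_union:
  fixes Y Z :: "'a::t2_space set"
  assumes "closed Y" "closed Z" and s: "Y \<inter> Z = {s}"
    and C: "C \<subseteq> Y \<union> Z" "connected C"
  shows "connected (C \<inter> Y)"
    and "x \<in> C \<inter> Y \<Longrightarrow> y \<in> C \<inter> Z \<Longrightarrow> s \<in> C"
proof -
  have sC: "s \<in> C" if "x \<in> C \<inter> Y" "y \<in> C \<inter> Z" for x y
  proof (rule ccontr)
    assume "s \<notin> C"
    then have "Y \<inter> Z \<inter> C = {}" using s by auto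
    then show False
      using connected_closedD[OF C(2) _ C(1) assms(1,2)] that by auto
  qed
  then show "x \<in> C \<inter> Y \<Longrightarrow> y \<in> C \<inter> Z \<Longrightarrow> s \<in> C" .
  define \<rho> where "\<rho> = (\<lambda>x. if x \<in> Y then x else s)"
  show "connected (C \<inter> Y)"
  proof (cases "s \<in> C")
    case True
    have "continuous_on (Y \<union> Z) (\<lambda>x. if x \<in> Y then x else s)"
      using s by (intro continuous_on_cases assms) auto
    then have "connected (\<rho> ` C)"
      using C unfolding \<rho>_def by (meson connected_continuous_image continuous_on_subset)
    moreover have "\<rho> ` C = C \<inter> Y"
      using True s C(1) by (force simp: \<rho>_def image_iff)
    ultimately show ?thesis by simp
  next
    case False
    then have "C \<inter> Y = {} \<or> C \<inter> Y = C" using sC C(1) by blast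
    then show ?thesis using C(2) by auto
  qed
qed

lemma uniquely_arc_connected_one_point_union:
  fixes Y Z :: "'a::t2_space set"
  assumes T: "uniquely_arc_connected Y" "uniquely_arc_connected Z"
    and cl: "closed Y" "closed Z" and s: "Y \<inter> Z = {s}"
  shows "uniquely_arc_connected (Y \<union> Z)"
proof -
  let ?P = "\<lambda>x y. \<exists>g. arc g \<and> pathstart g = x \<and> pathfinish g = y \<and> path_image g = seg (Y \<union> Z) x y"
  have same: "?P x y" if T: "uniquely_arc_connected A" "A \<union> B = Y \<union> Z" "closed A" "closed B" "A \<inter> B = {s}"
    and xy: "x \<in> A" "y \<in> A" "x \<noteq> y" for A B x y
  proof -
    obtain g where g: "arc g" "pathstart g = x" "pathfinish g = y" "path_image g = seg A x y"
      using T(1) xy unfolding uniquely_arc_connected_def by blast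
    have "path_image g = seg (Y \<union> Z) x y"
    proof (rule arc_eq_seg[OF g(1) _ g(2,3)])
      show "path_image g \<subseteq> Y \<union> Z" using g(4) T(2) seg_subset_space[of A x y] by auto
      fix C assume C: "C \<subseteq> Y \<union> Z" "connected C" "x \<in> C" "y \<in> C"
      have "connected (C \<inter> A)"
        using connected_one_point_union(1)[OF T(3,4,5)] C T(2) by auto
      then show "path_image g \<subseteq> C"
        using g(4) segD[of _ A x y "C \<inter> A"] C xy by auto
    qed
    then show ?thesis using g by blast
  qed
  have mixed: "?P x y" if T: "uniquely_arc_connected A" "uniquely_arc_connected B"
    "A \<union> B = Y \<union> Z" "closed A" "closed B" "A \<inter> B = {s}"
    and xy: "x \<in> A" "y \<in> B" "x \<noteq> s" "y \<noteq> s" for A B x y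
  proof -
    have sAB: "s \<in> A" "s \<in> B" using T(6) by auto
    obtain g where g: "arc g" "pathstart g = x" "pathfinish g = s" "path_image g = seg A x s"
      using T(1) xy sAB unfolding uniquely_arc_connected_def by blast
    obtain h where h: "arc h" "pathstart h = s" "pathfinish h = y" "path_image h = seg B s y"
      using T(2) xy sAB unfolding uniquely_arc_connected_def by metis
    have sub: "path_image g \<subseteq> A" "path_image h \<subseteq> B"
      using g h by (auto simp: seg_subset_space)
    have a: "arc (g +++ h)"
      using g h sub T(6) by (intro arc_join) auto
    have "path_image (g +++ h) = seg (Y \<union> Z) x y"
    proof (rule arc_eq_seg[OF a])
      show "path_image (g +++ h) \<subseteq> Y \<union> Z"
        using sub T(3) g h by (auto simp: path_image_join)
      fix C assume C: "C \<subseteq> Y \<union> Z" "connected C" "x \<in> C" "y \<in> C"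
      have CA: "connected (C \<inter> A)"
        using connected_one_point_union(1)[OF T(4,5,6)] C T(3) by auto
      have CB: "connected (C \<inter> B)"
        using connected_one_point_union(1)[OF T(5,4), of s C] C T(3,6) by auto
      have "s \<in> C"
        using connected_one_point_union(2)[OF T(4,5,6), of C x y] C T(3) xy by auto
      then have "path_image g \<subseteq> C" "path_image h \<subseteq> C"
        using g(4) segD[of _ A x s "C \<inter> A"] h(4) segD[of _ B s y "C \<inter> B"] C xy CA CB sAB by auto
      then show "path_image (g +++ h) \<subseteq> C"
        using g h by (simp add: path_image_join)
    qed (use g h in auto)
    then show ?thesis using a g h by (metis pathfinish_join pathstart_join)
  qed
  show ?thesis
    unfolding uniquely_arc_connected_def
  proof (intro ballI impI)
    fix x y assume xy: "x \<in> Y \<union> Z" "y \<in> Y \<union> Z" "x \<noteq> y"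
    have sYZ: "s \<in> Y" "s \<in> Z" using s by auto
    consider "x \<in> Y" "y \<in> Y" | "x \<in> Z" "y \<in> Z" | "x \<in> Y" "y \<in> Z" "x \<noteq> s" "y \<noteq> s"
      | "x \<in> Z" "y \<in> Y" "x \<noteq> s" "y \<noteq> s"
      using xy sYZ by blast
    then show "?P x y"
    proof cases
      case 1 then show ?thesis using same[of Y Z] T cl s xy by auto
    next
      case 2 then show ?thesis using same[of Z Y] T cl s xy by auto
    next
      case 3 then show ?thesis using mixed[of Y Z] T cl s xy by auto
    next
      case 4 then show ?thesis using mixed[of Z Y] T cl s xy by auto
    qed
  qed
qed

text \<open>
  A maximal connected part of the graph with unique arcs is everything: some further edge meets it,
  either in one point, and then it can be attached, or in both ends, and then it closes up with an
  arc inside the part to a circle.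
\<close>

lemma uniquely_arc_connected_tree:
  fixes X :: "'a::t2_space set"
  assumes G: "finite G" "\<forall>g\<in>G. arc g" "X = (\<Union>g\<in>G. path_image g)"
    "\<forall>g\<in>G. \<forall>h\<in>G. g \<noteq> h \<longrightarrow>
        path_image g \<inter> path_image h
          \<subseteq> {pathstart g, pathfinish g} \<inter> {pathstart h, pathfinish h}"
    and X: "X \<noteq> {}" "connected X" "\<not> (\<exists>S\<subseteq>X. S homeomorphic sphere (0::complex) 1)"
  shows "uniquely_arc_connected X"
proof -
  define Y where "Y = (\<lambda>H. \<Union>g\<in>H. path_image (g :: real \<Rightarrow> 'a))"
  define P where "P = (\<lambda>H. H \<subseteq> G \<and> H \<noteq> {} \<and> uniquely_arc_connected (Y H))"
  have clG: "closed (path_image g)" if "g \<in> G" for g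
    using that G(2) by (simp add: arc_imp_path compact_imp_closed compact_path_image)
  have clY: "closed (Y H)" if "H \<subseteq> G" for H
    using that G(1) clG unfolding Y_def by (intro closed_UN) (auto intro: finite_subset)
  obtain g0 where g0: "g0 \<in> G" using X(1) G(3) by auto
  have "P {g0}"
    using g0 uniquely_arc_connected_arc G(2) by (auto simp: P_def Y_def)
  moreover have "\<forall>H. P H \<longrightarrow> card H < Suc (card G)"
    using G(1) unfolding P_def by (meson card_mono le_imp_less_Suc)
  ultimately obtain H where H: "P H" and max: "\<And>K. P K \<Longrightarrow> card K \<le> card H"
    using ex_has_greatest_nat[of P "{g0}" card "Suc (card G)"] by metis
  have HG: "H \<subseteq> G" using H by (simp add: P_def)
  have "H = G"
  proof (rule ccontr)
    assume "H \<noteq> G"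
    have split: "X = Y H \<union> Y (G - H)" using G(3) HG by (auto simp: Y_def)
    have "Y H \<inter> Y (G - H) \<noteq> {}"
    proof
      assume "Y H \<inter> Y (G - H) = {}"
      moreover have "Y H \<noteq> {}" "Y (G - H) \<noteq> {}"
        using H \<open>H \<noteq> G\<close> HG by (auto simp: P_def Y_def)
      ultimately show False
        using connected_closedD[OF X(2) _ _ clY[OF HG] clY[of "G - H"]] split by auto
    qed
    then obtain g s where g: "g \<in> G" "g \<notin> H" and s: "s \<in> path_image g" "s \<in> Y H"
      by (auto simp: Y_def)
    have int: "path_image g \<inter> Y H \<subseteq> {pathstart g, pathfinish g}"
    proof
      fix z assume "z \<in> path_image g \<inter> Y H"
      then obtain h where "h \<in> H" "z \<in> path_image g \<inter> path_image h" by (auto simp: Y_def)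
      moreover from this have "h \<in> G" "g \<noteq> h" using g HG by auto
      ultimately show "z \<in> {pathstart g, pathfinish g}" using G(4) g(1) by blast
    qed
    have arcg: "arc g" using g G(2) by auto
    have "\<exists>s. Y H \<inter> path_image g = {s}"
    proof (rule ccontr)
      assume no: "\<nexists>s. Y H \<inter> path_image g = {s}"
      have both: "pathstart g \<in> Y H" "pathfinish g \<in> Y H"
      proof -
        show "pathstart g \<in> Y H"
        proof (rule ccontr)
          assume "pathstart g \<notin> Y H"
          then have "Y H \<inter> path_image g = {pathfinish g}" using int s by blast
          then show False using no by blast
        qed
        show "pathfinish g \<in> Y H"
        proof (rule ccontr)
          assume "pathfinish g \<notin> Y H"
          then have "Y H \<inter> path_image g = {pathstart g}" using int s by blast
          then show False using no by blast
        qed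
      qed
      moreover have "pathfinish g \<noteq> pathstart g" using arcg by (rule arc_distinct_ends)
      ultimately obtain h where h: "arc h" "pathstart h = pathfinish g" "pathfinish h = pathstart g"
        "path_image h = seg (Y H) (pathfinish g) (pathstart g)"
        using H unfolding P_def uniquely_arc_connected_def by blast
      have hY: "path_image h \<subseteq> Y H" using h(4) seg_subset_space[of "Y H"] by simp
      have "simple_path (g +++ h)"
        using arcg h int hY by (intro simple_path_join_loop) auto
      then have "path_image (g +++ h) homeomorphic sphere (0::complex) 1"
        using h by (intro homeomorphic_simple_path_image_circle) auto
      moreover have "path_image (g +++ h) \<subseteq> X"
        using hY split g G(3) h(2) by (auto simp: path_image_join)
      ultimately show False using X(3) by blast
    qed
    then obtain s where "Y H \<inter> path_image g = {s}" by blast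
    then have "uniquely_arc_connected (Y H \<union> path_image g)"
      using H clY[OF HG] clG[OF g(1)] uniquely_arc_connected_arc[OF arcg]
      by (intro uniquely_arc_connected_one_point_union) (auto simp: P_def)
    moreover have "Y H \<union> path_image g = Y (insert g H)" by (auto simp: Y_def)
    ultimately have "P (insert g H)" using HG g by (auto simp: P_def)
    then have "card (insert g H) \<le> card H" by (rule max)
    moreover have "finite H" using HG G(1) by (rule finite_subset)
    ultimately show False using g(2) by simp
  qed
  then show ?thesis using H G(3) by (simp add: P_def Y_def)
qed

locale arc_tree =
  fixes X :: "'a::t2_space set"
  assumes unique_arcs: "uniquely_arc_connected X"
begin

lemma seg_arcE:
  assumes "x \<in> X" "y \<in> X" "x \<noteq> y"
  obtains g where "arc g" "g 0 = x" "g 1 = y" "g ` {0..1} = seg X x y"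
  using assms unique_arcs unfolding uniquely_arc_connected_def path_image_def pathstart_def pathfinish_def
  by blast

lemma seg_self [simp]: "x \<in> X \<Longrightarrow> seg X x x = {x}"
  by (auto simp: seg_def dest: spec[of _ "{x}"])

lemma seg_ends:
  assumes "x \<in> X" "y \<in> X"
  shows "x \<in> seg X x y" "y \<in> seg X x y"
  using assms by (auto simp: seg_def)

lemma seg_connected_compact:
  assumes "x \<in> X" "y \<in> X"
  shows "connected (seg X x y)" "compact (seg X x y)"
proof -
  have "connected (seg X x y) \<and> compact (seg X x y)"
  proof (cases "x = y")
    case False
    then obtain g where "arc g" "g ` {0..1} = seg X x y" using seg_arcE assms by metis
    then show ?thesis
      by (metis arc_imp_path compact_path_image connected_path_image path_image_def)
  qed (use assms in auto)
  then show "connected (seg X x y)" "compact (seg X x y)" by auto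
qed

lemma seg_subset:
  assumes "z \<in> seg X x y"
  shows "seg X x z \<subseteq> seg X x y"
  using assms by (auto simp: seg_def)

lemma seg_subset_right:
  assumes "z \<in> seg X x y"
  shows "seg X z y \<subseteq> seg X x y"
  using assms by (auto simp: seg_def)

lemma seg_trans: "y \<in> seg X a z \<Longrightarrow> z \<in> seg X a x \<Longrightarrow> y \<in> seg X a x"
  using seg_subset by blast

text \<open>
  A connected set joining \<open>g r\<close> to \<open>g t\<close> is extended by the outer pieces of the arc to one joining its
  ends, which contains the whole arc; and the outer pieces do not meet the inner one. Through this
  lemma the order along a segment becomes the order of real parameters.
\<close>

lemma seg_subarc:
  assumes g: "arc g" "g ` {0..1} = seg X (g 0) (g 1)" and rt: "0 \<le> r" "r \<le> t" "t \<le> 1"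
  shows "seg X (g r) (g t) = g ` {r..t}"
proof
  have cont: "continuous_on {0..1} g" using g(1) by (simp add: arc_def path_def)
  have sub: "g ` {u..v} \<subseteq> X" "connected (g ` {u..v})" if "0 \<le> u" "v \<le> 1" for u v
  proof -
    have "{u..v} \<subseteq> {0..1}" using that by auto
    then show "connected (g ` {u..v})" "g ` {u..v} \<subseteq> X"
      using cont g(2) seg_subset_space[of X "g 0" "g 1"]
      by (auto intro!: connected_continuous_image intro: continuous_on_subset)
  qed
  show "seg X (g r) (g t) \<subseteq> g ` {r..t}"
    using segD[of _ X "g r" "g t" "g ` {r..t}"] sub[of r t] rt by auto
  show "g ` {r..t} \<subseteq> seg X (g r) (g t)"
  proof
    fix z assume "z \<in> g ` {r..t}"
    then obtain u where u: "z = g u" "r \<le> u" "u \<le> t" by auto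
    show "z \<in> seg X (g r) (g t)"
    proof (rule segI)
      show "z \<in> X" using sub(1)[of r t] rt u by auto
      fix C assume C: "C \<subseteq> X" "connected C" "g r \<in> C" "g t \<in> C"
      have "connected (C \<union> g ` {0..r})"
        using C sub(2)[of 0 r] rt by (intro connected_Un) (auto intro: image_eqI[of _ _ r])
      then have "connected ((C \<union> g ` {0..r}) \<union> g ` {t..1})"
        using C sub(2)[of t 1] rt by (rule_tac connected_Un) auto
      moreover have "(C \<union> g ` {0..r}) \<union> g ` {t..1} \<subseteq> X"
        using C sub[of 0 r] sub[of t 1] rt by auto
      moreover have "z \<in> seg X (g 0) (g 1)" using u rt g(2) by auto
      ultimately have "z \<in> (C \<union> g ` {0..r}) \<union> g ` {t..1}"
        by (rule_tac segD) (use rt in auto)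
      moreover have "z \<in> C" if z: "z \<in> g ` {0..r}"
      proof -
        obtain w where w: "z = g w" "0 \<le> w" "w \<le> r" using z by auto
        have "g w = g u" using u(1) w(1) by simp
        then have "w = u" using arcD[OF g(1), of w u] w(2,3) u(2,3) rt by simp
        then have "u = r \<or> u = t" using w(2,3) u(2,3) by linarith
        then show ?thesis using u(1) C by blast
      qed
      moreover have "z \<in> C" if z: "z \<in> g ` {t..1}"
      proof -
        obtain w where w: "z = g w" "t \<le> w" "w \<le> 1" using z by auto
        have "g w = g u" using u(1) w(1) by simp
        then have "w = u" using arcD[OF g(1), of w u] w(2,3) u(2,3) rt by simp
        then have "u = r \<or> u = t" using w(2,3) u(2,3) by linarith
        then show ?thesis using u(1) C by blast
      qed
      ultimately show "z \<in> C" by blast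
    qed
  qed
qed

lemma arc_image_eq_seg:
  assumes "arc g" "path_image g \<subseteq> X"
  shows "path_image g = seg X (g 0) (g 1)"
proof (rule arc_eq_seg[OF assms])
  fix C assume C: "C \<subseteq> X" "connected C" "g 0 \<in> C" "g 1 \<in> C"
  let ?S = "seg X (g 0) (g 1)"
  have X: "g 0 \<in> X" "g 1 \<in> X" using assms(2) by (auto simp: path_image_def)
  have "?S \<subseteq> path_image g"
    using segD[of _ X "g 0" "g 1" "path_image g"] assms
    by (auto simp: arc_imp_path connected_path_image) (auto simp: path_image_def)
  then have "g ` closed_segment 0 1 \<subseteq> ?S"
    using connected_subset_arc[OF assms(1), of ?S 0 1] seg_connected_compact(1)[OF X] seg_ends[OF X]
    by simp
  moreover have "?S \<subseteq> C" using C segD by blast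
  ultimately show "path_image g \<subseteq> C"
    by (auto simp: path_image_def closed_segment_eq_real_ivl)
qed (auto simp: pathstart_def pathfinish_def)

text \<open>
  Removing \<open>c\<close> separates \<open>z\<close> from \<open>x\<close> or from \<open>y\<close>. Put the other way round, not being separated by \<open>c\<close> is
  transitive.
\<close>

lemma seg_split:
  assumes "c \<in> seg X x y" "c \<in> X"
  shows "c \<in> seg X x z \<or> c \<in> seg X z y"
proof (rule ccontr)
  assume "\<not> ?thesis"
  then obtain C D where "C \<subseteq> X" "connected C" "x \<in> C" "z \<in> C" "c \<notin> C"
    "D \<subseteq> X" "connected D" "z \<in> D" "y \<in> D" "c \<notin> D"
    using not_segE assms(2) by metis
  moreover from this have "connected (C \<union> D)" by (intro connected_Un) auto
  ultimately show False using segD[OF assms(1), of "C \<union> D"] by auto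
qed

lemma seg_antisym:
  assumes "x \<in> X" "z \<in> seg X x y" "y \<in> seg X x z"
  shows "y = z"
proof (rule ccontr)
  assume ne: "y \<noteq> z"
  have yz: "y \<in> X" "z \<in> X" using assms seg_subset_space by blast+
  have xy: "x \<noteq> y" using assms(1,2) ne by auto
  obtain g where g: "arc g" "g 0 = x" "g 1 = y" "g ` {0..1} = seg X x y"
    using seg_arcE[OF assms(1) yz(1) xy] by blast
  obtain t where t: "0 \<le> t" "t \<le> 1" "z = g t"
    using assms(2) unfolding g(4)[symmetric] by auto
  have "seg X (g 0) (g t) = g ` {0..t}" using g t by (intro seg_subarc) auto
  then obtain u where "0 \<le> u" "u \<le> t" "g 1 = g u" using assms(3) g(2,3) t by auto
  then have "u = 1" using arcD[OF g(1), of 1 u] t by auto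
  then show False using \<open>u \<le> t\<close> t g(3) ne by auto
qed

text \<open>
  For fixed \<open>a\<close>, the relation \<open>c \<in> seg X a d\<close> is a partial order of \<open>c\<close>, \<open>d\<close>. Counting
  predecessors turns maximal and minimal elements of finite sets into extrema of numbers.
\<close>

lemma seg_strict_inclusion_measure:
  assumes "finite D" "D \<subseteq> X" "d \<in> D" "c \<in> seg X a d" "d \<noteq> c" "a \<in> X"
  shows "card {x\<in>D. x \<in> seg X a c} < card {x\<in>D. x \<in> seg X a d}"
proof (rule psubset_card_mono)
  have "d \<notin> seg X a c" using assms seg_antisym by blast
  moreover have "d \<in> seg X a d" using assms seg_ends(2) by blast
  moreover have "seg X a c \<subseteq> seg X a d" using assms(4) by (rule seg_subset)
  ultimately show "{x\<in>D. x \<in> seg X a c} \<subset> {x\<in>D. x \<in> seg X a d}"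
    using assms(3) by auto
qed (use assms in auto)

lemma finite_seg_maximal:
  assumes "finite D" "D \<noteq> {}" "D \<subseteq> X" "a \<in> X"
  obtains c where "c \<in> D" "\<And>d. d \<in> D \<Longrightarrow> c \<in> seg X a d \<Longrightarrow> d = c"
proof -
  let ?f = "\<lambda>c. card {x\<in>D. x \<in> seg X a c}"
  have "Max (?f ` D) \<in> ?f ` D" using assms by (intro Max_in) auto
  then obtain c where c: "c \<in> D" "?f c = Max (?f ` D)" by auto
  show thesis
  proof (rule that[OF c(1)], rule ccontr)
    fix d assume d: "d \<in> D" "c \<in> seg X a d" "d \<noteq> c"
    then have "?f c < ?f d"
      using seg_strict_inclusion_measure[OF assms(1,3) d(1,2)] assms(4) by blast
    moreover have "?f d \<le> ?f c" using d(1) c(2) assms(1) by simp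
    ultimately show False by simp
  qed
qed

lemma finite_seg_minimal:
  assumes "finite D" "D \<noteq> {}" "D \<subseteq> X" "a \<in> X"
  obtains c where "c \<in> D" "\<And>d. d \<in> D \<Longrightarrow> d \<in> seg X a c \<Longrightarrow> d = c"
proof -
  let ?f = "\<lambda>c. card {x\<in>D. x \<in> seg X a c}"
  have "Min (?f ` D) \<in> ?f ` D" using assms by (intro Min_in) auto
  then obtain c where c: "c \<in> D" "?f c = Min (?f ` D)" by auto
  show thesis
  proof (rule that[OF c(1)], rule ccontr)
    fix d assume d: "d \<in> D" "d \<in> seg X a c" "d \<noteq> c"
    then have "?f d < ?f c"
      using seg_strict_inclusion_measure[OF assms(1,3) c(1) d(2)] assms(4) by blast
    moreover have "?f c \<le> ?f d" using d(1) c(2) assms(1) by simp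
    ultimately show False by simp
  qed
qed

text \<open>
  If the points \<open>a\<close>, \<open>y\<close>, \<open>v\<close> and the points \<open>y\<close>, \<open>z\<close>, \<open>v\<close> lie in these orders, then all four lie in the order
  \<open>a\<close>, \<open>y\<close>, \<open>z\<close>, \<open>v\<close>.
\<close>

lemma seg_between:
  assumes X: "a \<in> X" "v \<in> X" and z: "z \<in> seg X y v" and y: "y \<in> seg X a v"
  shows "y \<in> seg X a z"
proof (rule segI)
  show yX: "y \<in> X" using y seg_subset_space by blast
  have zX: "z \<in> X" using z seg_subset_space by blast
  fix C assume C: "C \<subseteq> X" "connected C" "a \<in> C" "z \<in> C"
  show "y \<in> C"
  proof (cases "y \<in> seg X z v")
    case True
    then have "y = z"
      using seg_antisym[of v z y] z X by (simp add: seg_commute)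
    then show ?thesis using C by simp
  next
    case False
    then obtain D where D: "D \<subseteq> X" "connected D" "z \<in> D" "v \<in> D" "y \<notin> D"
      using not_segE yX by metis
    have "connected (C \<union> D)" using C D by (intro connected_Un) auto
    then have "y \<in> C \<union> D" using segD[OF y, of "C \<union> D"] C D by auto
    then show ?thesis using D by auto
  qed
qed

lemma seg_linear:
  assumes X: "a \<in> X" "e \<in> X" and "y \<in> seg X a e" "z \<in> seg X a e"
  shows "y \<in> seg X a z \<or> z \<in> seg X a y"
proof (cases "a = e")
  case True then show ?thesis using assms by auto
next
  case False
  then obtain g where g: "arc g" "g 0 = a" "g 1 = e" "g ` {0..1} = seg X a e"
    using seg_arcE X by metis
  obtain r t where rt: "y = g r" "z = g t" "r \<in> {0..1}" "t \<in> {0..1}"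
    using assms g by (metis imageE)
  have "y \<in> seg X a z" if "r \<le> t"
    using seg_subarc[of g 0 t] that g rt by auto
  moreover have "z \<in> seg X a y" if "t \<le> r"
    using seg_subarc[of g 0 r] that g rt by auto
  ultimately show ?thesis using linear by blast
qed

text \<open>
  Two arcs that leave \<open>x\<close> towards points \<open>p\<close>, \<open>q\<close> not separated by \<open>x\<close> start with a common piece: the
  segment \<open>[p,q]\<close> is closed and misses \<open>x\<close>, so a point \<open>g t\<close> of \<open>[x,p]\<close> close to \<open>x\<close> is not on it; but every
  connected set from \<open>x\<close> to \<open>q\<close>, continued by \<open>[p,q]\<close>, must pass through \<open>g t\<close>.
\<close>

lemma seg_common_start:
  assumes X: "x \<in> X" "p \<in> X" "q \<in> X" and x: "x \<notin> seg X p q"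
  obtains g s where "arc g" "g 0 = x" "g 1 = p" "g ` {0..1} = seg X x p"
    "0 < s" "s \<le> 1" "\<And>t. 0 \<le> t \<Longrightarrow> t \<le> s \<Longrightarrow> g t \<in> seg X x q"
proof -
  have "x \<noteq> p" using x X seg_ends by blast
  then obtain g where g: "arc g" "g 0 = x" "g 1 = p" "g ` {0..1} = seg X x p"
    using seg_arcE X by metis
  let ?C = "seg X p q"
  have "open (- ?C)" using seg_connected_compact(2)[OF X(2,3)] compact_imp_closed by blast
  moreover have "continuous_on {0..1} g" using g(1) by (simp add: arc_def path_def)
  ultimately obtain A where A: "open A" "A \<inter> {0..1} = g -` (- ?C) \<inter> {0..1}"
    unfolding continuous_on_open_invariant by metis
  have "0 \<in> g -` (- ?C) \<inter> {0..1}" using x g(2) by simp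
  then have "0 \<in> A" using A(2) by blast
  then obtain e where e: "e > 0" "\<And>t. \<bar>t\<bar> < e \<Longrightarrow> t \<in> A"
    using A(1) unfolding open_dist dist_real_def by fastforce
  define s where "s = min 1 (e/2)"
  have s: "0 < s" "s \<le> 1" using e by (auto simp: s_def)
  have "g t \<in> seg X x q" if t: "0 \<le> t" "t \<le> s" for t
  proof (cases "t = 0")
    case True then show ?thesis using g X seg_ends by auto
  next
    case False
    have "t \<in> A" using e t by (auto simp: s_def)
    then have notin: "g t \<notin> ?C" using A(2) t s by auto
    have gt: "g t \<in> seg X x p" using g(4) t s by auto
    show ?thesis
    proof (rule segI)
      show "g t \<in> X" using gt seg_subset_space by blast
      fix D assume D: "D \<subseteq> X" "connected D" "x \<in> D" "q \<in> D"
      have "connected (D \<union> ?C)"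
        using D seg_connected_compact(1)[OF X(2,3)] seg_ends X by (intro connected_Un) auto
      then have "g t \<in> D \<union> ?C"
        using segD[OF gt, of "D \<union> ?C"] D seg_ends X seg_subset_space[of X p q] by auto
      then show "g t \<in> D" using notin by auto
    qed
  qed
  then show thesis using that g s by metis
qed

end

section \<open>Endpoints\<close>

text \<open>
  Near an endpoint the space is a half-open interval. An injective path passing through the
  endpoint would take some small positive height both before and after it.
\<close>

lemma endpoint_not_inside_arc:
  fixes X :: "'a::t2_space set"
  assumes e: "e \<in> endpoints X" and g: "arc g" "path_image g \<subseteq> X" "e = g t" "t \<in> {0..1}"
  shows "t = 0 \<or> t = 1"
proof (rule ccontr)
  assume "\<not> (t = 0 \<or> t = 1)"
  then have t: "0 < t" "t < 1" using g(4) by auto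
  obtain U h k where U: "openin (top_of_set X) U" "e \<in> U" "homeomorphism U {0..<1::real} h k" "h e = 0"
    using e by (auto simp: endpoints_def)
  obtain W where W: "open W" "U = X \<inter> W" using U(1) by (auto simp: openin_open)
  have cg: "continuous_on {0..1} g" using g(1) by (simp add: arc_def path_def)
  have "continuous_on {0<..<1} g" using cg by (rule continuous_on_subset) auto
  then have "open (g -` W \<inter> {0<..<1})"
    using W(1) continuous_on_open_vimage[of "{0<..<1}" g] by auto
  moreover have "t \<in> g -` W \<inter> {0<..<1}" using t U(2) W(2) g(3) by auto
  ultimately obtain d where d: "d > 0" "cball t d \<subseteq> g -` W \<inter> {0<..<1}"
    using open_contains_cball by blast
  have gU: "g s \<in> U" and s01: "s \<in> {0..1}" if "s \<in> {t-d..t+d}" for s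
  proof -
    have "s \<in> cball t d" using that by (auto simp: dist_real_def)
    then have s: "s \<in> g -` W \<inter> {0<..<1}" using d(2) by blast
    then show "s \<in> {0..1}" by auto
    then have "g s \<in> X" using g(2) by (auto simp: path_image_def)
    then show "g s \<in> U" using s W(2) by auto
  qed
  have hU: "continuous_on U h" "h ` U = {0..<1}" "\<And>x. x \<in> U \<Longrightarrow> k (h x) = x"
    using U(3) by (auto simp: homeomorphism_def)
  have cont: "continuous_on {t-d..t+d} (\<lambda>s. h (g s))"
  proof (rule continuous_on_compose2[OF hU(1)])
    show "continuous_on {t-d..t+d} g" using s01 by (intro continuous_on_subset[OF cg]) blast
    show "g ` {t-d..t+d} \<subseteq> U" using gU by blast
  qed
  have inj: "s = s'" if "h (g s) = h (g s')" "s \<in> {t-d..t+d}" "s' \<in> {t-d..t+d}" for s s'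
  proof -
    have "g s = g s'" using hU(3) gU that by metis
    then show ?thesis using arcD[OF g(1) _ s01[OF that(2)] s01[OF that(3)]] by simp
  qed
  have nonneg: "h (g s) \<ge> 0" if "s \<in> {t-d..t+d}" for s
    using gU[OF that] hU(2) by auto
  have h0: "h (g t) = 0" using U(4) g(3) by simp
  define c where "c = min (h (g (t-d))) (h (g (t+d)))"
  have pos: "h (g (t-d)) \<noteq> 0" "h (g (t+d)) \<noteq> 0"
    using inj[of "t-d" t] inj[of "t+d" t] h0 d(1) by auto
  then have c: "c > 0" "c \<le> h (g (t-d))" "c \<le> h (g (t+d))"
    using nonneg[of "t-d"] nonneg[of "t+d"] d(1) by (auto simp: c_def)
  obtain s1 where s1: "t-d \<le> s1" "s1 \<le> t" "h (g s1) = c"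
    using IVT2'[of "\<lambda>s. h (g s)" t c "t-d"] c h0 d(1) continuous_on_subset[OF cont] by auto
  obtain s2 where s2: "t \<le> s2" "s2 \<le> t+d" "h (g s2) = c"
    using IVT'[of "\<lambda>s. h (g s)" t c "t+d"] c h0 d(1) continuous_on_subset[OF cont] by auto
  have "s1 = s2" using inj[of s1 s2] s1 s2 d(1) by auto
  then have "s1 = t" using s1 s2 by auto
  then show False using s1 h0 c by auto
qed

context arc_tree
begin

lemma endpoint_not_between:
  assumes "e \<in> endpoints X" "e \<in> seg X x y" "x \<in> X" "y \<in> X"
  shows "e = x \<or> e = y"
proof (cases "x = y")
  case True then show ?thesis using assms by auto
next
  case False
  then obtain g where g: "arc g" "g 0 = x" "g 1 = y" "g ` {0..1} = seg X x y"
    using seg_arcE assms by metis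
  obtain t where t: "t \<in> {0..1}" "e = g t" using assms(2) unfolding g(4)[symmetric] by auto
  then show ?thesis
    using endpoint_not_inside_arc[OF assms(1) g(1) _ t(2,1)] g seg_subset_space[of X x y]
    by (auto simp: path_image_def)
qed

end

locale tree =
  fixes X :: "'a::t2_space set"
  assumes tree: "topological_tree X"
begin

sublocale arc_tree X
  using tree uniquely_arc_connected_tree[of _ X]
  unfolding arc_tree_def topological_tree_def topological_graph_def by blast

lemma finite_endpoints: "finite (endpoints X)"
proof -
  obtain G where G: "finite G" "\<forall>g\<in>G. arc g" "X = (\<Union>g\<in>G. path_image g)"
    using tree unfolding topological_tree_def topological_graph_def by blast
  have "endpoints X \<subseteq> (\<Union>g\<in>G. {g 0, g 1})"
  proof
    fix e assume e: "e \<in> endpoints X"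
    then have "e \<in> X" by (simp add: endpoints_def)
    then obtain g t where g: "g \<in> G" "e = g t" "t \<in> {0..1}" using G(3) by (auto simp: path_image_def)
    then have "t = 0 \<or> t = 1"
      using endpoint_not_inside_arc[OF e, of g t] G by blast
    then show "e \<in> (\<Union>g\<in>G. {g 0, g 1})" using g by auto
  qed
  then show ?thesis using G(1) by (meson finite.emptyI finite_UN finite_insert finite_subset)
qed

text \<open>
  If \<open>g\<close> is the only edge at \<open>x\<close>, then \<open>g\<close> without its other end is a neighbourhood of \<open>x\<close>, since the
  other edges form a closed set.
\<close>

lemma leaf_vertex_is_endpoint:
  assumes G: "finite G" "\<forall>g\<in>G. arc g" "X = (\<Union>g\<in>G. path_image g)"
    "\<forall>g\<in>G. \<forall>h\<in>G. g \<noteq> h \<longrightarrow>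
        path_image g \<inter> path_image h
          \<subseteq> {pathstart g, pathfinish g} \<inter> {pathstart h, pathfinish h}"
    and g: "g \<in> G" "x = pathstart g \<or> x = pathfinish g"
    and only: "\<And>h. h \<in> G \<Longrightarrow> x \<in> path_image h \<Longrightarrow> h = g"
  shows "x \<in> endpoints X"
proof -
  obtain c where c: "arc c" "c 0 = x" "path_image c = path_image g"
    "{c 0, c 1} = {pathstart g, pathfinish g}"
  proof (cases "x = pathstart g")
    case True
    then show ?thesis using that[of g] g G(2) by (simp add: pathstart_def pathfinish_def)
  next
    case False
    then show ?thesis
      using that[of "reversepath g"] g G(2) arc_reversepath[of g]
      by (auto simp: pathstart_def pathfinish_def reversepath_def
          path_image_reversepath[unfolded reversepath_def])
  qed
  obtain k where k: "homeomorphism {0..1} (path_image c) c k"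
    using c(1) homeomorphism_compact[of "{0..1::real}" c "path_image c"]
    by (auto simp: arc_def path_def path_image_def)
  define U where "U = path_image c - {c 1}"
  have U: "U = c ` {0..<1}"
  proof
    show "U \<subseteq> c ` {0..<1}"
    proof
      fix u assume "u \<in> U"
      then obtain v where v: "u = c v" "v \<in> {0..1}" "u \<noteq> c 1" by (auto simp: U_def path_image_def)
      then have "v \<noteq> 1" by auto
      then show "u \<in> c ` {0..<1}" using v by auto
    qed
    show "c ` {0..<1} \<subseteq> U"
      using arcD[OF c(1), of _ 1] by (force simp: U_def path_image_def)
  qed
  have "homeomorphism {0..<1} U c k"
    by (rule homeomorphism_of_subsets[OF k _ _ U[symmetric]]) (auto simp: U_def)
  then have hom: "homeomorphism U {0..<1} k c" by (rule homeomorphism_symD)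
  have "closed ((\<Union>h\<in>G-{g}. path_image h) \<union> {c 1})"
    using G(1,2) by (intro closed_Un closed_UN) (auto intro!: compact_imp_closed simp: arc_imp_path compact_path_image)
  moreover have "U = X \<inter> - ((\<Union>h\<in>G-{g}. path_image h) \<union> {c 1})"
  proof -
    have "path_image h \<inter> U = {}" if h: "h \<in> G" "h \<noteq> g" for h
    proof -
      have "path_image g \<inter> path_image h \<subseteq> {c 0, c 1}"
        using G(4) h g(1) c(4) by blast
      moreover have "c 0 \<notin> path_image h" using only h c(2) by blast
      ultimately show ?thesis using c(3) by (auto simp: U_def)
    qed
    then show ?thesis using G(3) g(1) c(3) unfolding U_def by blast
  qed
  ultimately have "openin (top_of_set X) U"
    by (metis openin_open_Int open_Compl)
  moreover have "x \<in> U" using U c(2) by force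
  moreover have "k x = 0" using k c(2) by (auto simp: homeomorphism_def)
  moreover have "x \<in> path_image c" using c(2) by (auto simp: path_image_def)
  then have "x \<in> X" using G(3) g(1) c(3) by blast
  ultimately show ?thesis using hom unfolding endpoints_def by blast
qed

text \<open>
  Among the vertices beyond \<open>y\<close>, seen from \<open>a\<close>, take one that is farthest. Two edges at it would lead to
  vertices not separated from \<open>a\<close> by it, hence not from each other, and then they would start with a
  common piece.
\<close>

lemma endpoint_beyond:
  assumes "a \<in> X" "y \<in> X" "a \<noteq> y"
  obtains e where "e \<in> endpoints X" "y \<in> seg X a e"
proof -
  obtain G where G: "finite G" "\<forall>g\<in>G. arc g" "X = (\<Union>g\<in>G. path_image g)"
    "\<forall>g\<in>G. \<forall>h\<in>G. g \<noteq> h \<longrightarrow>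
        path_image g \<inter> path_image h
          \<subseteq> {pathstart g, pathfinish g} \<inter> {pathstart h, pathfinish h}"
    using tree unfolding topological_tree_def topological_graph_def by blast
  have edge: "path_image g = seg X (g 0) (g 1)" "g 0 \<in> X" "g 1 \<in> X" if "g \<in> G" for g
  proof -
    have "path_image g \<subseteq> X" using that G(3) by blast
    then show "path_image g = seg X (g 0) (g 1)" "g 0 \<in> X" "g 1 \<in> X"
      using arc_image_eq_seg that G(2) by (auto simp: path_image_def)
  qed
  define V where "V = (\<Union>g\<in>G. {g 0, g 1})"
  have VX: "V \<subseteq> X" using edge by (auto simp: V_def)
  define D where "D = {x\<in>V. y \<in> seg X a x}"
  have beyond: "x \<in> D \<or> x' \<in> D" if "g \<in> G" "{x, x'} = {g 0, g 1}" "y \<in> path_image g" for g x x'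
  proof -
    have "y \<in> seg X (g 0) (g 1)" using edge that by blast
    then have "y \<in> seg X a (g 0) \<or> y \<in> seg X a (g 1)"
      using seg_split[OF _ assms(2)] seg_commute by metis
    then have "g 0 \<in> D \<or> g 1 \<in> D" using that(1) by (auto simp: D_def V_def)
    then show ?thesis using that(2) by (metis doubleton_eq_iff)
  qed
  obtain g where "g \<in> G" "y \<in> path_image g" using assms(2) G(3) by auto
  then have "D \<noteq> {}" using beyond[of g "g 0" "g 1"] by auto
  moreover have "finite D" using G(1) by (auto simp: D_def V_def)
  moreover have "D \<subseteq> X" using VX by (auto simp: D_def)
  ultimately obtain x where x: "x \<in> D" and max: "\<And>d. d \<in> D \<Longrightarrow> x \<in> seg X a d \<Longrightarrow> d = x"
    using finite_seg_maximal assms(1) by metis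
  have xX: "x \<in> X" using x VX by (auto simp: D_def)
  have no: "x \<notin> seg X a z" if "z \<in> V" "z \<noteq> x" for z
  proof
    assume *: "x \<in> seg X a z"
    then have "y \<in> seg X a z" using x seg_trans by (auto simp: D_def)
    then show False using max[of z] * that by (auto simp: D_def)
  qed
  obtain g where g: "g \<in> G" "x = g 0 \<or> x = g 1" using x by (auto simp: D_def V_def)
  have "h = g" if h: "h \<in> G" "x \<in> path_image h" for h
  proof (rule ccontr)
    assume ne: "h \<noteq> g"
    have xg: "x \<in> path_image g" using g by (auto simp: path_image_def)
    then have int: "path_image h \<inter> path_image g \<subseteq> {h 0, h 1}" and xh: "x = h 0 \<or> x = h 1"
      using G(4) h g(1) ne unfolding pathstart_def pathfinish_def by blast+
    define other where "other = (\<lambda>c. if x = c 0 then c 1 else c (0::real))"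
    have other: "path_image c = seg X x (other c)" "other c \<in> V" "other c \<noteq> x"
      if "c \<in> G" "x = c 0 \<or> x = c 1" for c
    proof -
      have "c 0 \<noteq> c 1" using arcD[of c 0 1] G(2) that(1) by auto
      then show "path_image c = seg X x (other c)" "other c \<in> V" "other c \<noteq> x"
        using edge(1)[OF that(1)] that seg_commute[of X "c 0" "c 1"] by (auto simp: other_def V_def)
    qed
    let ?p = "other h" and ?q = "other g"
    have "x \<notin> seg X ?p ?q"
      using no other[OF h(1) xh] other[OF g] seg_split[of x ?p ?q a] xX seg_commute by metis
    moreover have "?p \<in> X" "?q \<in> X" using other(2)[OF h(1) xh] other(2)[OF g] VX by auto
    ultimately obtain c s where c: "arc c" "c 0 = x" "c ` {0..1} = seg X x ?p" "0 < s" "s \<le> 1"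
      "\<And>t. 0 \<le> t \<Longrightarrow> t \<le> s \<Longrightarrow> c t \<in> seg X x ?q"
      using seg_common_start[OF xX] by metis
    have "c ` {0..s} \<subseteq> path_image h \<inter> path_image g"
      using c other(1)[OF h(1) xh] other(1)[OF g] by force
    then have "c ` {0..s} \<subseteq> {h 0, h 1}" using int by blast
    then have "finite (c ` {0..s})" by (rule finite_subset) auto
    moreover have "inj_on c {0..s}"
      by (rule inj_on_subset[OF arc_imp_inj_on[OF c(1)]]) (use c(5) in auto)
    ultimately have "finite {0..s}" using finite_imageD by blast
    then show False using c(4) infinite_Icc[of 0 s] by simp
  qed
  then have "x \<in> endpoints X"
    using leaf_vertex_is_endpoint[OF G g(1)] g(2) by (auto simp: pathstart_def pathfinish_def)
  then show thesis using that x by (auto simp: D_def)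
qed

lemma two_endpoints: "End X \<ge> 2"
proof -
  obtain G where G: "\<forall>g\<in>G. arc g" "X = (\<Union>g\<in>G. path_image g)" "X \<noteq> {}"
    using tree unfolding topological_tree_def topological_graph_def by blast
  then obtain g where "g \<in> G" by auto
  then have g: "g 0 \<in> X" "g 1 \<in> X" "g 0 \<noteq> g 1"
    using G(1,2) arcD[of g 0 1] by (fastforce simp: path_image_def)+
  obtain e where e: "e \<in> endpoints X" "g 1 \<in> seg X (g 0) e" using endpoint_beyond[OF g] .
  then have "e \<noteq> g 0" using g by auto
  then obtain e' where e': "e' \<in> endpoints X" "g 0 \<in> seg X e e'"
    using endpoint_beyond[of e "g 0"] g e(1) by (auto simp: endpoints_def)
  then have "e' \<noteq> e" using \<open>e \<noteq> g 0\<close> e(1) by (auto simp: endpoints_def)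
  then have "card {e, e'} = 2" by simp
  then show ?thesis
    using card_mono[OF finite_endpoints, of "{e, e'}"] e e' by (simp add: End_def)
qed

text \<open>
  Points below the same endpoint are comparable, so an antichain injects into the endpoints.
\<close>

lemma card_antichain_le_End:
  assumes "a \<in> X" "M \<subseteq> X" "a \<notin> M"
    and anti: "\<And>y z. y \<in> M \<Longrightarrow> z \<in> M \<Longrightarrow> y \<in> seg X a z \<Longrightarrow> y = z"
  shows "card M \<le> End X"
proof -
  have "\<forall>y\<in>M. \<exists>e. e \<in> endpoints X \<and> y \<in> seg X a e"
    using endpoint_beyond assms(1-3) by (metis subsetD)
  then obtain E where E: "\<And>y. y \<in> M \<Longrightarrow> E y \<in> endpoints X \<and> y \<in> seg X a (E y)" by metis
  have "inj_on E M"
  proof (rule inj_onI)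
    fix y z assume "y \<in> M" "z \<in> M" "E y = E z"
    then show "y = z"
      using seg_linear[of a "E y" y z] E[of y] E[of z] assms anti
      by (auto simp: endpoints_def)
  qed
  then show ?thesis
    using E finite_endpoints unfolding End_def by (intro card_inj_on_le[of E]) auto
qed

end

section \<open>A point that separates a cycle from its own image\<close>

locale arc_tree_map = arc_tree X for X :: "'a::t2_space set" +
  fixes f :: "'a \<Rightarrow> 'a"
  assumes cont: "continuous_on X f" and maps: "f \<in> X \<rightarrow> X"
begin

lemma image_in: "x \<in> X \<Longrightarrow> f x \<in> X" using maps by auto

text \<open>
  The points \<open>z\<close> with \<open>z \<in> [p, f z]\<close> are those that \<open>f\<close> moves away from \<open>p\<close>, or fixes. Along an arc
  starting in \<open>p\<close> there is a last one. For if the supremum \<open>c\<close> were not moved outwards, then \<open>[p, f c]\<close>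
  would keep a distance from \<open>c\<close>, and \<open>[p, f c]\<close> together with the image of the short arc
  from a nearby point to \<open>c\<close> would join \<open>p\<close> to the image of that point without meeting the point.
\<close>

lemma last_point_moved_outwards:
  assumes p: "p \<in> X" "x \<in> X"
  obtains c where "c \<in> seg X p x" "c \<in> seg X p (f c)"
    "\<And>z. z \<in> seg X p x \<Longrightarrow> z \<in> seg X p (f z) \<Longrightarrow> z \<in> seg X p c"
proof (cases "p = x")
  case True
  then show thesis using that[of p] p image_in seg_ends by auto
next
  case False
  then obtain g where g: "arc g" "g 0 = p" "g 1 = x" "g ` {0..1} = seg X p x"
    using seg_arcE p by metis
  have gX: "g t \<in> X" if "t \<in> {0..1}" for t
    using g(4) that seg_subset_space[of X p x] by auto
  have cg: "continuous_on {0..1} g" using g(1) by (simp add: arc_def path_def)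
  define A where "A = {t\<in>{0..1}. g t \<in> seg X p (f (g t))}"
  have A0: "0 \<in> A" using g(2) p image_in seg_ends by (auto simp: A_def)
  have bdd: "bdd_above A" by (auto simp: A_def bdd_above_def)
  define s where "s = Sup A"
  have "0 \<le> s" using cSup_upper[OF A0 bdd] by (simp add: s_def)
  moreover have "s \<le> 1" unfolding s_def
    by (rule cSup_least) (use A0 in \<open>auto simp only: A_def mem_Collect_eq atLeastAtMost_iff\<close>)
  ultimately have s01: "s \<in> {0..1}" by simp
  have "s \<in> A"
  proof (rule ccontr)
    assume "s \<notin> A"
    let ?c = "g s"
    let ?C = "seg X p (f ?c)"
    have cX: "?c \<in> X" "f ?c \<in> X" using gX s01 image_in by auto
    have c: "?c \<notin> ?C" using \<open>s \<notin> A\<close> s01 by (simp add: A_def)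
    then have "?c \<noteq> f ?c" using seg_ends(2)[OF p(1) cX(2)] by auto
    then obtain O1 O2 where O: "open O1" "open O2" "?c \<in> O1" "f ?c \<in> O2" "O1 \<inter> O2 = {}"
      using hausdorff by metis
    have cfg: "continuous_on {0..1} (\<lambda>t. f (g t))"
      using gX by (intro continuous_on_compose2[OF cont cg]) auto
    have "open (O1 - ?C)"
      using O(1) seg_connected_compact(2)[OF p(1) cX(2)] by (simp add: compact_imp_closed open_Diff)
    then have "eventually (\<lambda>t. g t \<in> O1 - ?C) (at s within {0..1})"
      using cg c O(3) s01 by (intro topological_tendstoD[of g "g s"]) (auto simp: continuous_on_def)
    moreover have "eventually (\<lambda>t. f (g t) \<in> O2) (at s within {0..1})"
      using cfg O s01 by (intro topological_tendstoD[of _ "f (g s)"]) (auto simp: continuous_on_def)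
    ultimately have "eventually (\<lambda>t. g t \<in> O1 - ?C \<and> f (g t) \<in> O2) (at s within {0..1})"
      by (rule eventually_conj)
    then obtain d where d: "d > 0"
      "\<And>t. t \<in> {0..1} \<Longrightarrow> t \<noteq> s \<Longrightarrow> dist t s < d \<Longrightarrow> g t \<in> O1 - ?C \<and> f (g t) \<in> O2"
      unfolding eventually_at by blast
    have near: "g t \<in> O1 - ?C \<and> f (g t) \<in> O2" if "t \<in> {0..1}" "dist t s < d" for t
      using d(2)[of t] that O c by (cases "t = s") auto
    have "s - d < Sup A" using d(1) by (simp add: s_def)
    then obtain t where t: "t \<in> A" "s - d < t" using less_cSupE[of "s - d" A] A0 by blast
    have ts: "t \<le> s" using t(1) bdd cSup_upper by (simp add: s_def)
    have t01: "{t..s} \<subseteq> {0..1}" using t(1) s01 by (auto simp: A_def)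
    let ?K = "?C \<union> (\<lambda>t. f (g t)) ` {t..s}"
    have "connected ?K"
    proof (rule connected_Un)
      show "connected ?C" using seg_connected_compact(1)[OF p(1) cX(2)] .
      show "connected ((\<lambda>t. f (g t)) ` {t..s})"
        using t01 by (intro connected_continuous_image continuous_on_subset[OF cfg]) auto
      have "f ?c \<in> (\<lambda>t. f (g t)) ` {t..s}" using ts by auto
      then show "?C \<inter> (\<lambda>t. f (g t)) ` {t..s} \<noteq> {}" using seg_ends(2)[OF p(1) cX(2)] by blast
    qed
    moreover have "?K \<subseteq> X" using seg_subset_space t01 gX image_in by fastforce
    moreover have "p \<in> ?K" using seg_ends(1)[OF p(1) cX(2)] by blast
    moreover have "f (g t) \<in> ?K" using ts by auto
    moreover have "g t \<in> seg X p (f (g t))" using t(1) by (simp add: A_def)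
    ultimately have "g t \<in> ?K" by (rule_tac segD)
    moreover have "g t \<in> O1 - ?C" using near[of t] t ts t01 by (auto simp: dist_real_def)
    moreover have "f (g u) \<in> O2" if "u \<in> {t..s}" for u
      using near[of u] t01 that t(2) by (auto simp: dist_real_def)
    ultimately show False using O(5) by auto
  qed
  show thesis
  proof (rule that)
    show "g s \<in> seg X p x" using s01 g(4) by auto
    show "g s \<in> seg X p (f (g s))" using \<open>s \<in> A\<close> by (simp add: A_def)
    fix z assume z: "z \<in> seg X p x" "z \<in> seg X p (f z)"
    then obtain t where t: "z = g t" "t \<in> {0..1}" unfolding g(4)[symmetric] by auto
    then have "t \<in> A" using z by (simp add: A_def)
    then have "t \<le> s" using bdd cSup_upper by (simp add: s_def)
    then show "z \<in> seg X p (g s)"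
      using seg_subarc[of g 0 s] g t s01 by auto
  qed
qed

text \<open>
  If \<open>f\<close> moves \<open>c\<close> outwards in the direction of \<open>x\<close>, it also moves the points slightly beyond \<open>c\<close> outwards:
  they stay on the near side of a barrier \<open>b\<close> shortly after \<open>c\<close>, and their images stay beyond \<open>b\<close>.
\<close>

lemma moved_outwards_further:
  assumes p: "p \<in> X" "c \<in> X" "x \<in> X"
    and c: "c \<in> seg X p (f c)" "c \<notin> seg X (f c) x"
  obtains z where "z \<in> seg X p x" "z \<in> seg X p (f z)" "c \<in> seg X p z" "z \<noteq> c"
proof -
  have fc: "f c \<in> X" using p image_in by auto
  have cx: "c \<in> seg X p x"
    using seg_split[OF c(1) p(2), of x] c(2) seg_commute by metis
  obtain g s where g: "arc g" "g 0 = c" "g 1 = f c" "g ` {0..1} = seg X c (f c)"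
    and s: "0 < s" "s \<le> 1" "\<And>t. 0 \<le> t \<Longrightarrow> t \<le> s \<Longrightarrow> g t \<in> seg X c x"
    using seg_common_start[OF p(2) fc p(3) c(2)] by metis
  have gX: "g t \<in> X" if "t \<in> {0..1}" for t
    using g(4) that seg_subset_space[of X c "f c"] by auto
  have cg: "continuous_on {0..1} g" using g(1) by (simp add: arc_def path_def)
  have cfg: "continuous_on {0..1} (\<lambda>t. f (g t))"
    using gX by (intro continuous_on_compose2[OF cont cg]) auto
  \<comment> \<open>With \<open>s/2\<close> in place of \<open>s\<close> the barrier \<open>b\<close> differs from \<open>f c\<close> even for \<open>s = 1\<close>.\<close>
  define b where "b = g (s/2)"
  have b: "b \<in> seg X c (f c)" using s g(4) by (auto simp: b_def)
  have "b \<noteq> f c" using arcD[OF g(1), of "s/2" 1] s g by (auto simp: b_def)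
  then have "eventually (\<lambda>t. f (g t) \<in> - {b}) (at 0 within {0..1})"
    using cfg g(2) by (intro topological_tendstoD[of _ "f (g 0)"]) (auto simp: continuous_on_def)
  then obtain d where d: "d > 0"
    "\<And>t. t \<in> {0..1} \<Longrightarrow> t \<noteq> 0 \<Longrightarrow> dist t 0 < d \<Longrightarrow> f (g t) \<in> - {b}"
    unfolding eventually_at by blast
  have near: "f (g t) \<noteq> b" if "t \<in> {0..1}" "t < d" for t
    using d(2)[of t] that \<open>b \<noteq> f c\<close> g(2) by (cases "t = 0") auto
  define r where "r = min (s/2) (d/2)"
  have r: "0 < r" "r \<le> s/2" "r < d" "r \<le> 1" using s d(1) by (auto simp: r_def)
  let ?z = "g r"
  have zX: "?z \<in> X" "f ?z \<in> X" using gX r image_in by auto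
  have pb: "b \<in> seg X p (f c)"
    using seg_subset[of c "f c" p] b c(1) seg_commute by blast
  have "b \<in> seg X p (f ?z)"
  proof (rule segI)
    show "b \<in> X" using b seg_subset_space by blast
    fix D assume D: "D \<subseteq> X" "connected D" "p \<in> D" "f ?z \<in> D"
    let ?F = "(\<lambda>t. f (g t)) ` {0..r}"
    have sub: "{0..r} \<subseteq> {0..1}" using r by auto
    have "connected ?F" by (intro connected_continuous_image continuous_on_subset[OF cfg sub]) auto
    moreover have "f ?z \<in> ?F" using r by auto
    ultimately have "connected (D \<union> ?F)" using D by (rule_tac connected_Un) auto
    moreover have "f c \<in> ?F" using g(2) r by force
    moreover have "?F \<subseteq> X" using gX image_in sub by auto
    ultimately have "b \<in> D \<union> ?F" using segD[OF pb, of "D \<union> ?F"] D by auto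
    moreover have "b \<notin> ?F"
    proof
      assume "b \<in> ?F"
      then obtain t where "b = f (g t)" "t \<in> {0..r}" by auto
      then show False using near[of t] sub r by auto
    qed
    ultimately show "b \<in> D" by auto
  qed
  have cb: "c \<in> seg X p b" using seg_between[OF p(1) fc b c(1)] .
  have z: "?z \<in> seg X c (f c)" using g(4) r by auto
  have "?z \<in> seg X c b" using seg_subarc[of g 0 "s/2"] g s r by (auto simp: b_def)
  then have "?z \<in> seg X p b" using cb seg_subset[of c b p] seg_commute by blast
  show thesis
  proof (rule that)
    show "?z \<in> seg X p x"
      using s(3)[of r] r s seg_subset_right[OF cx] by auto
    show "?z \<in> seg X p (f ?z)"
      using \<open>?z \<in> seg X p b\<close> \<open>b \<in> seg X p (f ?z)\<close> seg_trans by blast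
    show "c \<in> seg X p ?z" using seg_between[OF p(1) fc z c(1)] .
    show "?z \<noteq> c" using arcD[OF g(1), of r 0] r g(2) by auto
  qed
qed

text \<open>
  Span \<open>P\<close> by the segments from one of its points \<open>p\<close>, and let \<open>a\<close> be a maximal point of this hull that
  is moved outwards. By maximality \<open>f a\<close> does not lie in the direction of any point of \<open>P\<close>; in
  other words, \<open>a\<close> is a fixed point of \<open>f\<close> followed by the retraction to the hull.
\<close>

lemma separating_point:
  assumes P: "finite P" "P \<noteq> {}" "P \<subseteq> X" "f ` P \<subseteq> P" "\<And>x. x \<in> P \<Longrightarrow> f x \<noteq> x"
  obtains a where "a \<in> X" "a \<notin> P" "\<And>x. x \<in> P \<Longrightarrow> a \<in> seg X (f a) x"
    "\<exists>x\<in>P. \<exists>x'\<in>P. a \<in> seg X x x'"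
proof -
  obtain p where p: "p \<in> P" "p \<in> X" using P by auto
  define Q where "Q = (\<lambda>c x. c \<in> seg X p x \<and> c \<in> seg X p (f c) \<and>
    (\<forall>z. z \<in> seg X p x \<longrightarrow> z \<in> seg X p (f z) \<longrightarrow> z \<in> seg X p c))"
  have "\<exists>c. Q c x" if "x \<in> P" for x
    unfolding Q_def
    by (rule last_point_moved_outwards[OF p(2), of x]) (use that P(3) in blast)+
  then have "\<forall>x\<in>P. \<exists>c. Q c x" by blast
  then obtain m where m: "\<And>x. x \<in> P \<Longrightarrow> Q (m x) x" by metis
  have "m ` P \<subseteq> X" using m seg_subset_space unfolding Q_def by blast
  then obtain a where a: "a \<in> m ` P" and max: "\<And>d. d \<in> m ` P \<Longrightarrow> a \<in> seg X p d \<Longrightarrow> d = a"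
    using finite_seg_maximal[of "m ` P" p] P p by blast
  obtain y where y: "y \<in> P" "a = m y" using a by auto
  have aX: "a \<in> X" using a \<open>m ` P \<subseteq> X\<close> by auto
  have am: "a \<in> seg X p y" "a \<in> seg X p (f a)" using m[OF y(1)] y(2) by (auto simp: Q_def)
  have sep: "a \<in> seg X (f a) x" if x: "x \<in> P" for x
  proof (rule ccontr)
    assume "a \<notin> seg X (f a) x"
    moreover have "x \<in> X" using P(3) x by blast
    ultimately obtain z where z: "z \<in> seg X p x" "z \<in> seg X p (f z)" "a \<in> seg X p z" "z \<noteq> a"
      using moved_outwards_further[OF p(2) aX _ am(2)] by metis
    have "z \<in> seg X p (m x)" using m[OF x] z by (auto simp: Q_def)
    moreover from this have "a \<in> seg X p (m x)" using z(3) seg_trans by blast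
    ultimately have "z \<in> seg X p a" using max[of "m x"] x by auto
    then show False using seg_antisym[OF p(2) z(3)] z(4) by metis
  qed
  have "a \<notin> P"
  proof
    assume "a \<in> P"
    then have "f a \<in> P" "f a \<in> X" using P(3,4) by auto
    then have "a \<in> seg X (f a) (f a)" using sep by blast
    then show False using P(5)[OF \<open>a \<in> P\<close>] \<open>f a \<in> X\<close> by auto
  qed
  then show thesis using that aX sep am(1) p(1) y(1) by blast
qed

end

section \<open>Cycles and least periods\<close>

lemma card_orbit_least_period:
  assumes d: "0 < d" "(f ^^ d) x = x" and least: "\<And>j. 0 < j \<Longrightarrow> j < d \<Longrightarrow> (f ^^ j) x \<noteq> x"
  shows "card (orbit f x) = d"
proof -
  have "inj_on (\<lambda>i. (f ^^ i) x) {..<d}"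
  proof (rule linorder_inj_onI')
    fix i j assume "i \<in> {..<d}" "j \<in> {..<d}" and ij: "i < j"
    show "(f ^^ i) x \<noteq> (f ^^ j) x"
    proof
      assume eq: "(f ^^ i) x = (f ^^ j) x"
      have "(f ^^ (d - j + i)) x = (f ^^ (d - j)) ((f ^^ j) x)" by (simp add: funpow_add eq)
      also have "\<dots> = (f ^^ (d - j + j)) x" by (simp add: funpow_add)
      also have "\<dots> = x" using \<open>j \<in> {..<d}\<close> d(2) by simp
      finally have "(f ^^ (d - j + i)) x = x" .
      moreover have "0 < d - j + i" "d - j + i < d" using ij \<open>j \<in> {..<d}\<close> by simp_all
      note least[OF this]
      ultimately show False by contradiction
    qed
  qed
  moreover have "orbit f x = (\<lambda>i. (f ^^ i) x) ` {..<d}"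
    using orbit_altdef_bounded[OF d(2,1)] by auto
  ultimately show ?thesis by (simp add: card_image)
qed

lemma funpow_in:
  assumes "f \<in> X \<rightarrow> X" "x \<in> X"
  shows "(f ^^ i) x \<in> X"
  using assms by (induction i) auto

lemma cycle_periodsI:
  assumes "f \<in> X \<rightarrow> X" "x \<in> X" "0 < d" "(f ^^ d) x = x"
    and "\<And>j. 0 < j \<Longrightarrow> j < d \<Longrightarrow> (f ^^ j) x \<noteq> x"
  shows "d \<in> cycle_periods X f"
proof -
  have orb: "orbit f x = {(f ^^ m) x |m. m < d}"
    using assms by (intro orbit_altdef_bounded) auto
  have "x \<in> orbit f x" unfolding orb using assms(3) by (auto intro: exI[of _ 0])
  moreover have "orbit f x \<subseteq> X" using funpow_in[OF assms(1,2)] by (auto simp: orb)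
  ultimately show ?thesis
    using card_orbit_least_period[OF assms(3-5)]
    unfolding cycle_periods_def cyclic_on_def by blast
qed

lemma cycle_periodsE:
  assumes "n \<in> cycle_periods X f"
  obtains x where "x \<in> X" "0 < n" "(f ^^ n) x = x" "\<And>j. 0 < j \<Longrightarrow> j < n \<Longrightarrow> (f ^^ j) x \<noteq> x"
    "orbit f x \<subseteq> X"
proof -
  obtain x where x: "x \<in> orbit f x" "orbit f x \<subseteq> X" "n = card (orbit f x)"
    using assms by (auto simp: cycle_periods_def cyclic_on_def)
  let ?Q = "\<lambda>d. 0 < d \<and> (f ^^ d) x = x"
  define d where "d = (LEAST d. ?Q d)"
  have "\<exists>d. ?Q d" using x(1) by (auto simp: orbit_altdef)
  then have d: "?Q d" unfolding d_def by (rule LeastI_ex)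
  have least: "(f ^^ j) x \<noteq> x" if "0 < j" "j < d" for j
    using not_less_Least[of j ?Q] that by (auto simp: d_def)
  have "n = d" using card_orbit_least_period[of d f x] d least x(3) by auto
  then show thesis using that[of x] d least x by blast
qed

lemma least_period_dvd:
  assumes "(f ^^ m) x = x" "0 < j" "j < m" "(f ^^ j) x = x"
  obtains d where "0 < d" "d dvd m" "d < m" "(f ^^ d) x = x"
proof -
  let ?Q = "\<lambda>d. 0 < d \<and> (f ^^ d) x = x"
  define d where "d = (LEAST d. ?Q d)"
  have d: "?Q d" unfolding d_def by (rule LeastI[of ?Q j]) (use assms in auto)
  have dj: "d \<le> j" unfolding d_def by (rule Least_le) (use assms in auto)
  have "(f ^^ (m mod d)) x = x" using funpow_mod_eq[of d f x m] d assms(1) by auto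
  moreover have "m mod d < d" using d by simp
  ultimately have "m mod d = 0" using not_less_Least[of "m mod d" ?Q] by (auto simp: d_def)
  then show thesis using that[of d] d dj assms by auto
qed

section \<open>Monotone pullbacks along segments\<close>

text \<open>
  The Knaster--Tarski argument; the map may be discontinuous.
\<close>

lemma mono_unit_interval_fixpoint:
  fixes \<psi> :: "real \<Rightarrow> real"
  assumes range: "\<And>t. t \<in> {0..1} \<Longrightarrow> \<psi> t \<in> {0..1}"
    and mono: "\<And>s t. s \<in> {0..1} \<Longrightarrow> t \<in> {0..1} \<Longrightarrow> s \<le> t \<Longrightarrow> \<psi> s \<le> \<psi> t"
  obtains t where "t \<in> {0..1}" "\<psi> t = t"
proof -
  define A where "A = {t\<in>{0..1}. t \<le> \<psi> t}"
  have A0: "0 \<in> A" using range[of 0] by (simp add: A_def)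
  have bdd: "bdd_above A" by (auto simp: A_def bdd_above_def)
  define s where "s = Sup A"
  have "0 \<le> s" using cSup_upper[OF A0 bdd] by (simp add: s_def)
  moreover have "s \<le> 1" unfolding s_def
    by (rule cSup_least) (use A0 in \<open>auto simp only: A_def mem_Collect_eq atLeastAtMost_iff\<close>)
  ultimately have s: "s \<in> {0..1}" by simp
  have "s \<le> \<psi> s"
    unfolding s_def
  proof (rule cSup_least)
    show "A \<noteq> {}" using A0 by auto
    fix t assume t: "t \<in> A"
    then have "t \<le> s" using cSup_upper[OF _ bdd] by (simp add: s_def)
    then have "\<psi> t \<le> \<psi> s" using mono[of t s] t s by (auto simp: A_def)
    then show "t \<le> \<psi> (Sup A)" using t by (auto simp: A_def s_def)
  qed
  then have "\<psi> s \<in> A" using mono[of s "\<psi> s"] range[OF s] s by (simp add: A_def)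
  then have "\<psi> s \<le> s" using cSup_upper[OF _ bdd] by (simp add: s_def)
  then show thesis using that[OF s] \<open>s \<le> \<psi> s\<close> by simp
qed

context arc_tree_map
begin

lemma iterate_in: "x \<in> X \<Longrightarrow> (f ^^ i) x \<in> X"
  using funpow_in[OF maps] .

text \<open>
  The points \<open>f p\<close>, \<open>p'\<close>, \<open>q'\<close>, \<open>f q\<close> lie in this order on one segment, so the image of \<open>[p,q]\<close> runs over
  \<open>[p',q']\<close> in the positive direction, from \<open>p'\<close> to \<open>q'\<close>.
\<close>

definition covers :: "'a \<Rightarrow> 'a \<Rightarrow> 'a \<Rightarrow> 'a \<Rightarrow> bool" where
  "covers p q p' q' \<longleftrightarrow> p' \<in> seg X (f p) (f q) \<and> q' \<in> seg X p' (f q)"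

text \<open>
  A choice of preimages under \<open>f ^^ m\<close> in \<open>[p,q]\<close> for the points of \<open>[p',q']\<close>, monotone with respect to the
  orders towards \<open>q\<close> and \<open>q'\<close>. The predicate \<open>R\<close> records where the chosen orbits travel. The choice
  is in general discontinuous.
\<close>

definition pullback :: "nat \<Rightarrow> 'a \<Rightarrow> 'a \<Rightarrow> 'a \<Rightarrow> 'a \<Rightarrow> ('a \<Rightarrow> bool) \<Rightarrow> bool" where
  "pullback m p q p' q' R \<longleftrightarrow>
    (\<exists>\<sigma>. \<forall>z\<in>seg X p' q'. \<sigma> z \<in> seg X p q \<and> (f ^^ m) (\<sigma> z) = z \<and> R (\<sigma> z) \<and>
      (\<forall>z'\<in>seg X z q'. \<sigma> z' \<in> seg X (\<sigma> z) q))"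

lemma pullback_mono:
  assumes "pullback m p q p' q' R"
    and "\<And>x. x \<in> seg X p q \<Longrightarrow> (f ^^ m) x \<in> seg X p' q' \<Longrightarrow> R x \<Longrightarrow> R' x"
  shows "pullback m p q p' q' R'"
proof -
  obtain \<sigma> where \<sigma>: "\<And>z. z \<in> seg X p' q' \<Longrightarrow> \<sigma> z \<in> seg X p q \<and> (f ^^ m) (\<sigma> z) = z \<and> R (\<sigma> z) \<and>
      (\<forall>z'\<in>seg X z q'. \<sigma> z' \<in> seg X (\<sigma> z) q)"
    using assms(1) unfolding pullback_def by blast
  then have "R' (\<sigma> z)" if "z \<in> seg X p' q'" for z using assms(2) that by metis
  then show ?thesis using \<sigma> unfolding pullback_def by blast
qed

lemma pullback_refl: "pullback 0 p q p q (\<lambda>x. True)"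
  unfolding pullback_def by (rule exI[of _ "\<lambda>z. z"]) auto

lemma pullback_trans:
  assumes "pullback m p q p' q' R" "pullback m' p' q' p'' q'' R'" and X: "p' \<in> X" "q' \<in> X"
  shows "pullback (m + m') p q p'' q'' (\<lambda>x. R x \<and> R' ((f ^^ m) x))"
proof -
  obtain \<sigma> where \<sigma>: "\<And>z. z \<in> seg X p' q' \<Longrightarrow> \<sigma> z \<in> seg X p q \<and> (f ^^ m) (\<sigma> z) = z \<and> R (\<sigma> z) \<and>
      (\<forall>z'\<in>seg X z q'. \<sigma> z' \<in> seg X (\<sigma> z) q)"
    using assms(1) unfolding pullback_def by blast
  obtain \<tau> where \<tau>: "\<And>z. z \<in> seg X p'' q'' \<Longrightarrow> \<tau> z \<in> seg X p' q' \<and> (f ^^ m') (\<tau> z) = z \<and> R' (\<tau> z) \<and>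
      (\<forall>z'\<in>seg X z q''. \<tau> z' \<in> seg X (\<tau> z) q')"
    using assms(2) unfolding pullback_def by blast
  have "(f ^^ (m + m')) (\<sigma> (\<tau> z)) = z" if "z \<in> seg X p'' q''" for z
  proof -
    have "(f ^^ (m + m')) (\<sigma> (\<tau> z)) = (f ^^ m') ((f ^^ m) (\<sigma> (\<tau> z)))"
      by (metis add.commute comp_apply funpow_add)
    then show ?thesis using \<sigma> \<tau> that by simp
  qed
  then show ?thesis
    unfolding pullback_def
    by (intro exI[of _ "\<lambda>z. \<sigma> (\<tau> z)"] ballI conjI) (use \<sigma> \<tau> in auto)
qed

text \<open>
  For \<open>z\<close> in the target let \<open>T z\<close> be the last parameter at which the image of the arc \<open>[p,q]\<close> visits \<open>z\<close>. After
  this time the image still has to reach \<open>f q\<close>, so it visits all points between \<open>z\<close> and \<open>f q\<close> later;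
  hence \<open>T\<close> is monotone. Excursions of the image off the segment do no harm.
\<close>

lemma pullback_covers:
  assumes X: "p \<in> X" "q \<in> X" and cov: "covers p q p' q'"
  shows "pullback 1 p q p' q' (\<lambda>x. True)"
proof (cases "p = q")
  case True
  then have p': "p' = f p" using cov X image_in by (auto simp: covers_def)
  then have "q' = f p" using cov X image_in True by (auto simp: covers_def)
  then show ?thesis
    unfolding pullback_def using True p' X image_in by (intro exI[of _ "\<lambda>_. p"]) auto
next
  case False
  have fpq: "f p \<in> X" "f q \<in> X" using X image_in by auto
  obtain g where g: "arc g" "g 0 = p" "g 1 = q" "g ` {0..1} = seg X p q"
    using seg_arcE X False by metis
  have gX: "g t \<in> X" if "t \<in> {0..1}" for t
    using g(4) that seg_subset_space[of X p q] by auto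
  have cg: "continuous_on {0..1} g" using g(1) by (simp add: arc_def path_def)
  have cfg: "continuous_on {0..1} (\<lambda>t. f (g t))"
    using gX by (intro continuous_on_compose2[OF cont cg]) auto
  define A where "A = (\<lambda>z. {t\<in>{0..1}. f (g t) = z})"
  define T where "T = (\<lambda>z. Sup (A z))"
  have bdd: "bdd_above (A z)" for z by (auto simp: A_def bdd_above_def)
  have hit: "\<exists>t\<in>{r..1}. f (g t) = z" if "z \<in> seg X (f (g r)) (f q)" "r \<in> {0..1}" for z r
  proof -
    have sub: "{r..1} \<subseteq> {0..1}" using that by auto
    have "z \<in> (\<lambda>t. f (g t)) ` {r..1}"
    proof (rule segD[OF that(1)])
      show "connected ((\<lambda>t. f (g t)) ` {r..1})"
        by (intro connected_continuous_image continuous_on_subset[OF cfg sub]) auto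
      show "(\<lambda>t. f (g t)) ` {r..1} \<subseteq> X" using sub gX image_in by blast
    qed (use g(3) that(2) in auto)
    then show ?thesis by auto
  qed
  have sub: "seg X p' q' \<subseteq> seg X (f p) (f q)"
    using cov seg_subset[of q' p' "f q"] seg_subset_right[of p' "f p" "f q"]
    unfolding covers_def by blast
  have T: "T z \<in> {0..1}" "f (g (T z)) = z" if z: "z \<in> seg X p' q'" for z
  proof -
    have "\<exists>t\<in>{0..1}. f (g t) = z" using hit[of z 0] z sub g(2) by auto
    then have "A z \<noteq> {}" unfolding A_def by blast
    moreover have "A z = {0..1} \<inter> (\<lambda>t. f (g t)) -` {z}" by (auto simp: A_def)
    then have "closed (A z)" using continuous_closed_preimage[OF cfg, of "{z}"] by simp
    ultimately have "T z \<in> A z" unfolding T_def using bdd closed_contains_Sup by blast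
    then show "T z \<in> {0..1}" "f (g (T z)) = z" by (auto simp: A_def)
  qed
  have mono: "g (T z') \<in> seg X (g (T z)) q" if z: "z \<in> seg X p' q'" and z': "z' \<in> seg X z q'" for z z'
  proof -
    have zX: "z \<in> X" using z seg_subset_space by blast
    have p'X: "p' \<in> X" using cov seg_subset_space by (auto simp: covers_def)
    have "q' \<in> seg X (f q) z"
      using seg_between[of "f q" p' z q'] z cov fpq p'X by (simp add: covers_def seg_commute)
    then have "z' \<in> seg X z (f q)"
      using z' seg_subset[of q' z "f q"] by (auto simp: seg_commute)
    then obtain u where u: "u \<in> {T z..1}" "f (g u) = z'" using hit[of z' "T z"] T[OF z] by auto
    have "z' \<in> seg X p' q'"
      using z' seg_subset_right[OF z] by blast
    then have "T z' \<in> {0..1}" using T by blast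
    moreover have "u \<le> T z'"
      unfolding T_def using u T[OF z] by (intro cSup_upper[OF _ bdd]) (auto simp: A_def)
    ultimately show ?thesis
      using seg_subarc[of g "T z" 1] g u T[OF z] by auto
  qed
  show ?thesis
    unfolding pullback_def
  proof (intro exI[of _ "\<lambda>z. g (T z)"] ballI conjI)
    fix z assume z: "z \<in> seg X p' q'"
    show "g (T z) \<in> seg X p q" using T[OF z] g(4) by blast
    show "(f ^^ 1) (g (T z)) = z" using T[OF z] by simp
  qed (use mono in auto)
qed

lemma pullback_loop_fixpoint:
  assumes X: "p \<in> X" "q \<in> X" and loop: "pullback m p q p q R"
  obtains w where "w \<in> seg X p q" "(f ^^ m) w = w" "R w"
proof -
  obtain \<sigma> where \<sigma>: "\<And>z. z \<in> seg X p q \<Longrightarrow> \<sigma> z \<in> seg X p q \<and> (f ^^ m) (\<sigma> z) = z \<and> R (\<sigma> z) \<and>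
      (\<forall>z'\<in>seg X z q. \<sigma> z' \<in> seg X (\<sigma> z) q)"
    using loop unfolding pullback_def by blast
  have "\<exists>w\<in>seg X p q. \<sigma> w = w"
  proof (cases "p = q")
    case True
    then show ?thesis using \<sigma>[of p] X by auto
  next
    case False
    obtain g where g: "arc g" "g 0 = p" "g 1 = q" "g ` {0..1} = seg X p q"
      using seg_arcE X False by metis
    have "\<forall>t\<in>{0..1}. \<exists>s\<in>{0..1}. \<sigma> (g t) = g s"
      using \<sigma> g(4) by (metis imageE imageI)
    then obtain \<psi> where \<psi>: "\<And>t. t \<in> {0..1} \<Longrightarrow> \<psi> t \<in> {0..1} \<and> \<sigma> (g t) = g (\<psi> t)" by metis
    have up: "seg X (g s) q = g ` {s..1}" if "s \<in> {0..1}" for s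
      using seg_subarc[of g s 1] that g by auto
    obtain t where "t \<in> {0..1}" "\<psi> t = t"
    proof (rule mono_unit_interval_fixpoint[of \<psi>])
      fix s t :: real assume st: "s \<in> {0..1}" "t \<in> {0..1}" "s \<le> t"
      have "g t \<in> seg X (g s) q" using up[OF st(1)] st by auto
      then have "g (\<psi> t) \<in> seg X (g (\<psi> s)) q"
        using \<sigma>[of "g s"] \<psi> st g(4) by (metis imageI)
      then obtain u where u: "g (\<psi> t) = g u" "u \<in> {\<psi> s..1}" using up[of "\<psi> s"] \<psi>[OF st(1)] by auto
      moreover have "u \<in> {0..1}" using u(2) \<psi>[OF st(1)] by auto
      ultimately have "\<psi> t = u" using arcD[OF g(1) u(1)] \<psi>[OF st(2)] by auto
      then show "\<psi> s \<le> \<psi> t" using u(2) by simp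
    qed (use \<psi> in auto)
    then show ?thesis using \<psi>[of t] g(4) by force
  qed
  then show thesis using \<sigma> that by metis
qed

lemma pullback_orbit_segments:
  assumes "u \<in> X" "v \<in> X"
  shows "pullback k u v ((f ^^ k) u) ((f ^^ k) v) (\<lambda>x. True)"
proof (induction k)
  case (Suc k)
  let ?u = "(f ^^ k) u" and ?v = "(f ^^ k) v"
  have X: "?u \<in> X" "?v \<in> X" "f ?u \<in> X" "f ?v \<in> X" using assms iterate_in image_in by auto
  then have "covers ?u ?v (f ?u) (f ?v)" by (simp add: covers_def seg_ends)
  then show ?case
    using pullback_trans[OF Suc.IH pullback_covers[OF X(1,2)] X(1,2)] by simp
qed (use pullback_refl in auto)

end

section \<open>Two loops of coprime lengths\<close>

lemma eventually_periodic_self_map: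
  assumes "finite M" "\<phi> \<in> M \<rightarrow> M" "y \<in> M"
  obtains z l where "z \<in> M" "1 \<le> l" "l \<le> card M" "(\<phi> ^^ l) z = z"
proof -
  have in_M: "(\<phi> ^^ i) y \<in> M" for i using funpow_in[OF assms(2,3)] .
  have "\<not> inj_on (\<lambda>i. (\<phi> ^^ i) y) {..card M}"
  proof
    assume "inj_on (\<lambda>i. (\<phi> ^^ i) y) {..card M}"
    then have "card {..card M} \<le> card M"
      using in_M assms(1) by (intro card_inj_on_le[of "\<lambda>i. (\<phi> ^^ i) y"]) auto
    then show False by simp
  qed
  then obtain i j where "i \<le> card M" "j \<le> card M" "(\<phi> ^^ i) y = (\<phi> ^^ j) y" "i \<noteq> j"
    by (auto simp: inj_on_def)
  then obtain i j where ij: "i < j" "j \<le> card M" "(\<phi> ^^ i) y = (\<phi> ^^ j) y"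
    by (metis nat_neq_iff)
  have "(\<phi> ^^ (j - i)) ((\<phi> ^^ i) y) = (\<phi> ^^ (j - i + i)) y" by (simp add: funpow_add)
  then show thesis using that[of "(\<phi> ^^ i) y" "j - i"] ij in_M by auto
qed

lemma funpow_periodic:
  assumes "(f ^^ n) x = x"
  shows "(f ^^ (n * c)) x = x"
  using assms by (induction c) (auto simp: funpow_add)

context arc_tree_map
begin

text \<open>
  Two loops of segments based at \<open>[p,q]\<close>: a short one of length \<open>l\<close> that stays in \<open>D0\<close>, and a long one of
  length \<open>n\<close> whose first step leads into \<open>D1\<close>. Orbits can be told apart since \<open>D0\<close> and \<open>D1\<close> are disjoint.
\<close>

definition double_loop :: "nat \<Rightarrow> nat \<Rightarrow> 'a \<Rightarrow> 'a \<Rightarrow> 'a set \<Rightarrow> 'a set \<Rightarrow> bool" where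
  "double_loop l n p q D0 D1 \<longleftrightarrow>
    p \<in> X \<and> q \<in> X \<and> compact D0 \<and> compact D1 \<and> D0 \<inter> D1 = {} \<and> seg X p q \<subseteq> D0 \<and>
    pullback l p q p q (\<lambda>x. \<forall>i\<le>l. (f ^^ i) x \<in> D0) \<and>
    pullback n p q p q (\<lambda>x. f x \<in> D1)"

end

locale tree_map = tree X + arc_tree_map X f for X :: "'a::t2_space set" and f
begin

text \<open>
  The heart of the proof. The order used is \<open>x \<in> seg X a y\<close>, with \<open>a\<close> the separating point of the
  cycle. The short loop goes through segments \<open>[a,y]\<close> with \<open>y\<close> minimal in the cycle; the long loop follows the
  cycle itself, after a start between a minimal point \<open>y\<close> and the point \<open>v\<close> of the cycle above it.
\<close>

lemma germ_loop_and_excursion: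
  assumes n: "1 < n" "\<forall>p. prime p \<and> p dvd n \<longrightarrow> \<not> p < End X + 1" "n \<in> cycle_periods X f"
  obtains p q l D0 D1 where "1 \<le> l" "l \<le> End X" "coprime l n" "double_loop l n p q D0 D1"
proof -
  obtain x0 where x0: "x0 \<in> X" "(f ^^ n) x0 = x0" "\<And>j. 0 < j \<Longrightarrow> j < n \<Longrightarrow> (f ^^ j) x0 \<noteq> x0"
    "orbit f x0 \<subseteq> X"
    using cycle_periodsE[OF n(3)] by metis
  define P where "P = orbit f x0"
  have P_eq: "P = {(f ^^ m) x0 |m. m < n}"
    unfolding P_def using n(1) x0 by (intro orbit_altdef_bounded) auto
  have P: "finite P" "P \<subseteq> X" using x0 by (auto simp: P_eq P_def[symmetric])
  have fP: "f x \<in> P" if "x \<in> P" for x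
    using that unfolding P_def by (rule orbit.step)
  have fnP: "(f ^^ i) x \<in> P" if "x \<in> P" for x i
    using funpow_in[of f P x i] fP that by auto
  have per: "(f ^^ n) x = x" if x: "x \<in> P" for x
  proof -
    obtain m where "x = (f ^^ m) x0" using x by (auto simp: P_eq)
    then show ?thesis using x0(2) by (metis add.commute comp_apply funpow_add)
  qed
  have trans: "\<exists>j. x = (f ^^ j) y" if x: "x \<in> P" and y: "y \<in> P" for x y
  proof -
    obtain i m where i: "x = (f ^^ i) x0" and m: "y = (f ^^ m) x0" "m < n"
      using x y by (auto simp: P_eq)
    have "(f ^^ (i + (n - m))) y = (f ^^ i) ((f ^^ (n - m + m)) x0)"
      by (simp add: m(1) funpow_add)
    then show ?thesis using m i x0(2) by (metis le_add_diff_inverse2 less_imp_le)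
  qed
  have nofix: "f x \<noteq> x" if x: "x \<in> P" for x
  proof
    assume fx: "f x = x"
    have "x0 \<in> P" using n(1) by (auto simp: P_eq intro!: exI[of _ 0])
    then obtain j where "x0 = (f ^^ j) x" using trans[OF _ x] by blast
    moreover have "(f ^^ j) x = x" for j using fx by (induction j) auto
    ultimately have "f x0 = x0" using fx by simp
    then show False using x0(3)[of 1] n(1) by simp
  qed
  have "P \<noteq> {}" "f ` P \<subseteq> P" using orbit_nonempty[of f x0] fP by (auto simp: P_def)
  then obtain a where a: "a \<in> X" "a \<notin> P" and fa: "\<And>x. x \<in> P \<Longrightarrow> a \<in> seg X (f a) x"
    and sep: "\<exists>x\<in>P. \<exists>x'\<in>P. a \<in> seg X x x'"
    using separating_point[OF P(1) _ P(2) _ nofix] by blast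
  define M where "M = {y\<in>P. \<forall>x\<in>P. x \<in> seg X a y \<longrightarrow> x = y}"
  have M: "M \<subseteq> P" "M \<subseteq> X" "finite M" using P by (auto simp: M_def intro: finite_subset)
  have "\<exists>z\<in>M. z \<in> seg X a x" if x: "x \<in> P" for x
  proof -
    let ?D = "{z\<in>P. z \<in> seg X a x}"
    have "x \<in> ?D" using x seg_ends a(1) P(2) by auto
    then obtain c where c: "c \<in> ?D" "\<And>d. d \<in> ?D \<Longrightarrow> d \<in> seg X a c \<Longrightarrow> d = c"
      using finite_seg_minimal[of ?D a] P a(1) by auto
    have "c \<in> M" using c seg_trans[of _ a c x] by (auto simp: M_def)
    then show ?thesis using c(1) by auto
  qed
  then have "\<exists>z. z \<in> M \<and> z \<in> seg X a (f y)" if "y \<in> M" for y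
    using fP M(1) that by blast
  then obtain \<phi> where \<phi>: "\<And>y. y \<in> M \<Longrightarrow> \<phi> y \<in> M \<and> \<phi> y \<in> seg X a (f y)" by metis
  have "M \<noteq> {}" using \<open>P \<noteq> {}\<close> \<open>\<And>x. x \<in> P \<Longrightarrow> \<exists>z\<in>M. z \<in> seg X a x\<close> by auto
  then obtain y0 l where y0: "y0 \<in> M" and l: "1 \<le> l" "l \<le> card M" "(\<phi> ^^ l) y0 = y0"
    using eventually_periodic_self_map[OF M(3), of \<phi>] \<phi> by (metis Pi_I ex_in_conv)
  have \<phi>M: "(\<phi> ^^ i) y \<in> M" if "y \<in> M" for i y
    using funpow_in[of \<phi> M y i] \<phi> that by auto
  have "card M \<le> End X"
  proof (rule card_antichain_le_End[OF a(1) M(2)])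
    show "a \<notin> M" using a(2) M(1) by auto
  qed (auto simp: M_def)
  then have lE: "l \<le> End X" using l(2) by simp
  have cop: "coprime l n"
  proof (rule ccontr)
    assume "\<not> coprime l n"
    then obtain p where p: "prime p" "p dvd gcd l n"
      using prime_factor_nat[of "gcd l n"] by (auto simp: coprime_iff_gcd_eq_1)
    then have "p \<le> l" using l(1) dvd_imp_le[of p l] by auto
    then show False using n(2) p lE by auto
  qed

  \<comment> \<open>Points of the cycle whose orbits \<open>a\<close> never separates.\<close>
  define together where "together = (\<lambda>x x'. \<forall>j. a \<notin> seg X ((f ^^ j) x) ((f ^^ j) x'))"
  have tog_trans: "together x z" if "together x y" "together y z" for x y z
    using that seg_split[OF _ a(1)] unfolding together_def by blast
  have tog_f: "together (f x) (f y)" if "together x y" for x y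
    using that unfolding together_def by (metis comp_apply funpow_Suc_right)
  \<comment> \<open>Otherwise \<open>f ^^ l\<close> moves \<open>y0\<close> to a point together with \<open>y0\<close>. As \<open>l\<close> is invertible modulo \<open>n\<close>, the
    powers of \<open>f ^^ l\<close> reach the whole cycle from \<open>y0\<close>.\<close>
  have "\<exists>i. \<not> together (f ((\<phi> ^^ i) y0)) (\<phi> ((\<phi> ^^ i) y0))"
  proof (rule ccontr)
    assume "\<not> ?thesis"
    then have all: "together (f ((\<phi> ^^ i) y0)) (\<phi> ((\<phi> ^^ i) y0))" for i by blast
    have tog_refl: "together x x" if "x \<in> P" for x
      unfolding together_def using a(2) fnP[OF that] P(2) by (metis seg_self singletonD subsetD)
    have "together ((f ^^ i) y0) ((\<phi> ^^ i) y0)" for i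
    proof (induction i)
      case 0 then show ?case using tog_refl y0 M(1) by auto
    next
      case (Suc i)
      then show ?case using tog_trans[OF tog_f all] by simp
    qed
    then have base: "together ((f ^^ l) y0) y0" using l(3) by metis
    have step: "together ((f ^^ (l * c)) y0) y0" for c
    proof (induction c)
      case 0 then show ?case using tog_refl y0 M(1) by auto
    next
      case (Suc c)
      have "together ((f ^^ i) x) ((f ^^ i) y)" if "together x y" for x y i
        using that tog_f by (induction i) auto
      then have "together ((f ^^ l) ((f ^^ (l * c)) y0)) ((f ^^ l) y0)" using Suc by blast
      then show ?case using tog_trans[OF _ base] by (simp add: funpow_add)
    qed
    have all_tog: "together x y0" if x: "x \<in> P" for x
    proof -
      obtain j where j: "x = (f ^^ j) y0" using trans[OF x] y0 M(1) by blast
      obtain b where "[l * b = 1] (mod n)" using cong_solve_coprime_nat[OF cop] by auto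
      then have "[l * b * j = 1 * j] (mod n)" by (rule cong_scalar_right)
      then have c: "[l * (b * j) = j] (mod n)" by (simp add: ac_simps)
      define c where "c = b * j"
      have "(f ^^ (l * c)) y0 = (f ^^ j) y0"
        using funpow_mod_eq[OF per, of y0 "l * c"] funpow_mod_eq[OF per, of y0 j] y0 M(1) c
        by (auto simp: cong_def c_def)
      then show ?thesis using step[of c] j by simp
    qed
    obtain x x' where xx: "x \<in> P" "x' \<in> P" "a \<in> seg X x x'" using sep by blast
    have "a \<notin> seg X x y0" "a \<notin> seg X x' y0"
      using all_tog[OF xx(1)] all_tog[OF xx(2)] unfolding together_def by (metis funpow_0)+
    then show False using seg_split[OF xx(3) a(1), of y0] by (simp add: seg_commute)
  qed
  then obtain i where i: "\<not> together (f ((\<phi> ^^ i) y0)) (\<phi> ((\<phi> ^^ i) y0))" by blast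
  define q where "q = (\<phi> ^^ i) y0"
  define y where "y = \<phi> q"
  define v where "v = f q"
  have q: "q \<in> M" "q \<in> P" "q \<in> X" using \<phi>M[OF y0] M by (auto simp: q_def)
  have y: "y \<in> M" "y \<in> P" "y \<in> X" "y \<in> seg X a v" using \<phi>[OF q(1)] M by (auto simp: y_def v_def)
  have v: "v \<in> P" "v \<in> X" using fP[OF q(2)] P(2) by (auto simp: v_def)
  obtain j where j: "a \<in> seg X ((f ^^ j) v) ((f ^^ j) y)"
    using i by (auto simp: together_def q_def y_def v_def)
  \<comment> \<open>Both orbits have period \<open>n\<close>, so the separation occurs within the first \<open>n\<close> steps.\<close>
  define k where "k = j mod n"
  have k: "k \<le> n - 1" using n(1) by (simp add: k_def less_Suc_eq_le[symmetric])
  have ak: "a \<in> seg X ((f ^^ k) y) ((f ^^ k) v)"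
    using j funpow_mod_eq[OF per[OF y(2)], of j] funpow_mod_eq[OF per[OF v(1)], of j]
    by (simp add: k_def seg_commute)
  have "a \<in> (f ^^ k) ` seg X y v"
  proof (rule segD[OF ak])
    have sub: "seg X y v \<subseteq> X" by (rule seg_subset_space)
    have "continuous_on X (f ^^ k)"
    proof (induction k)
      case 0 then show ?case by (simp add: id_def)
    next
      case (Suc k)
      have "continuous_on ((f ^^ k) ` X) f" using iterate_in by (intro continuous_on_subset[OF cont]) auto
      then show ?case using continuous_on_compose[OF Suc] by simp
    qed
    then show "connected ((f ^^ k) ` seg X y v)"
      using connected_continuous_image[OF continuous_on_subset[OF _ sub]]
        seg_connected_compact(1)[OF y(3) v(2)] by blast
    show "(f ^^ k) ` seg X y v \<subseteq> X" using sub iterate_in by auto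
  qed (use seg_ends y v in auto)
  then obtain u where u: "u \<in> seg X y v" "(f ^^ k) u = a" by auto
  have uX: "u \<in> X" using u(1) seg_subset_space by blast
  have uy: "u \<noteq> y" using u(2) fnP[OF y(2), of k] a(2) by auto
  \<comment> \<open>Starting the excursion in \<open>u\<close> instead of \<open>y\<close> keeps it away from the short loop, and makes it reach
    \<open>a\<close> exactly when the orbit of \<open>y\<close> and that of \<open>v\<close> are separated.\<close>
  define D0 where "D0 = (\<Union>x\<in>M. seg X a x)"
  define D1 where "D1 = seg X u v"
  have "compact D0" "compact D1"
    unfolding D0_def D1_def using M a(1) uX v
    by (auto intro!: compact_UN seg_connected_compact(2))
  moreover have "D0 \<inter> D1 = {}"
  proof (rule ccontr)
    assume "D0 \<inter> D1 \<noteq> {}"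
    then obtain z x where x: "x \<in> M" "z \<in> seg X a x" and z: "z \<in> seg X u v"
      by (auto simp: D0_def D1_def)
    have zyv: "z \<in> seg X y v" using z seg_subset_right[OF u(1)] by blast
    have yz: "y \<in> seg X a z" using seg_between[OF a(1) v(2) zyv y(4)] .
    then have "y \<in> seg X a x" using x(2) seg_trans by blast
    then have "x = y" using x(1) y(2) by (auto simp: M_def)
    then have "z = y" using seg_antisym[OF a(1) x(2)] yz by simp
    then have "y \<in> seg X v u" using z by (simp add: seg_commute)
    moreover have "u \<in> seg X v y" using u(1) by (simp add: seg_commute)
    ultimately have "u = y" using seg_antisym[OF v(2), of y u] by blast
    then show False using uy by simp
  qed
  moreover have "seg X a q \<subseteq> D0" using q by (auto simp: D0_def)
  moreover have "pullback l a q a q (\<lambda>x. \<forall>i\<le>l. (f ^^ i) x \<in> D0)"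
  proof -
    have germ: "pullback j a q a ((\<phi> ^^ j) q) (\<lambda>x. \<forall>i\<le>j. (f ^^ i) x \<in> D0)" for j
    proof (induction j)
      case 0
      have "pullback 0 a q a q (\<lambda>x. \<forall>i\<le>0. (f ^^ i) x \<in> D0)"
        by (rule pullback_mono[OF pullback_refl]) (use q(1) in \<open>auto simp: D0_def\<close>)
      then show ?case by simp
    next
      case (Suc j)
      let ?z = "(\<phi> ^^ j) q"
      have z: "?z \<in> M" "?z \<in> P" "?z \<in> X" "f ?z \<in> P" using \<phi>M[OF q(1)] M fP by auto
      have "covers a ?z a (\<phi> ?z)"
        using fa[OF z(4)] \<phi>[OF z(1)] by (simp add: covers_def)
      then have 1: "pullback (j + 1) a q a (\<phi> ?z) (\<lambda>x. (\<forall>i\<le>j. (f ^^ i) x \<in> D0) \<and> True)"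
        using pullback_trans[OF Suc pullback_covers[OF a(1) z(3)] a(1) z(3)] by simp
      have "seg X a (\<phi> ?z) \<subseteq> D0" using \<phi>[OF z(1)] by (auto simp: D0_def)
      have "pullback (j + 1) a q a (\<phi> ?z) (\<lambda>x. \<forall>i\<le>Suc j. (f ^^ i) x \<in> D0)"
        by (rule pullback_mono[OF 1]) (use \<open>seg X a (\<phi> ?z) \<subseteq> D0\<close> in \<open>auto simp: le_Suc_eq\<close>)
      then show ?case by simp
    qed
    have "(\<phi> ^^ l) q = q"
    proof -
      have "(\<phi> ^^ l) ((\<phi> ^^ i) y0) = (\<phi> ^^ (l + i)) y0" by (simp add: funpow_add)
      also have "\<dots> = (\<phi> ^^ i) ((\<phi> ^^ l) y0)" by (subst add.commute) (simp add: funpow_add)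
      finally show ?thesis by (simp add: l(3) q_def)
    qed
    then show ?thesis using germ[of l] by simp
  qed
  moreover have "pullback n a q a q (\<lambda>x. f x \<in> D1)"
  proof -
    have "a \<in> seg X (f a) v" using fa v(1) by blast
    then have "seg X y v \<subseteq> seg X (f a) v"
      using seg_subset_right[OF y(4)] seg_subset_right by blast
    then have "covers a q u v"
      using u(1) seg_ends(2)[OF uX v(2)] by (auto simp: covers_def v_def)
    from pullback_covers[OF a(1) q(3) this]
    have 1: "pullback 1 a q u v (\<lambda>x. f x \<in> D1)"
      by (rule pullback_mono) (auto simp: D1_def)
    \<comment> \<open>Follow \<open>[u,v]\<close> for \<open>k\<close> steps, until its lower end has become \<open>a\<close>; then follow \<open>[a,x]\<close> along the
      cycle until \<open>x = q\<close>.\<close>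
    have vk: "(f ^^ k) v \<in> P" "(f ^^ k) v \<in> X" using fnP[OF v(1)] P(2) by auto
    have 2: "pullback (1 + k) a q a ((f ^^ k) v) (\<lambda>x. f x \<in> D1)"
      using pullback_trans[OF 1 pullback_orbit_segments[OF uX v(2), of k] uX v(2)] u(2) by simp
    have 3: "pullback j a x a ((f ^^ j) x) (\<lambda>x. True)" if x: "x \<in> P" for j x
    proof (induction j)
      case 0
      show ?case using pullback_refl by simp
    next
      case (Suc j)
      let ?z = "(f ^^ j) x"
      have z: "?z \<in> P" "?z \<in> X" "f ?z \<in> P" "f ?z \<in> X" using fnP[OF x] P(2) fP by auto
      have "covers a ?z a (f ?z)"
        using fa[OF z(3)] seg_ends a(1) z by (simp add: covers_def)
      then show ?case
        using pullback_trans[OF Suc pullback_covers[OF a(1) z(2)] a(1) z(2)] by simp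
    qed
    have "(f ^^ (n - 1 - k)) ((f ^^ k) v) = (f ^^ (n - 1 - k + k + 1)) q"
      by (simp add: v_def funpow_add funpow_swap1)
    also have "\<dots> = q" using per[OF q(2)] k n(1) by simp
    finally have "pullback (n - 1 - k) a ((f ^^ k) v) a q (\<lambda>x. True)"
      using 3[OF vk(1), of "n - 1 - k"] by simp
    from pullback_trans[OF 2 this a(1) vk(2)]
    show ?thesis using k n(1) by simp
  qed
  ultimately have "double_loop l n a q D0 D1"
    using a(1) q(3) unfolding double_loop_def by blast
  then show thesis using that[OF l(1) lE cop] by blast
qed

end

section \<open>All large periods\<close>

context arc_tree_map
begin

lemma pullback_power:
  assumes X: "p \<in> X" "q \<in> X" and loop: "pullback n p q p q R"
  shows "pullback (s * n) p q p q (\<lambda>x. \<forall>j<s. R ((f ^^ (j * n)) x))"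
proof (induction s)
  case 0
  show ?case using pullback_refl by simp
next
  case (Suc s)
  from pullback_trans[OF Suc loop X]
  have "pullback (s * n + n) p q p q (\<lambda>x. (\<forall>j<s. R ((f ^^ (j * n)) x)) \<and> R ((f ^^ (s * n)) x))" .
  moreover have "s * n + n = Suc s * n" by simp
  ultimately have "pullback (Suc s * n) p q p q
      (\<lambda>x. (\<forall>j<s. R ((f ^^ (j * n)) x)) \<and> R ((f ^^ (s * n)) x))" by simp
  then show ?case by (rule pullback_mono) (auto simp: less_Suc_eq)
qed

end

lemma residue_multiple:
  fixes l n m :: nat
  assumes "coprime l n" "1 \<le> l"
  obtains s where "1 \<le> s" "s \<le> l" "[s * n = m] (mod l)"
proof -
  have "coprime n l" using assms(1) by (simp add: coprime_commute)
  then obtain x where "[n * x = 1] (mod l)" using cong_solve_coprime_nat by auto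
  then have "[n * x * m = 1 * m] (mod l)" by (rule cong_scalar_right)
  then have x: "[(x * m) * n = m] (mod l)" by (simp add: ac_simps)
  define s0 where "s0 = (x * m) mod l"
  have s0: "[s0 * n = m] (mod l)"
    using x unfolding s0_def cong_def by (simp add: mod_mult_left_eq)
  show thesis
  proof (cases "s0 = 0")
    case True
    then have "[l * n = m] (mod l)" using s0 by (simp add: cong_def)
    then show thesis using that[of l] assms(2) by simp
  next
    case False
    then show thesis using that[of s0] s0 assms(2) by (simp add: s0_def less_imp_le)
  qed
qed

context tree_map
begin

lemma period_gt_End:
  assumes "1 < n" "\<forall>p. prime p \<and> p dvd n \<longrightarrow> \<not> p < End X + 1"
  shows "End X < n"
proof -
  obtain p where p: "prime p" "p dvd n" using prime_factor_nat[of n] assms(1) by auto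
  then have "p \<le> n" using assms(1) by (auto dest: dvd_imp_le)
  moreover have "\<not> p < End X + 1" using assms(2) p by blast
  ultimately show ?thesis by simp
qed

text \<open>
  With \<open>m = s * n + t * l\<close> and \<open>1 \<le> s \<le> l\<close>, the point \<open>w\<close> fixed by \<open>f ^^ m\<close> visits \<open>D1\<close> at the times
  \<open>j * n + 1\<close> with \<open>j < s\<close> and stays in \<open>D0\<close> from time \<open>s * n\<close> to time \<open>m\<close>. A period \<open>d\<close> of \<open>w\<close> with \<open>d < m\<close> may be
  taken to divide \<open>m\<close>, so \<open>2 * d \<le> m\<close>; the bound on \<open>m\<close> then leaves room for a multiple of \<open>d\<close> that shifts the
  last visit to \<open>D1\<close> into the stay in \<open>D0\<close>.
\<close>

lemma all_large_periods:
  assumes n: "1 < n" "\<forall>p. prime p \<and> p dvd n \<longrightarrow> \<not> p < End X + 1" "n \<in> cycle_periods X f"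
    and m: "m > 2 * End X * (n - 1)"
  shows "m \<in> cycle_periods X f"
proof -
  define E where "E = End X"
  have E2: "2 \<le> E" using two_endpoints by (simp add: E_def)
  have nE: "E + 1 \<le> n" using period_gt_End[OF n(1,2)] by (simp add: E_def)
  obtain p q l D0 D1 where l: "1 \<le> l" "l \<le> End X" "coprime l n" and loops: "double_loop l n p q D0 D1"
    using germ_loop_and_excursion[OF n] by metis
  have pq: "p \<in> X" "q \<in> X" and D: "D0 \<inter> D1 = {}" "seg X p q \<subseteq> D0"
    and \<alpha>: "pullback l p q p q (\<lambda>x. \<forall>i\<le>l. (f ^^ i) x \<in> D0)"
    and \<beta>: "pullback n p q p q (\<lambda>x. f x \<in> D1)"
    using loops unfolding double_loop_def by blast+
  have lE: "l \<le> E" using l(2) by (simp add: E_def)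
  obtain s where s: "1 \<le> s" "s \<le> l" "[s * n = m] (mod l)" using residue_multiple[OF l(3,1)] .
  have m': "2 * E * n + 1 \<le> m + 2 * E"
    using m n(1) by (cases n) (auto simp: E_def algebra_simps)
  have En: "2 * E \<le> E * n" using n(1) by (simp add: mult.commute)
  have "s * n \<le> E * n" using s lE by simp
  then have "s * n \<le> m" using m' En by linarith
  then obtain t where t: "m = s * n + t * l"
    using s(3) by (metis cong_iff_lin_nat cong_sym le_add_diff_inverse cong_diff_iff_cong_0_nat
        cong_0_iff dvdE mult.commute)
  have sn: "(s - 1) * n + n = s * n" using s(1) by (cases s) auto
  have long: "pullback m p q p q
      (\<lambda>x. (\<forall>j<s. f ((f ^^ (j * n)) x) \<in> D1) \<and> (\<forall>i. s * n \<le> i \<and> i \<le> m \<longrightarrow> (f ^^ i) x \<in> D0))"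
  proof -
    have 1: "pullback (t * l) p q p q (\<lambda>x. \<forall>i\<le>t * l. (f ^^ i) x \<in> D0)"
    proof (rule pullback_mono[OF pullback_power[OF pq \<alpha>]], intro allI impI)
      fix x i assume x: "x \<in> seg X p q" "\<forall>j<t. \<forall>i\<le>l. (f ^^ i) ((f ^^ (j * l)) x) \<in> D0"
        and i: "i \<le> t * l"
      show "(f ^^ i) x \<in> D0"
      proof (cases "i = 0")
        case True then show ?thesis using x(1) D(2) by auto
      next
        case False
        define j where "j = (i - 1) div l"
        have "j * l \<le> i - 1" "i - 1 < j * l + l"
          using l(1) dividend_less_times_div[of l "i - 1"] by (auto simp: j_def mult.commute)
        then have j: "j * l \<le> i" "i - j * l \<le> l" by linarith+
        have "i - 1 < t * l" using False i by linarith
        then have "j < t" unfolding j_def by (rule less_mult_imp_div_less)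
        then have "(f ^^ (i - j * l)) ((f ^^ (j * l)) x) \<in> D0" using x(2) j by blast
        then show ?thesis using j(1) by (metis comp_apply funpow_add le_add_diff_inverse2)
      qed
    qed
    have 2: "pullback m p q p q (\<lambda>x. (\<forall>j<s. f ((f ^^ (j * n)) x) \<in> D1) \<and>
        (\<forall>i\<le>t * l. (f ^^ i) ((f ^^ (s * n)) x) \<in> D0))"
      unfolding t by (rule pullback_trans[OF pullback_power[OF pq \<beta>] 1 pq])
    show ?thesis
    proof (rule pullback_mono[OF 2], intro conjI allI impI)
      fix x i assume "(\<forall>j<s. f ((f ^^ (j * n)) x) \<in> D1) \<and>
        (\<forall>i\<le>t * l. (f ^^ i) ((f ^^ (s * n)) x) \<in> D0)" "s * n \<le> i \<and> i \<le> m"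
      then have "(f ^^ (i - s * n)) ((f ^^ (s * n)) x) \<in> D0" "s * n \<le> i" using t by auto
      then show "(f ^^ i) x \<in> D0" by (metis comp_apply funpow_add le_add_diff_inverse2)
    qed auto
  qed
  obtain w where w: "w \<in> seg X p q" "(f ^^ m) w = w"
    and D1: "\<And>j. j < s \<Longrightarrow> f ((f ^^ (j * n)) w) \<in> D1"
    and D0: "\<And>i. s * n \<le> i \<Longrightarrow> i \<le> m \<Longrightarrow> (f ^^ i) w \<in> D0"
    using pullback_loop_fixpoint[OF pq long] by metis
  show ?thesis
  proof (rule cycle_periodsI[OF maps _ _ w(2)])
    show "w \<in> X" using w(1) seg_subset_space by blast
    show "0 < m" using m by simp
    fix j assume j: "0 < j" "j < m"
    show "(f ^^ j) w \<noteq> w"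
    proof
      assume "(f ^^ j) w = w"
      then obtain d where d: "0 < d" "d dvd m" "d < m" "(f ^^ d) w = w"
        using least_period_dvd[OF w(2) j] by metis
      have d2: "2 * d \<le> m"
      proof -
        obtain c where c: "m = d * c" using d(2) by auto
        then have "c \<noteq> 0" "c \<noteq> 1" using d(3) by (auto intro!: Nat.gr0I)
        then show ?thesis using c by simp
      qed
      \<comment> \<open>The last visit to \<open>D1\<close> is at time \<open>(s - 1) * n + 1\<close>, so the shift has to be at least \<open>n - 1\<close>.\<close>
      have s1: "(s - 1) * n \<le> (E - 1) * n"
        by (intro mult_le_mono1 diff_le_mono) (use s(2) lE in linarith)
      have m'': "2 * (E * n) + 1 \<le> m + 2 * E" using m' by (simp add: mult.assoc)
      have E1: "(E - 1) * n + n = E * n" using E2 by (cases E) auto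
      have "\<exists>c. n - 1 \<le> d * c \<and> (s - 1) * n + 1 + d * c \<le> m"
      proof (cases "n - 1 \<le> d")
        case True
        have "(s - 1) * n + 1 + d \<le> m" using s1 E1 d2 m'' nE by linarith
        then show ?thesis using True by (intro exI[of _ 1]) simp
      next
        case False
        define c where "c = (n - 1 + (d - 1)) div d"
        have c1: "d * c \<le> n - 1 + (d - 1)" "n - 1 + (d - 1) < d * c + d"
          using d(1) dividend_less_times_div[of d "n - 1 + (d - 1)"] by (auto simp: c_def)
        have "2 * E \<le> (E - 1) * n + 4"
        proof -
          have "(E - 1) * (E + 1) \<le> (E - 1) * n" using nE by (intro mult_le_mono2) simp
          moreover have "(E - 1) * (E + 1) + 4 \<ge> 2 * E"
          proof -
            obtain e where "E = e + 2" using E2 le_Suc_ex by (metis add.commute)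
            then show ?thesis by (simp add: algebra_simps)
          qed
          ultimately show ?thesis by linarith
        qed
        then have "(s - 1) * n + 1 + d * c \<le> m"
          using s1 E1 m'' c1(1) False d(1) n(1) by linarith
        moreover have "n - 1 \<le> d * c" using c1(2) d(1) by linarith
        ultimately show ?thesis by blast
      qed
      then obtain c where c: "n - 1 \<le> d * c" "(s - 1) * n + 1 + d * c \<le> m" by blast
      have "(f ^^ ((s - 1) * n + 1 + d * c)) w \<in> D0"
        using c sn n(1) by (intro D0) linarith+
      moreover have "(f ^^ ((s - 1) * n + 1 + d * c)) w = (f ^^ ((s - 1) * n + 1)) ((f ^^ (d * c)) w)"
        by (simp add: funpow_add)
      ultimately have "f ((f ^^ ((s - 1) * n)) w) \<in> D0"
        using funpow_periodic[OF d(4), of c] by simp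
      then show False using D1[of "s - 1"] s(1) D(1) by auto
    qed
  qed
qed

end

section \<open>Entropy from separated orbits\<close>

lemma finite_iterated_join:
  assumes "finite \<U>"
  shows "finite (iterated_join X f \<U> N)"
proof -
  let ?F = "\<lambda>A. {x \<in> X. \<forall>i<N. (f ^^ i) x \<in> A i}"
  have "iterated_join X f \<U> N \<subseteq> ?F ` (PiE {..<N} (\<lambda>_. \<U>))"
  proof
    fix V assume "V \<in> iterated_join X f \<U> N"
    then obtain A where A: "V = ?F A" "\<forall>i<N. A i \<in> \<U>" by (auto simp: iterated_join_def)
    then have "V = ?F (restrict A {..<N})" by auto
    moreover have "restrict A {..<N} \<in> PiE {..<N} (\<lambda>_. \<U>)" using A(2) by auto
    ultimately show "V \<in> ?F ` (PiE {..<N} (\<lambda>_. \<U>))" by blast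
  qed
  moreover have "finite (PiE {..<N} (\<lambda>_. \<U>))" using assms by (intro finite_PiE) auto
  ultimately show ?thesis by (meson finite_imageI finite_subset)
qed

text \<open>
  An element of the refined cover prescribes for each time which of \<open>D0\<close>, \<open>D1\<close> the orbit avoids,
  so it contains at most one of the given points.
\<close>

lemma separated_points_le_min_subcover_card:
  fixes X D0 D1 :: "'a set" and f :: "'a \<Rightarrow> 'a" and pt :: "'b \<Rightarrow> 'a"
  assumes maps: "f \<in> X \<rightarrow> X" and D: "D0 \<inter> D1 = {}"
    and W: "finite W" "\<And>w. w \<in> W \<Longrightarrow> pt w \<in> X"
    and sep: "\<And>v w. v \<in> W \<Longrightarrow> w \<in> W \<Longrightarrow> v \<noteq> w \<Longrightarrow> \<exists>i<N.
        (f ^^ i) (pt v) \<in> D0 \<and> (f ^^ i) (pt w) \<in> D1 \<or> (f ^^ i) (pt v) \<in> D1 \<and> (f ^^ i) (pt w) \<in> D0"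
  shows "card W \<le> min_subcover_card X (iterated_join X f {X - D0, X - D1} N)"
proof -
  let ?J = "iterated_join X f {X - D0, X - D1} N"
  let ?Q = "\<lambda>k. \<exists>V\<subseteq>?J. finite V \<and> card V = k \<and> X \<subseteq> \<Union>V"
  have "X \<subseteq> \<Union>?J"
  proof
    fix x assume x: "x \<in> X"
    define A where "A = (\<lambda>i. if (f ^^ i) x \<in> D0 then X - D1 else X - D0)"
    have "(f ^^ i) x \<in> A i" for i
      using D funpow_in[OF maps x, of i] by (auto simp: A_def)
    moreover have "A i \<in> {X - D0, X - D1}" for i by (simp add: A_def)
    ultimately show "x \<in> \<Union>?J" using x unfolding iterated_join_def by blast
  qed
  moreover have "finite ?J" by (rule finite_iterated_join) simp
  ultimately have "?Q (card ?J)" by blast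
  then have "?Q (min_subcover_card X ?J)" unfolding min_subcover_card_def by (rule LeastI)
  then obtain V where V: "V \<subseteq> ?J" "finite V" "card V = min_subcover_card X ?J" "X \<subseteq> \<Union>V"
    by blast
  have "\<forall>w\<in>W. \<exists>S\<in>V. pt w \<in> S" using W(2) V(4) by blast
  then obtain S where S: "\<And>w. w \<in> W \<Longrightarrow> S w \<in> V \<and> pt w \<in> S w" by metis
  have "inj_on S W"
  proof (rule inj_onI, rule ccontr)
    fix v w assume vw: "v \<in> W" "w \<in> W" "S v = S w" "v \<noteq> w"
    obtain A where A: "S v = {x \<in> X. \<forall>i<N. (f ^^ i) x \<in> A i}" "\<forall>i<N. A i \<in> {X - D0, X - D1}"
      using S[OF vw(1)] V(1) by (force simp: iterated_join_def)
    obtain i where i: "i < N" "(f ^^ i) (pt v) \<in> D0 \<and> (f ^^ i) (pt w) \<in> D1 \<or>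
        (f ^^ i) (pt v) \<in> D1 \<and> (f ^^ i) (pt w) \<in> D0"
      using sep[OF vw(1,2,4)] by blast
    have "pt v \<in> S v" "pt w \<in> S v" using S[OF vw(1)] S[OF vw(2)] vw(3) by auto
    then have "(f ^^ i) (pt v) \<in> A i" "(f ^^ i) (pt w) \<in> A i" using A(1) i(1) by auto
    then show False using A(2) i by auto
  qed
  then show ?thesis using card_inj_on_le[of S W V] S V by auto
qed

lemma topological_entropy_ge:
  fixes X D0 D1 :: "'a::t2_space set"
  assumes maps: "f \<in> X \<rightarrow> X" and D: "closed D0" "closed D1" "D0 \<inter> D1 = {}" and n: "1 \<le> n"
    and pt: "\<And>w :: bool list. pt w \<in> X"
    and sep: "\<And>v w :: bool list. length v = length w \<Longrightarrow> v \<noteq> w \<Longrightarrow> \<exists>i<n * length w.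
        (f ^^ i) (pt v) \<in> D0 \<and> (f ^^ i) (pt w) \<in> D1 \<or> (f ^^ i) (pt v) \<in> D1 \<and> (f ^^ i) (pt w) \<in> D0"
  shows "topological_entropy X f \<ge> ereal (ln 2 / real n)"
proof -
  let ?U = "{X - D0, X - D1}"
  let ?u = "\<lambda>N. ereal (ln (real (min_subcover_card X (iterated_join X f ?U N))) / real N)"
  have "openin (top_of_set X) (X - D)" if "closed D" for D
    using that by (metis Diff_eq open_Compl openin_open_Int)
  then have "?U \<in> open_covers X"
    using D by (auto simp: open_covers_def)
  then have "cover_entropy X f ?U \<le> topological_entropy X f"
    unfolding topological_entropy_def by (rule SUP_upper)
  moreover have "ereal (ln 2 / real n) \<le> cover_entropy X f ?U"
  proof -
    have "ereal (ln 2 / real n) \<le> ?u (n * Suc k)" for k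
    proof -
      let ?W = "{w :: bool list. length w = Suc k}"
      have card: "card ?W = 2 ^ Suc k" and fin: "finite ?W"
        using card_lists_length_eq[of "UNIV :: bool set" "Suc k"]
          finite_lists_length_eq[of "UNIV :: bool set" "Suc k"] by auto
      let ?c = "min_subcover_card X (iterated_join X f ?U (n * Suc k))"
      have "card ?W \<le> ?c"
      proof (rule separated_points_le_min_subcover_card[OF maps D(3) fin])
        show "pt w \<in> X" for w by (rule pt)
        show "\<exists>i<n * Suc k. (f ^^ i) (pt v) \<in> D0 \<and> (f ^^ i) (pt w) \<in> D1 \<or>
          (f ^^ i) (pt v) \<in> D1 \<and> (f ^^ i) (pt w) \<in> D0" if "v \<in> ?W" "w \<in> ?W" "v \<noteq> w" for v w
          using sep[of v w] that by auto
      qed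
      then have "(2::real) ^ Suc k \<le> real ?c" unfolding card
        by (metis of_nat_le_iff of_nat_numeral of_nat_power)
      then have "ln ((2::real) ^ Suc k) \<le> ln (real ?c)" by (intro ln_mono) auto
      then have "real (Suc k) * ln 2 \<le> ln (real ?c)" by (simp only: ln_realpow)
      then have "real (Suc k) * ln 2 / real (n * Suc k) \<le> ln (real ?c) / real (n * Suc k)"
        by (rule divide_right_mono) simp
      moreover have "real (Suc k) * ln 2 / real (n * Suc k) = ln 2 / real n"
        unfolding of_nat_mult mult.commute[of "real n"]
        by (rule mult_divide_mult_cancel_left) simp
      ultimately show ?thesis by simp
    qed
    then have "ereal (ln 2 / real n) \<le> limsup (?u \<circ> (\<lambda>k. n * Suc k))"
      by (intro le_Limsup) auto
    also have "\<dots> \<le> limsup ?u"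
      using n by (intro limsup_subseq_mono) (auto simp: strict_mono_def)
    finally show ?thesis by (simp add: cover_entropy_def)
  qed
  ultimately show ?thesis by (rule order_trans[rotated])
qed

context arc_tree_map
begin

text \<open>
  The letters stand for rounds of the two loops: \<open>True\<close> for the long one, which enters \<open>D1\<close> at its first
  step, and \<open>False\<close> for the short one, which stays in \<open>D0\<close>.
\<close>

primrec itinerary :: "nat \<Rightarrow> nat \<Rightarrow> 'a set \<Rightarrow> 'a set \<Rightarrow> bool list \<Rightarrow> 'a \<Rightarrow> bool" where
  "itinerary l n D0 D1 [] x \<longleftrightarrow> True"
| "itinerary l n D0 D1 (b # w) x \<longleftrightarrow>
    (if b then f x \<in> D1 \<and> itinerary l n D0 D1 w ((f ^^ n) x)
     else f x \<in> D0 \<and> itinerary l n D0 D1 w ((f ^^ l) x))"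

text \<open>
  Words with a common prefix are synchronous up to the first letter in which they differ, and one step
  later one orbit is in \<open>D1\<close> and the other in \<open>D0\<close>.
\<close>

lemma itineraries_separated:
  assumes "length v = length w" "v \<noteq> w" "1 < n" "l \<le> n"
    and "itinerary l n D0 D1 v x" "itinerary l n D0 D1 w y"
  shows "\<exists>i<n * length w. (f ^^ i) x \<in> D0 \<and> (f ^^ i) y \<in> D1 \<or> (f ^^ i) x \<in> D1 \<and> (f ^^ i) y \<in> D0"
  using assms
proof (induction v arbitrary: w x y)
  case (Cons b v)
  then obtain c w' where w: "w = c # w'" by (cases w) auto
  have "1 < n * length w"
    using Cons.prems(3) w by (metis One_nat_def less_le_trans length_Cons less_1_mult linorder_not_less mult.commute mult_1 mult_le_mono2 Suc_leI zero_less_Suc)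
  show ?case
  proof (cases "b = c")
    case False
    then have "(f ^^ 1) x \<in> D0 \<and> (f ^^ 1) y \<in> D1 \<or> (f ^^ 1) x \<in> D1 \<and> (f ^^ 1) y \<in> D0"
      using Cons.prems(5,6) w by (cases b) auto
    then show ?thesis using \<open>1 < n * length w\<close> by blast
  next
    case True
    define k where "k = (if b then n else l)"
    have "itinerary l n D0 D1 v ((f ^^ k) x)" "itinerary l n D0 D1 w' ((f ^^ k) y)"
      using Cons.prems(5,6) w True by (auto simp: k_def split: if_splits)
    moreover have "length v = length w'" "v \<noteq> w'" using Cons.prems(1,2) w True by auto
    ultimately obtain i where i: "i < n * length w'"
      "(f ^^ i) ((f ^^ k) x) \<in> D0 \<and> (f ^^ i) ((f ^^ k) y) \<in> D1 \<or>
       (f ^^ i) ((f ^^ k) x) \<in> D1 \<and> (f ^^ i) ((f ^^ k) y) \<in> D0"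
      using Cons.IH[of w' "(f ^^ k) x" "(f ^^ k) y"] Cons.prems(3,4) by blast
    have "i + k < n * length w" using i(1) Cons.prems(4) w by (simp add: k_def)
    moreover have "(f ^^ (i + k)) x \<in> D0 \<and> (f ^^ (i + k)) y \<in> D1 \<or>
       (f ^^ (i + k)) x \<in> D1 \<and> (f ^^ (i + k)) y \<in> D0"
      using i(2) by (simp add: funpow_add)
    ultimately show ?thesis by blast
  qed
qed simp

lemma double_loop_itinerary:
  assumes loops: "double_loop l n p q D0 D1" and l: "1 \<le> l"
  obtains x where "x \<in> X" "itinerary l n D0 D1 w x"
proof -
  have pq: "p \<in> X" "q \<in> X"
    and \<alpha>: "pullback l p q p q (\<lambda>x. \<forall>i\<le>l. (f ^^ i) x \<in> D0)"
    and \<beta>: "pullback n p q p q (\<lambda>x. f x \<in> D1)"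
    using loops unfolding double_loop_def by blast+
  have \<alpha>1: "pullback l p q p q (\<lambda>x. f x \<in> D0)"
    by (rule pullback_mono[OF \<alpha>]) (use l in \<open>auto dest: spec[of _ 1]\<close>)
  have "\<exists>m. pullback m p q p q (itinerary l n D0 D1 w)"
  proof (induction w)
    case Nil
    have "pullback 0 p q p q (itinerary l n D0 D1 [])"
      by (rule pullback_mono[OF pullback_refl]) simp
    then show ?case by blast
  next
    case (Cons b w)
    then obtain m where m: "pullback m p q p q (itinerary l n D0 D1 w)" by blast
    show ?case
    proof (cases b)
      case True
      have "pullback (n + m) p q p q (itinerary l n D0 D1 (b # w))"
        by (rule pullback_mono[OF pullback_trans[OF \<beta> m pq]]) (simp add: True)
      then show ?thesis by blast
    next
      case False
      have "pullback (l + m) p q p q (itinerary l n D0 D1 (b # w))"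
        by (rule pullback_mono[OF pullback_trans[OF \<alpha>1 m pq]]) (simp add: False)
      then show ?thesis by blast
    qed
  qed
  then obtain m \<sigma> where "\<forall>z\<in>seg X p q. \<sigma> z \<in> seg X p q \<and> itinerary l n D0 D1 w (\<sigma> z)"
    unfolding pullback_def by blast
  then show thesis
    using that[of "\<sigma> p"] seg_ends(1)[OF pq] seg_subset_space[of X p q] by blast
qed

lemma double_loop_entropy:
  assumes loops: "double_loop l n p q D0 D1" and l: "1 \<le> l" "l \<le> n" "1 < n"
  shows "topological_entropy X f \<ge> ereal (ln 2 / real n)"
proof -
  have D: "closed D0" "closed D1" "D0 \<inter> D1 = {}"
    using loops unfolding double_loop_def by (auto intro: compact_imp_closed)
  have "\<forall>w. \<exists>x. x \<in> X \<and> itinerary l n D0 D1 w x"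
    using double_loop_itinerary[OF loops l(1)] by metis
  then obtain pt where pt: "\<And>w. pt w \<in> X" "\<And>w. itinerary l n D0 D1 w (pt w)" by metis
  show ?thesis
    by (rule topological_entropy_ge[OF maps D, of n pt])
      (use pt l itineraries_separated[OF _ _ l(3,2) pt(2) pt(2)] in auto)
qed

end

section \<open>Multiplying the periods of an interval map\<close>

text \<open>
  The dynamics of the map to be constructed, without topology. The point \<open>\<kappa> i t\<close> is the point of
  height \<open>t\<close> on collar number \<open>i\<close>; as long as heights stay positive, collars are visited cyclically and heights
  change by \<open>T i\<close>, and all other points fall into the fixed point \<open>c\<close>. Heights in \<open>{1/2..1}\<close>
  carry a copy of \<open>g\<close>. Heights below \<open>1/2\<close> cannot be avoided, since \<open>T i\<close> has to come down to \<open>0\<close>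
  continuously; there the maps are monotone, so that new cycles have period \<open>n\<close>, which belongs to the
  set of periods anyway.
\<close>

lemma conveyor_cycle_periods:
  fixes f :: "'a \<Rightarrow> 'a" and \<kappa> :: "nat \<Rightarrow> real \<Rightarrow> 'a" and T :: "nat \<Rightarrow> real \<Rightarrow> real"
    and g :: "real \<Rightarrow> real" and n :: nat
  defines "live \<equiv> {\<kappa> i t | i t. i < n \<and> t \<in> {0<..1}}"
  assumes n: "1 \<le> n" and maps: "f \<in> X \<rightarrow> X" and c: "c \<in> X" "f c = c" "c \<notin> live"
    and \<kappa>X: "live \<subseteq> X"
    and inj: "\<And>i j s t. i < n \<Longrightarrow> j < n \<Longrightarrow> s \<in> {0<..1} \<Longrightarrow> t \<in> {0<..1} \<Longrightarrow>
      \<kappa> i s = \<kappa> j t \<Longrightarrow> i = j \<and> s = t"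
    and dead: "\<And>x. x \<in> X \<Longrightarrow> x \<notin> live \<Longrightarrow> f x = c"
    and Tpos: "\<And>i t. i < n \<Longrightarrow> t \<in> {0<..1} \<Longrightarrow> 0 < T i t \<Longrightarrow>
      T i t \<le> 1 \<and> f (\<kappa> i t) = \<kappa> (Suc i mod n) (T i t)"
    and Tzero: "\<And>i t. i < n \<Longrightarrow> t \<in> {0<..1} \<Longrightarrow> \<not> 0 < T i t \<Longrightarrow> f (\<kappa> i t) \<notin> live"
    and T_id: "\<And>i t. Suc i < n \<Longrightarrow> t \<in> {1/2..1} \<Longrightarrow> T i t = t"
    and T_g: "\<And>t. t \<in> {0..1} \<Longrightarrow> T (n - 1) ((1 + t) / 2) = (1 + g t) / 2"
    and T_mono: "\<And>i s t. i < n \<Longrightarrow> 0 < s \<Longrightarrow> s \<le> t \<Longrightarrow> t < 1/2 \<Longrightarrow> T i s \<le> T i t"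
    and g: "g \<in> {0..1} \<rightarrow> {0..1}" "1 \<in> cycle_periods {0..1} g"
  shows "cycle_periods X f = {1} \<union> {n * k | k. k \<in> cycle_periods {0..1} g}"
proof -
  let ?half = "\<lambda>x :: real. (1 + x) / 2"
  have gn: "(g ^^ k) x \<in> {0..1}" if "x \<in> {0..1}" for k x
    using funpow_in[OF g(1) that] .
  have half: "?half x \<in> {1/2..1}" if "x \<in> {0..1}" for x using that by auto
  have orbit: "(f ^^ j) (\<kappa> 0 (?half x)) = \<kappa> (j mod n) (?half ((g ^^ (j div n)) x))"
    if x: "x \<in> {0..1}" for x j
  proof (induction j)
    case (Suc j)
    let ?i = "j mod n" and ?t = "?half ((g ^^ (j div n)) x)"
    have i: "?i < n" using n by simp
    have t: "?t \<in> {1/2..1}" using half[OF gn[OF x]] .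
    then have t': "?t \<in> {0<..1}" by auto
    have Teq: "T ?i ?t = ?half ((g ^^ (Suc j div n)) x)"
    proof (cases "Suc ?i = n")
      case True
      then have "Suc j mod n = 0" by (simp add: mod_Suc)
      then have "Suc j div n = Suc (j div n)" by (simp add: div_Suc)
      moreover have "?i = n - 1" using True by simp
      ultimately show ?thesis using T_g[OF gn[OF x]] by simp
    next
      case False
      then have "Suc j mod n \<noteq> 0" by (simp add: mod_Suc)
      then have "Suc j div n = j div n" by (simp add: div_Suc)
      then show ?thesis using T_id[of ?i ?t] False i t by simp
    qed
    have "0 < T ?i ?t" unfolding Teq using half[OF gn[OF x, of "Suc j div n"]] by simp
    then have "f (\<kappa> ?i ?t) = \<kappa> (Suc ?i mod n) (T ?i ?t)" using Tpos[OF i t'] by blast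
    then have "f (\<kappa> ?i ?t) = \<kappa> (Suc ?i mod n) (?half ((g ^^ (Suc j div n)) x))" unfolding Teq .
    then show ?case using Suc by (simp add: mod_Suc_eq)
  qed simp
  have orbit_eq: "(f ^^ j) (\<kappa> 0 (?half x)) = \<kappa> 0 (?half x) \<longleftrightarrow> n dvd j \<and> (g ^^ (j div n)) x = x"
    if x: "x \<in> {0..1}" for x j
  proof -
    have "j mod n < n" using n by simp
    then have "\<kappa> (j mod n) (?half ((g ^^ (j div n)) x)) = \<kappa> 0 (?half x) \<longleftrightarrow>
        j mod n = 0 \<and> (g ^^ (j div n)) x = x"
      using inj[of "j mod n" 0 "?half ((g ^^ (j div n)) x)" "?half x"] gn[OF x, of "j div n"] x n by auto
    then show ?thesis using orbit[OF x] by (auto simp: dvd_eq_mod_eq_0)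
  qed
  have upper_period: "k \<in> cycle_periods {0..1} g"
    if x: "x \<in> {0..1}" and k: "0 < k" "(f ^^ (n * k)) (\<kappa> 0 (?half x)) = \<kappa> 0 (?half x)"
      "\<And>j. 0 < j \<Longrightarrow> j < n * k \<Longrightarrow> (f ^^ j) (\<kappa> 0 (?half x)) \<noteq> \<kappa> 0 (?half x)" for x k
  proof (rule cycle_periodsI[OF g(1) x k(1)])
    show "(g ^^ k) x = x" using k(2) orbit_eq[OF x] n by simp
    fix j assume "0 < j" "j < k"
    then show "(g ^^ j) x \<noteq> x" using k(3)[of "n * j"] orbit_eq[OF x, of "n * j"] n by simp
  qed
  have "n * k \<in> cycle_periods X f" if k: "k \<in> cycle_periods {0..1} g" for k
  proof -
    obtain x where x: "x \<in> {0..1}" "0 < k" "(g ^^ k) x = x"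
      "\<And>j. 0 < j \<Longrightarrow> j < k \<Longrightarrow> (g ^^ j) x \<noteq> x"
      using cycle_periodsE[OF k] by metis
    show ?thesis
    proof (rule cycle_periodsI[OF maps])
      have "\<kappa> 0 (?half x) \<in> live" using n half[OF x(1)] unfolding live_def by fastforce
      then show "\<kappa> 0 (?half x) \<in> X" using \<kappa>X by blast
      show "0 < n * k" using n x by simp
      show "(f ^^ (n * k)) (\<kappa> 0 (?half x)) = \<kappa> 0 (?half x)" using orbit_eq[OF x(1)] x(3) n by simp
      fix j assume j: "0 < j" "j < n * k"
      show "(f ^^ j) (\<kappa> 0 (?half x)) \<noteq> \<kappa> 0 (?half x)"
      proof
        assume "(f ^^ j) (\<kappa> 0 (?half x)) = \<kappa> 0 (?half x)"
        then obtain q where "j = n * q" "(g ^^ q) x = x" using orbit_eq[OF x(1)] n by auto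
        then show False using x(4)[of q] j by auto
      qed
    qed
  qed
  moreover have "1 \<in> cycle_periods X f"
    by (rule cycle_periodsI[OF maps c(1)]) (use c(2) in auto)
  moreover have "\<exists>k. m = n * k \<and> k \<in> cycle_periods {0..1} g"
    if m: "m \<in> cycle_periods X f" "m \<noteq> 1" for m
  proof -
    obtain x where x: "x \<in> X" "0 < m" "(f ^^ m) x = x" "\<And>j. 0 < j \<Longrightarrow> j < m \<Longrightarrow> (f ^^ j) x \<noteq> x"
      using cycle_periodsE[OF m(1)] by metis
    have fx: "f x \<noteq> x" using x(4)[of 1] x(2) m(2) by auto
    have fcn: "(f ^^ j) c = c" for j using c(2) by (induction j) auto
    have no_c: "(f ^^ j) x \<noteq> c" for j
    proof
      assume j: "(f ^^ j) x = c"
      have "x = (f ^^ (m * j)) x" using funpow_periodic[OF x(3)] by simp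
      also have "\<dots> = (f ^^ ((m - 1) * j)) ((f ^^ j) x)"
        using x(2) by (cases m) (simp_all add: funpow_add[symmetric] add.commute flip: comp_apply[of "f ^^ _" "f ^^ _"])
      also have "\<dots> = c" using j fcn by simp
      finally show False using fx c(2) by simp
    qed
    have alive: "(f ^^ j) x \<in> live" for j
      using dead[of "(f ^^ j) x"] funpow_in[OF maps x(1)] no_c[of "Suc j"] by auto
    then obtain i0 t0 where it0: "x = \<kappa> i0 t0" "i0 < n" "t0 \<in> {0<..1}"
      using alive[of 0] by (auto simp: live_def)
    have next_alive: "\<exists>t'\<in>{0<..1}. t' = T i t \<and> (f ^^ Suc j) x = \<kappa> (Suc i mod n) t'"
      if "(f ^^ j) x = \<kappa> i t" "i < n" "t \<in> {0<..1}" for i t j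
      using Tpos[OF that(2,3)] Tzero[OF that(2,3)] alive[of "Suc j"] that(1) by fastforce
    have "\<exists>t\<in>{0<..1}. (f ^^ j) x = \<kappa> ((i0 + j) mod n) t" for j
    proof (induction j)
      case (Suc j)
      then obtain t where t: "t \<in> {0<..1}" "(f ^^ j) x = \<kappa> ((i0 + j) mod n) t" by blast
      then show ?case using next_alive[OF t(2) _ t(1)] n by (auto simp: mod_Suc_eq)
    qed (use it0 in auto)
    then obtain s where s: "\<And>j. s j \<in> {0<..1}" "\<And>j. (f ^^ j) x = \<kappa> ((i0 + j) mod n) (s j)"
      by metis
    \<comment> \<open>Start the orbit on collar number 0.\<close>
    define y where "y = (f ^^ (n - i0)) x"
    define t where "t = (\<lambda>j. s (j + (n - i0)))"
    have fy: "(f ^^ j) y = (f ^^ (j + (n - i0))) x" for j by (simp add: y_def funpow_add)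
    have y: "(f ^^ j) y = \<kappa> (j mod n) (t j)" for j
    proof -
      have "(i0 + (j + (n - i0))) mod n = j mod n" using it0(2) by simp
      then show ?thesis unfolding fy s(2) t_def by simp
    qed
    have t: "t j \<in> {0<..1}" for j using s(1) by (simp add: t_def)
    have t_step: "t (Suc j) = T (j mod n) (t j)" for j
    proof -
      obtain t' where t': "t' \<in> {0<..1}" "t' = T (j mod n) (t j)"
        "(f ^^ Suc (j + (n - i0))) x = \<kappa> (Suc (j mod n) mod n) t'"
        using next_alive[of "j + (n - i0)" "j mod n" "t j"] y[of j] fy[of j] t n by auto
      then have "\<kappa> (Suc j mod n) (t (Suc j)) = \<kappa> (Suc j mod n) t'"
        using y[of "Suc j"] fy[of "Suc j"] by (simp add: mod_Suc_eq)
      then show ?thesis using inj[of "Suc j mod n" "Suc j mod n" "t (Suc j)" t'] t t' n by auto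
    qed
    have ym: "(f ^^ m) y = y"
    proof -
      have "(f ^^ m) y = (f ^^ (n - i0)) ((f ^^ m) x)"
        unfolding fy by (subst add.commute) (simp add: funpow_add)
      then show ?thesis using x(3) by (simp add: y_def)
    qed
    have y_least: "(f ^^ j) y \<noteq> y" if j: "0 < j" "j < m" for j
    proof
      assume "(f ^^ j) y = y"
      then obtain d where d: "0 < d" "d dvd m" "d < m" "(f ^^ d) y = y"
        using least_period_dvd[OF ym j] by metis
      obtain b where b: "n - i0 + b = m * n" using it0(2) x(2)
        by (metis diff_le_self le_trans le_add_diff_inverse mult_le_mono1 mult_1 Suc_leI One_nat_def)
      have "(f ^^ b) y = (f ^^ (m * n)) x" unfolding fy b[symmetric] by (simp add: add.commute)
      then have bx: "(f ^^ b) y = x" using funpow_periodic[OF x(3)] by simp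
      have "(f ^^ d) x = (f ^^ (d + b)) y" unfolding bx[symmetric] by (simp add: funpow_add)
      also have "\<dots> = (f ^^ b) ((f ^^ d) y)" by (subst add.commute) (simp add: funpow_add)
      also have "\<dots> = x" using d(4) bx by simp
      finally show False using x(4)[OF d(1,3)] by simp
    qed
    have "\<kappa> (m mod n) (t m) = \<kappa> 0 (t 0)" using ym y[of m] y[of 0] by simp
    then have "m mod n = 0" using inj[of "m mod n" 0 "t m" "t 0"] t n by auto
    then obtain k where k: "m = n * k" by auto
    then have k0: "0 < k" using x(2) by (cases k) auto
    have t_per: "t (j + m * q) = t j" for j q
    proof -
      have "(f ^^ (j + m * q)) y = (f ^^ j) y" using funpow_periodic[OF ym, of q] by (simp add: funpow_add)
      then have "\<kappa> (j mod n) (t (j + m * q)) = \<kappa> (j mod n) (t j)" using y k by (simp add: mult.assoc)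
      then show ?thesis using inj[of "j mod n" "j mod n" "t (j + m * q)" "t j"] t n by auto
    qed
    show ?thesis
    proof (cases "\<exists>j. t j \<ge> 1/2")
      case True
      then obtain j where j: "t j \<ge> 1/2" by blast
      have up: "t (Suc j) \<ge> 1/2" if tj: "t j \<ge> 1/2" for j
      proof (cases "Suc (j mod n) < n")
        case True
        then show ?thesis using t_step[of j] T_id[of "j mod n" "t j"] t[of j] tj by auto
      next
        case False
        then have "j mod n = n - 1" using n mod_less_divisor[of n j] by linarith
        moreover have u: "2 * t j - 1 \<in> {0..1}" using t[of j] tj by auto
        moreover have "g (2 * t j - 1) \<in> {0..1}" using g(1) u by blast
        ultimately show ?thesis using t_step[of j] T_g[OF u] by auto
      qed
      have "t (j + i) \<ge> 1/2" for i using up j by (induction i) auto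
      moreover have "j \<le> m * j" using x(2) by simp
      ultimately have "t (0 + m * j) \<ge> 1/2" by (metis add_0 le_add_diff_inverse)
      then have t0: "t 0 \<ge> 1/2" unfolding t_per .
      define u where "u = 2 * t 0 - 1"
      have u: "u \<in> {0..1}" using t0 t[of 0] by (auto simp: u_def)
      have yu: "y = \<kappa> 0 (?half u)" using y[of 0] by (simp add: u_def)
      have "k \<in> cycle_periods {0..1} g"
      proof (rule upper_period[OF u k0])
        show "(f ^^ (n * k)) (\<kappa> 0 (?half u)) = \<kappa> 0 (?half u)" using ym k yu by simp
        show "(f ^^ j) (\<kappa> 0 (?half u)) \<noteq> \<kappa> 0 (?half u)" if "0 < j" "j < n * k" for j
          using y_least[of j] that k yu by simp
      qed
      then show ?thesis using k by blast
    next
      case False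
      then have low: "t j < 1/2" for j by (meson not_less)
      \<comment> \<open>Below \<open>1/2\<close> one full turn is an increasing map, so a cycle closes after one turn.\<close>
      have mono: "t (Suc a) \<le> t (Suc b)" if "t a \<le> t b" "a mod n = b mod n" for a b
        using T_mono[of "a mod n" "t a" "t b"] t_step[of a] t_step[of b] that t[of a] low[of b] n by auto
      have inc: "t j \<le> t (j + n)" if "t 0 \<le> t n" for j
        using that by (induction j) (auto intro: mono)
      have dec: "t (j + n) \<le> t j" if "t n \<le> t 0" for j
        using that by (induction j) (auto intro: mono)
      have inc': "t n \<le> t (n * Suc q)" if "t 0 \<le> t n" for q
      proof (induction q)
        case (Suc q)
        have "t (n * Suc q) \<le> t (n * Suc q + n)" using inc[OF that] .
        moreover have "n * Suc q + n = n * Suc (Suc q)" by simp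
        ultimately show ?case using Suc by (metis order_trans)
      qed simp
      have dec': "t (n * Suc q) \<le> t n" if "t n \<le> t 0" for q
      proof (induction q)
        case (Suc q)
        have "t (n * Suc q + n) \<le> t (n * Suc q)" using dec[OF that] .
        moreover have "n * Suc q + n = n * Suc (Suc q)" by simp
        ultimately show ?case using Suc by (metis order_trans)
      qed simp
      obtain q where q: "k = Suc q" using k0 by (cases k) auto
      have "t (n * Suc q) = t 0" using t_per[of 0 1] k q by simp
      then have "t n = t 0" using inc'[of q] dec'[of q] by linarith
      then have "(f ^^ n) y = y" using y[of n] y[of 0] by simp
      then have "\<not> n < m" using y_least[of n] n by auto
      then have "k = 1" using k k0 n by (cases k) auto
      then show ?thesis using k g(2) by blast
    qed
  qed
  ultimately show ?thesis by blast
qed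

lemma interval_map_fixpoint:
  fixes g :: "real \<Rightarrow> real"
  assumes "continuous_on {0..1} g" "g \<in> {0..1} \<rightarrow> {0..1}"
  shows "1 \<in> cycle_periods {0..1} g"
proof -
  have c: "continuous_on {0..1} (\<lambda>x. g x - x)" using assms(1) by (intro continuous_intros)
  have "g 0 \<in> {0..1}" "g 1 \<in> {0..1}" using assms(2) by (auto simp: Pi_iff)
  then obtain x where x: "0 \<le> x" "x \<le> 1" "g x - x = 0"
    using IVT2'[of "\<lambda>x. g x - x" 1 0 0] c by auto
  then show ?thesis
    by (intro cycle_periodsI[OF assms(2), of x]) auto
qed

text \<open>
  The chart of an endpoint is shortened, so that its image becomes compact and contains no other
  endpoint.
\<close>

lemma endpoint_collar:
  fixes X :: "'a::t2_space set"
  assumes e: "e \<in> endpoints X"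
  obtains k :: "real \<Rightarrow> 'a" where "continuous_on {0..1} k" "inj_on k {0..1}" "k ` {0..1} \<subseteq> X" "k 0 = e"
    "endpoints X \<inter> k ` {0..1} = {e}"
    "\<And>\<epsilon>. 0 < \<epsilon> \<Longrightarrow> \<epsilon> \<le> 1 \<Longrightarrow> openin (top_of_set X) (k ` {0..<\<epsilon>})"
proof -
  obtain U h k0 where U: "openin (top_of_set X) U" "e \<in> U" "homeomorphism U {0..<1::real} h k0" "h e = 0"
    using e by (auto simp: endpoints_def)
  have k0: "continuous_on {0..<1} k0" "k0 ` {0..<1} = U" "\<And>t. t \<in> {0..<1} \<Longrightarrow> h (k0 t) = t"
    and k00: "k0 0 = e"
    using U by (auto simp: homeomorphism_def)
  have UX: "U \<subseteq> X" using U(1) by (rule openin_imp_subset)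
  have inj: "inj_on k0 {0..<1}" using k0(3) by (rule inj_on_inverseI)
  define k where "k = (\<lambda>t. k0 (t / 2))"
  define c where "c = (\<lambda>t. k0 (3 * t / 4))"
  have "path c"
    unfolding path_def c_def
    by (rule continuous_on_compose2[OF k0(1)]) (auto intro!: continuous_intros)
  moreover have "inj_on c {0..1}"
    using inj_onD[OF inj] by (fastforce simp: c_def inj_on_def)
  ultimately have c: "arc c" by (simp add: arc_def)
  have cX: "path_image c \<subseteq> X" using k0(2) UX by (force simp: path_image_def c_def)
  show thesis
  proof
    show "continuous_on {0..1} k"
      unfolding k_def
      by (rule continuous_on_compose2[OF k0(1)]) (auto intro!: continuous_intros)
    show "inj_on k {0..1}"
      using inj_onD[OF inj] by (fastforce simp: k_def inj_on_def)
    show "k ` {0..1} \<subseteq> X" using k0(2) UX by (force simp: k_def)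
    show "k 0 = e" using k00 by (simp add: k_def)
    show "endpoints X \<inter> k ` {0..1} = {e}"
    proof
      show "endpoints X \<inter> k ` {0..1} \<subseteq> {e}"
      proof
        fix x assume x: "x \<in> endpoints X \<inter> k ` {0..1}"
        then obtain t where t: "x = k t" "t \<in> {0..1}" by auto
        then have "x = c (2 * t / 3)" by (simp add: k_def c_def)
        then have "2 * t / 3 = 0 \<or> 2 * t / 3 = 1"
          using endpoint_not_inside_arc[of x X c "2 * t / 3"] x c cX t(2) by auto
        then have "t = 0" using t(2) by auto
        then show "x \<in> {e}" using t(1) k00 by (simp add: k_def)
      qed
      show "{e} \<subseteq> endpoints X \<inter> k ` {0..1}"
        using e k00 by (force simp: k_def)
    qed
    fix \<epsilon> :: real assume \<epsilon>: "0 < \<epsilon>" "\<epsilon> \<le> 1"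
    have "{0..<\<epsilon>/2} = {0..<1} \<inter> {..<\<epsilon>/2}" using \<epsilon> by auto
    then have "openin (top_of_set {0..<1}) {0..<\<epsilon>/2}" by (metis open_lessThan openin_open_Int)
    then have "openin (top_of_set U) (k0 ` {0..<\<epsilon>/2})"
      by (rule homeomorphism_imp_open_map[OF homeomorphism_symD[OF U(3)]])
    moreover have "k ` {0..<\<epsilon>} = k0 ` {0..<\<epsilon>/2}"
    proof
      show "k ` {0..<\<epsilon>} \<subseteq> k0 ` {0..<\<epsilon>/2}" by (force simp: k_def)
      show "k0 ` {0..<\<epsilon>/2} \<subseteq> k ` {0..<\<epsilon>}"
      proof
        fix x assume "x \<in> k0 ` {0..<\<epsilon>/2}"
        then obtain t where "x = k (2 * t)" "2 * t \<in> {0..<\<epsilon>}" by (auto simp: k_def)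
        then show "x \<in> k ` {0..<\<epsilon>}" by blast
      qed
    qed
    ultimately show "openin (top_of_set X) (k ` {0..<\<epsilon>})"
      using U(1) openin_trans by metis
  qed
qed

lemma eventually_collar_misses_closed:
  fixes k :: "real \<Rightarrow> 'a::topological_space"
  assumes "continuous_on {0..1} k" "closed K" "k 0 \<notin> K"
  shows "eventually (\<lambda>\<epsilon>. k ` {0..\<epsilon>} \<inter> K = {}) (at_right 0)"
proof -
  have "eventually (\<lambda>t. k t \<in> - K) (at 0 within {0..1})"
    using assms by (intro topological_tendstoD[of k "k 0"]) (auto simp: continuous_on_def)
  then obtain d where d: "d > 0" "\<And>t. t \<in> {0..1} \<Longrightarrow> t \<noteq> 0 \<Longrightarrow> dist t 0 < d \<Longrightarrow> k t \<in> - K"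
    unfolding eventually_at by blast
  have "k ` {0..\<epsilon>} \<inter> K = {}" if "\<epsilon> < min d 1" for \<epsilon>
  proof -
    have "k t \<notin> K" if "t \<in> {0..\<epsilon>}" for t
      using d(2)[of t] assms(3) that \<open>\<epsilon> < min d 1\<close> by (cases "t = 0") auto
    then show ?thesis by auto
  qed
  then show ?thesis
    unfolding eventually_at_right_field using d(1) by (intro exI[of _ "min d 1"]) auto
qed

lemma (in arc_tree) seg_pathE:
  assumes "x \<in> X" "y \<in> X"
  obtains p where "path p" "pathstart p = x" "pathfinish p = y" "path_image p = seg X x y"
proof (cases "x = y")
  case True
  then show thesis
    using that[of "\<lambda>_. x"] assms by (simp add: path_def pathstart_def pathfinish_def)
next
  case False
  then show thesis
    using that assms unique_arcs unfolding uniquely_arc_connected_def by (metis arc_imp_path)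
qed

context tree
begin

text \<open>
  Collars \<open>k i\<close> of \<open>n\<close> endpoints, parametrised from the endpoint inwards, and paths \<open>\<delta> i\<close> from \<open>c\<close> to these
  endpoints. The first half of \<open>\<delta> i\<close> avoids the parts \<open>k j ` {0..\<epsilon>}\<close> of all collars, and the second half is the collar
  \<open>k i\<close> run outwards.
\<close>

definition spoke_system :: "nat \<Rightarrow> 'a \<Rightarrow> real \<Rightarrow> (nat \<Rightarrow> real \<Rightarrow> 'a) \<Rightarrow> (nat \<Rightarrow> real \<Rightarrow> 'a) \<Rightarrow> bool" where
  "spoke_system n c \<epsilon> k \<delta> \<longleftrightarrow> c \<in> X \<and> 0 < \<epsilon> \<and> \<epsilon> < 1 \<and>
    (\<forall>i<n. continuous_on {0..1} (k i) \<and> inj_on (k i) {0..1} \<and> k i ` {0..1} \<subseteq> X \<and>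
      openin (top_of_set X) (k i ` {0..<\<epsilon>})) \<and>
    (\<forall>i<n. \<forall>j<n. i \<noteq> j \<longrightarrow> k j ` {0..\<epsilon>} \<inter> k i ` {0..1} = {}) \<and>
    (\<forall>i<n. path (\<delta> i) \<and> path_image (\<delta> i) \<subseteq> X \<and> \<delta> i 0 = c) \<and>
    (\<forall>i<n. \<forall>u. 1/2 < u \<and> u \<le> 1 \<longrightarrow> \<delta> i u = k i (2 - 2 * u)) \<and>
    (\<forall>i<n. \<forall>j<n. \<forall>u. 0 \<le> u \<and> u \<le> 1/2 \<longrightarrow> \<delta> i u \<notin> k j ` {0..\<epsilon>})"

text \<open>
  An endpoint lies on a segment only as one of its ends. So sufficiently short collars miss the segments from
  \<open>c\<close> to the inner ends of the collars, and they miss the other collars.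
\<close>

lemma collars_and_spokes:
  assumes n: "1 \<le> n" "n \<le> End X"
  shows "\<exists>c \<epsilon> k \<delta>. spoke_system n c \<epsilon> k \<delta>"
proof -
  obtain S where S: "S \<subseteq> endpoints X" "card S = n" "finite S"
    using n(2) unfolding End_def by (rule obtain_subset_with_card_n)
  then obtain e where "bij_betw e {..<n} S"
    using ex_bij_betw_nat_finite[OF S(3)] by (auto simp: atLeast0LessThan)
  then have e: "\<And>i. i < n \<Longrightarrow> e i \<in> endpoints X" "inj_on e {..<n}"
    using S(1) by (auto simp: bij_betw_def)
  let ?K = "\<lambda>i (k :: real \<Rightarrow> 'a). continuous_on {0..1} k \<and> inj_on k {0..1} \<and> k ` {0..1} \<subseteq> X \<and> k 0 = e i \<and>
    endpoints X \<inter> k ` {0..1} = {e i} \<and>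
    (\<forall>\<epsilon>. 0 < \<epsilon> \<and> \<epsilon> \<le> 1 \<longrightarrow> openin (top_of_set X) (k ` {0..<\<epsilon>}))"
  have "\<exists>k. ?K i k" if i: "i < n" for i
  proof (rule endpoint_collar[OF e(1)[OF i]])
    fix k :: "real \<Rightarrow> 'a"
    assume "continuous_on {0..1} k" "inj_on k {0..1}" "k ` {0..1} \<subseteq> X" "k 0 = e i"
      "endpoints X \<inter> k ` {0..1} = {e i}"
      "\<And>\<epsilon>. 0 < \<epsilon> \<Longrightarrow> \<epsilon> \<le> 1 \<Longrightarrow> openin (top_of_set X) (k ` {0..<\<epsilon>})"
    then have "?K i k" by (intro conjI allI impI) auto
    then show ?thesis by - (rule exI, assumption)
  qed
  then have "\<forall>i\<in>{..<n}. \<exists>k. ?K i k" by blast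
  then obtain k where k: "\<forall>i\<in>{..<n}. ?K i (k i)" by (rule bchoice[THEN exE])
  \<comment> \<open>The inner end of a collar serves as centre, since it is not an endpoint.\<close>
  define c where "c = k 0 1"
  have b: "k i 1 \<in> X" "k i 1 \<notin> endpoints X" if i: "i < n" for i
  proof -
    show "k i 1 \<in> X" using k i by force
    have "inj_on (k i) {0..1}" using k i by simp
    then have "k i 1 \<noteq> k i 0" using inj_onD[of "k i" "{0..1}" 1 0] by auto
    moreover have "k i 1 \<in> k i ` {0..1}" by simp
    moreover have "endpoints X \<inter> k i ` {0..1} = {k i 0}" using k i by simp
    ultimately show "k i 1 \<notin> endpoints X" by blast
  qed
  have c: "c \<in> X" "c \<notin> endpoints X" using b[of 0] n by (auto simp: c_def)
  have eK: "k j 0 \<notin> seg X c (k i 1)" if "i < n" "j < n" for i j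
  proof
    assume "k j 0 \<in> seg X c (k i 1)"
    moreover have "k j 0 \<in> endpoints X" using k e(1) that by auto
    ultimately have "k j 0 = c \<or> k j 0 = k i 1"
      using endpoint_not_between c(1) b(1) that by blast
    then show False using \<open>k j 0 \<in> endpoints X\<close> c(2) b(2)[OF that(1)] by auto
  qed
  have eL: "k j 0 \<notin> k i ` {0..1}" if "i < n" "j < n" "i \<noteq> j" for i j
  proof
    assume "k j 0 \<in> k i ` {0..1}"
    moreover have "k j 0 = e j" using k that(2) by simp
    ultimately have "e j \<in> endpoints X \<inter> k i ` {0..1}" using e(1)[OF that(2)] by simp
    moreover have "endpoints X \<inter> k i ` {0..1} = {e i}" using k that(1) by simp
    ultimately have "e j = e i" by blast
    then show False using e(2) that by (auto simp: inj_on_def)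
  qed
  have cpt: "compact (k i ` {0..1})" if "i < n" for i
    using k that by (intro compact_continuous_image) auto
  have "eventually (\<lambda>\<epsilon>. \<forall>i\<in>{..<n}. \<forall>j\<in>{..<n}. k j ` {0..\<epsilon>} \<inter> seg X c (k i 1) = {} \<and>
      (i \<noteq> j \<longrightarrow> k j ` {0..\<epsilon>} \<inter> k i ` {0..1} = {})) (at_right 0)"
  proof (intro eventually_ball_finite ballI finite_lessThan)
    fix i j assume ij: "i \<in> {..<n}" "j \<in> {..<n}"
    have "closed (seg X c (k i 1))"
      using seg_connected_compact(2)[OF c(1) b(1)] ij by (auto intro: compact_imp_closed)
    then have 1: "eventually (\<lambda>\<epsilon>. k j ` {0..\<epsilon>} \<inter> seg X c (k i 1) = {}) (at_right 0)"
      using k ij eK by (intro eventually_collar_misses_closed) auto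
    have 2: "eventually (\<lambda>\<epsilon>. i \<noteq> j \<longrightarrow> k j ` {0..\<epsilon>} \<inter> k i ` {0..1} = {}) (at_right 0)"
    proof (cases "i = j")
      case False
      then have "eventually (\<lambda>\<epsilon>. k j ` {0..\<epsilon>} \<inter> k i ` {0..1} = {}) (at_right 0)"
        using k ij eL compact_imp_closed[OF cpt] by (intro eventually_collar_misses_closed) auto
      then show ?thesis by (rule eventually_mono) simp
    qed simp
    show "eventually (\<lambda>\<epsilon>. k j ` {0..\<epsilon>} \<inter> seg X c (k i 1) = {} \<and>
      (i \<noteq> j \<longrightarrow> k j ` {0..\<epsilon>} \<inter> k i ` {0..1} = {})) (at_right 0)"
      by (rule eventually_conj[OF 1 2])
  qed
  moreover have "eventually (\<lambda>\<epsilon>. \<epsilon> \<in> {0<..<1}) (at_right (0::real))"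
    by (rule eventually_at_right_real) simp
  ultimately have "\<exists>\<epsilon>. (\<forall>i\<in>{..<n}. \<forall>j\<in>{..<n}. k j ` {0..\<epsilon>} \<inter> seg X c (k i 1) = {} \<and>
      (i \<noteq> j \<longrightarrow> k j ` {0..\<epsilon>} \<inter> k i ` {0..1} = {})) \<and> \<epsilon> \<in> {0<..<1}"
    by (intro eventually_happens'[OF trivial_limit_at_right_real] eventually_conj)
  then obtain \<epsilon> where "(\<forall>i\<in>{..<n}. \<forall>j\<in>{..<n}. k j ` {0..\<epsilon>} \<inter> seg X c (k i 1) = {} \<and>
      (i \<noteq> j \<longrightarrow> k j ` {0..\<epsilon>} \<inter> k i ` {0..1} = {})) \<and> \<epsilon> \<in> {0<..<1}"
    by (rule exE)
  then have \<epsilon>: "0 < \<epsilon>" "\<epsilon> < 1"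
    and missK: "\<And>i j. i < n \<Longrightarrow> j < n \<Longrightarrow> k j ` {0..\<epsilon>} \<inter> seg X c (k i 1) = {}"
    and missL: "\<And>i j. i < n \<Longrightarrow> j < n \<Longrightarrow> i \<noteq> j \<Longrightarrow> k j ` {0..\<epsilon>} \<inter> k i ` {0..1} = {}"
    by auto
  let ?P = "\<lambda>i p. path p \<and> pathstart p = c \<and> pathfinish p = k i 1 \<and> path_image p = seg X c (k i 1)"
  have "\<exists>p. ?P i p" if i: "i < n" for i
    by (rule seg_pathE[OF c(1) b(1)[OF i]]) blast
  then have "\<forall>i\<in>{..<n}. \<exists>p. ?P i p" by blast
  then obtain p where p: "\<forall>i\<in>{..<n}. ?P i (p i)" by (rule bchoice[THEN exE])
  define \<delta> where "\<delta> = (\<lambda>i. p i +++ reversepath (k i))"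
  have "spoke_system n c \<epsilon> k \<delta>"
    unfolding spoke_system_def
  proof (intro conjI allI impI)
    show "c \<in> X" "0 < \<epsilon>" "\<epsilon> < 1" using c \<epsilon> by auto
    fix i assume i: "i < n"
    show "continuous_on {0..1} (k i)" "inj_on (k i) {0..1}" "k i ` {0..1} \<subseteq> X"
      "openin (top_of_set X) (k i ` {0..<\<epsilon>})"
      using k i \<epsilon> by auto
    show "k j ` {0..\<epsilon>} \<inter> k i ` {0..1} = {}" if "j < n" "i \<noteq> j" for j
      using missL i that by blast
    have pk: "path (k i)" "path_image (k i) \<subseteq> X" using k i by (auto simp: path_def path_image_def)
    have pi: "path (p i)" "p i 0 = c" "pathfinish (p i) = k i 1" "path_image (p i) = seg X c (k i 1)"
      using p i by (auto simp: pathstart_def)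
    have joins: "pathfinish (p i) = pathstart (reversepath (k i))"
      using pi(3) by (simp add: pathfinish_def)
    then show "path (\<delta> i)" unfolding \<delta>_def using pi(1) pk(1) by simp
    show "path_image (\<delta> i) \<subseteq> X"
      unfolding \<delta>_def using joins pi(4) pk(2) seg_subset_space[of X c "k i 1"]
      by (simp add: path_image_join)
    show "\<delta> i 0 = c" using pi(2) by (simp add: \<delta>_def joinpaths_def)
    show "\<delta> i u = k i (2 - 2 * u)" if "1/2 < u \<and> u \<le> 1" for u
      using that by (simp add: \<delta>_def joinpaths_def reversepath_def)
    show "\<delta> i u \<notin> k j ` {0..\<epsilon>}" if j: "j < n" and u: "0 \<le> u \<and> u \<le> 1/2" for j u
    proof -
      have "\<delta> i u = p i (2 * u)" using u by (simp add: \<delta>_def joinpaths_def)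
      then have "\<delta> i u \<in> seg X c (k i 1)" using pi(4) u by (auto simp: path_image_def)
      then show ?thesis using missK[OF i j] by blast
    qed
  qed
  then show ?thesis by blast
qed

text \<open>
  The map sends the point of height \<open>t\<close> on collar \<open>i\<close> to \<open>\<delta> (i + 1) (\<theta> i t)\<close>, with \<open>\<theta> i 0 = 0\<close>, and the rest of the
  tree to \<open>c = \<delta> (i + 1) 0\<close>, which makes it continuous.
\<close>

lemma multiplied_periods:
  fixes g :: "real \<Rightarrow> real"
  assumes n: "1 \<le> n" "n \<le> End X" and g: "continuous_on {0..1} g" "g \<in> {0..1} \<rightarrow> {0..1}"
  shows "\<exists>f. continuous_on X f \<and> f \<in> X \<rightarrow> X \<and>
    cycle_periods X f = {1} \<union> {n * k | k. k \<in> cycle_periods {0..1} g}"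
proof -
  obtain c \<epsilon> k \<delta> where spokes: "spoke_system n c \<epsilon> k \<delta>"
    using collars_and_spokes[OF n] by blast
  have c: "c \<in> X" and \<epsilon>: "0 < \<epsilon>" "\<epsilon> < 1"
    and k: "\<And>i. i < n \<Longrightarrow> continuous_on {0..1} (k i) \<and> inj_on (k i) {0..1} \<and> k i ` {0..1} \<subseteq> X"
    and kopen: "\<And>i. i < n \<Longrightarrow> openin (top_of_set X) (k i ` {0..<\<epsilon>})"
    and kdisj: "\<And>i j. i < n \<Longrightarrow> j < n \<Longrightarrow> i \<noteq> j \<Longrightarrow> k j ` {0..\<epsilon>} \<inter> k i ` {0..1} = {}"
    and \<delta>: "\<And>i. i < n \<Longrightarrow> path (\<delta> i) \<and> path_image (\<delta> i) \<subseteq> X \<and> \<delta> i 0 = c"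
    and \<delta>_up: "\<And>i u. i < n \<Longrightarrow> 1/2 < u \<Longrightarrow> u \<le> 1 \<Longrightarrow> \<delta> i u = k i (2 - 2 * u)"
    and \<delta>_low: "\<And>i j u. i < n \<Longrightarrow> j < n \<Longrightarrow> 0 \<le> u \<Longrightarrow> u \<le> 1/2 \<Longrightarrow> \<delta> i u \<notin> k j ` {0..\<epsilon>}"
    using spokes unfolding spoke_system_def by simp_all
  \<comment> \<open>Height \<open>1\<close> is the endpoint, height \<open>0\<close> the inner end of the short collar.\<close>
  define \<kappa> where "\<kappa> = (\<lambda>i t. k i (\<epsilon> * (1 - t)))"
  define live where "live = {\<kappa> i t | i t. i < n \<and> t \<in> {0<..1}}"
  \<comment> \<open>\<open>\<tau> u\<close> is the height of \<open>\<delta> i u\<close>, and \<open>\<rho>\<close> is a right inverse of \<open>\<tau>\<close>.\<close>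
  define \<tau> where "\<tau> = (\<lambda>u. max 0 (1 - (2 - 2 * u) / \<epsilon>))"
  define \<rho> where "\<rho> = (\<lambda>t. 1 - \<epsilon> * (1 - t) / 2)"
  \<comment> \<open>The copy of \<open>g\<close> acts on the last collar only; \<open>\<theta>\<close> extends it linearly to heights below \<open>1/2\<close>.\<close>
  define G where "G = (\<lambda>i t. if Suc i = n then (1 + g (2 * t - 1)) / 2 else t)"
  define \<theta> where "\<theta> = (\<lambda>i t. if t \<le> 1/2 then 2 * t * \<rho> (G i (1/2)) else \<rho> (G i t))"
  define T where "T = (\<lambda>i t. \<tau> (\<theta> i t))"
  have \<epsilon>_mult: "\<epsilon> * (1 - t) \<in> {0..\<epsilon>}" if "t \<in> {0..1}" for t
    using that \<epsilon> mult_left_le[of "1 - t" \<epsilon>] by auto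
  have live_eq: "live = (\<Union>i<n. k i ` {0..<\<epsilon>})"
  proof
    show "live \<subseteq> (\<Union>i<n. k i ` {0..<\<epsilon>})"
    proof
      fix x assume "x \<in> live"
      then obtain i t where it: "i < n" "t \<in> {0<..1}" "x = k i (\<epsilon> * (1 - t))"
        by (auto simp: live_def \<kappa>_def)
      have "\<epsilon> * (1 - t) \<in> {0..<\<epsilon>}" using it(2) \<epsilon> by auto
      then show "x \<in> (\<Union>i<n. k i ` {0..<\<epsilon>})" using it by blast
    qed
    show "(\<Union>i<n. k i ` {0..<\<epsilon>}) \<subseteq> live"
    proof
      fix x assume "x \<in> (\<Union>i<n. k i ` {0..<\<epsilon>})"
      then obtain i s where si: "i < n" "s \<in> {0..<\<epsilon>}" "x = k i s" by auto
      then have "x = \<kappa> i (1 - s / \<epsilon>)" "1 - s / \<epsilon> \<in> {0<..1}" using \<epsilon> by (auto simp: \<kappa>_def)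
      then show "x \<in> live" using si(1) unfolding live_def by blast
    qed
  qed
  have \<kappa>_inj: "i = j \<and> s = t" if ij: "i < n" "j < n" "s \<in> {0..1}" "t \<in> {0..1}" "\<kappa> i s = \<kappa> j t" for i j s t
  proof -
    have s: "\<epsilon> * (1 - s) \<in> {0..\<epsilon>}" and t: "\<epsilon> * (1 - t) \<in> {0..\<epsilon>}"
      using \<epsilon>_mult ij(3,4) by blast+
    have sub: "{0..\<epsilon>} \<subseteq> {0..1}" using \<epsilon> by auto
    have "k i (\<epsilon> * (1 - s)) \<in> k j ` {0..\<epsilon>}" using t ij(5) by (simp add: \<kappa>_def)
    moreover have "\<epsilon> * (1 - s) \<in> {0..1}" using s sub by blast
    ultimately have "i = j" using kdisj[of i j] ij by blast
    moreover have "\<epsilon> * (1 - t) \<in> {0..1}" using t sub by blast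
    ultimately have "\<epsilon> * (1 - s) = \<epsilon> * (1 - t)"
      using inj_onD[OF conjunct1[OF conjunct2[OF k[OF ij(1)]]]] ij(5) \<open>\<epsilon> * (1 - s) \<in> {0..1}\<close>
      unfolding \<kappa>_def by blast
    then show ?thesis using \<open>i = j\<close> \<epsilon> by simp
  qed
  have \<rho>_range: "1 - \<epsilon> / 2 \<le> \<rho> t \<and> \<rho> t \<le> 1" if "t \<in> {0..1}" for t
    using that \<epsilon>_mult[OF that] by (auto simp: \<rho>_def)
  have \<tau>\<rho>: "\<tau> (\<rho> t) = t" if "t \<in> {0..1}" for t
    using that \<epsilon> by (simp add: \<tau>_def \<rho>_def)
  have G: "G i t \<in> {1/2..1}" if "t \<in> {1/2..1}" for i t
  proof -
    have "g (2 * t - 1) \<in> {0..1}" using g(2) that by (auto simp: Pi_iff)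
    then show ?thesis using that by (auto simp: G_def)
  qed
  have \<theta>_half: "\<theta> i t = \<rho> (G i t)" if "t \<in> {1/2..1}" for i t
  proof (cases "t \<le> 1/2")
    case True
    have "t = 1/2" using that True by simp
    show ?thesis unfolding \<theta>_def \<open>t = 1/2\<close> by simp
  next
    case False
    then show ?thesis by (simp add: \<theta>_def)
  qed
  have \<theta>_range: "\<theta> i t \<in> {0..1}" if t: "t \<in> {0..1}" for i t
  proof (cases "t \<le> 1/2")
    case True
    have "0 \<le> \<rho> (G i (1/2))" "\<rho> (G i (1/2)) \<le> 1"
      using \<rho>_range[of "G i (1/2)"] G[of "1/2" i] \<epsilon> by auto
    moreover from this have "2 * t * \<rho> (G i (1/2)) \<le> 1 * 1"
      using True t by (intro mult_mono) auto
    ultimately show ?thesis using True t by (simp add: \<theta>_def)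
  next
    case False
    then show ?thesis using \<rho>_range[of "G i t"] G[of t i] t \<epsilon> by (auto simp: \<theta>_def)
  qed
  have \<theta>_cont: "continuous_on {0..1} (\<theta> i)" for i
  proof -
    have "continuous_on {t \<in> {0..1}. 1/2 \<le> t} (G i)"
    proof (cases "Suc i = n")
      case True
      have "continuous_on {t \<in> {0..1::real}. 1/2 \<le> t} (\<lambda>t. g (2 * t - 1))"
        by (rule continuous_on_compose2[OF g(1)]) (auto intro!: continuous_intros)
      then show ?thesis using True unfolding G_def by (auto intro!: continuous_intros)
    next
      case False
      then show ?thesis by (simp add: G_def)
    qed
    then have "continuous_on {t \<in> {0..1}. 1/2 \<le> t} (\<lambda>t. \<rho> (G i t))"
      unfolding \<rho>_def by (intro continuous_intros) auto
    then show ?thesis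
      unfolding \<theta>_def
    proof (rule continuous_on_cases_le[rotated])
      show "2 * t * \<rho> (G i (1/2)) = \<rho> (G i t)" if "t = 1/2" for t
        unfolding that by simp
    qed (intro continuous_intros)+
  qed
  have \<delta>_pos: "\<delta> i u = \<kappa> i (\<tau> u)" if "i < n" "u \<in> {0..1}" "0 < \<tau> u" for i u
  proof -
    have "(2 - 2 * u) / \<epsilon> < 1" and \<tau>: "\<tau> u = 1 - (2 - 2 * u) / \<epsilon>"
      using that(3) by (auto simp: \<tau>_def max_def split: if_splits)
    then have "2 - 2 * u < \<epsilon>" using \<epsilon> by (simp add: divide_less_eq)
    then have "1/2 < u" using \<epsilon> by linarith
    then show ?thesis using \<delta>_up[of i u] that \<epsilon> by (simp add: \<kappa>_def \<tau>)
  qed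
  have \<delta>_zero: "\<delta> i u \<notin> live" if i: "i < n" and u: "u \<in> {0..1}" "\<not> 0 < \<tau> u" for i u
  proof
    assume "\<delta> i u \<in> live"
    then obtain j s where j: "j < n" "s \<in> {0..<\<epsilon>}" "\<delta> i u = k j s" by (auto simp: live_eq)
    then have in_j: "\<delta> i u \<in> k j ` {0..\<epsilon>}" by auto
    then have u2: "1/2 < u" using \<delta>_low[OF i j(1)] u by force
    have "1 \<le> (2 - 2 * u) / \<epsilon>" using u(2) by (auto simp: \<tau>_def)
    then have ge: "\<epsilon> \<le> 2 - 2 * u" using \<epsilon> by (simp add: le_divide_eq)
    have up: "\<delta> i u = k i (2 - 2 * u)" using \<delta>_up[OF i u2] u by simp
    have 01: "2 - 2 * u \<in> {0..1}" "s \<in> {0..1}" using u2 u j(2) \<epsilon> by auto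
    then have "i = j" using kdisj[OF i j(1)] in_j up by blast
    then have "2 - 2 * u = s"
      using k[OF i] up j(3) 01 by (auto simp: inj_on_def)
    then show False using ge j(2) by simp
  qed
  have c_live: "c \<notin> live"
    using \<delta>_zero[of 0 0] \<delta>[of 0] n \<epsilon> by (simp add: \<tau>_def)
  define f where "f = (\<lambda>x. if x \<in> live
    then (case SOME p. fst p < n \<and> snd p \<in> {0<..1} \<and> x = \<kappa> (fst p) (snd p) of
      (i, t) \<Rightarrow> \<delta> (Suc i mod n) (\<theta> i t)) else c)"
  have \<theta>0: "\<theta> i 0 = 0" for i by (simp add: \<theta>_def)
  have mod_n: "Suc i mod n < n" for i using n by simp
  have f\<kappa>: "f (\<kappa> i t) = \<delta> (Suc i mod n) (\<theta> i t)" if i: "i < n" and t: "t \<in> {0..1}" for i t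
  proof (cases "t = 0")
    case True
    have "\<kappa> i 0 \<notin> live"
    proof
      assume "\<kappa> i 0 \<in> live"
      then obtain j s where "j < n" "s \<in> {0<..1}" "\<kappa> i 0 = \<kappa> j s" by (auto simp: live_def)
      then show False using \<kappa>_inj[of i j 0 s] i by auto
    qed
    then show ?thesis using True \<theta>0 \<delta>[OF mod_n] by (simp add: f_def)
  next
    case False
    let ?Q = "\<lambda>p. fst p < n \<and> snd p \<in> {0<..1} \<and> \<kappa> i t = \<kappa> (fst p) (snd p)"
    have Q: "?Q (i, t)" using i t False by auto
    then have "?Q (SOME p. ?Q p)" by (rule someI)
    then have "(SOME p. ?Q p) = (i, t)"
      using \<kappa>_inj[of i "fst (SOME p. ?Q p)" t "snd (SOME p. ?Q p)"] i t by (auto simp: prod_eq_iff)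
    moreover have "\<kappa> i t \<in> live" using Q by (auto simp: live_def)
    ultimately show ?thesis by (simp add: f_def)
  qed
  have f_dead: "f x = c" if "x \<notin> live" for x using that by (simp add: f_def)
  have \<delta>X: "\<delta> i u \<in> X" if "i < n" "u \<in> {0..1}" for i u
    using \<delta>[OF that(1)] that(2) by (auto simp: path_image_def)
  have maps: "f \<in> X \<rightarrow> X"
  proof
    fix x assume "x \<in> X"
    show "f x \<in> X"
    proof (cases "x \<in> live")
      case True
      then obtain i t where "i < n" "t \<in> {0<..1}" "x = \<kappa> i t" by (auto simp: live_def)
      then show ?thesis using f\<kappa>[of i t] \<delta>X[OF mod_n \<theta>_range[of t i]] by simp
    qed (use f_dead c in simp)
  qed
  have cont: "continuous_on X f"
  proof -
    let ?W = "\<lambda>i. k i ` {0..\<epsilon>}" and ?Z = "X - (\<Union>i<n. k i ` {0..<\<epsilon>})"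
    have sub\<epsilon>: "{0..\<epsilon>} \<subseteq> {0..1}" using \<epsilon> by auto
    have kc: "continuous_on {0..\<epsilon>} (k i)" if "i < n" for i
      using k[OF that] sub\<epsilon> continuous_on_subset by blast
    have W: "closed (?W i)" if "i < n" for i
      using compact_continuous_image[OF kc[OF that]] by (simp add: compact_imp_closed)
    have contW: "continuous_on (?W i) f" if i: "i < n" for i
    proof -
      define h where "h = inv_into {0..\<epsilon>} (k i)"
      have inj: "inj_on (k i) {0..\<epsilon>}" using k[OF i] sub\<epsilon> inj_on_subset by blast
      have h: "h (k i s) = s" if "s \<in> {0..\<epsilon>}" for s
        using that inj by (simp add: h_def)
      have hc: "continuous_on (?W i) h"
        using h by (intro continuous_on_inv[OF kc[OF i]]) auto
      have 1: "continuous_on {0..\<epsilon>} (\<lambda>s. \<theta> i (1 - s / \<epsilon>))"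
        by (rule continuous_on_compose2[OF \<theta>_cont]) (use \<epsilon> in \<open>auto intro!: continuous_intros\<close>)
      have "continuous_on {0..1} (\<delta> (Suc i mod n))" using \<delta>[OF mod_n] by (simp add: path_def)
      then have "continuous_on {0..\<epsilon>} (\<lambda>s. \<delta> (Suc i mod n) (\<theta> i (1 - s / \<epsilon>)))"
        by (rule continuous_on_compose2[OF _ 1]) (use \<theta>_range \<epsilon> in auto)
      then have "continuous_on (?W i) (\<lambda>x. \<delta> (Suc i mod n) (\<theta> i (1 - h x / \<epsilon>)))"
        by (rule continuous_on_compose2[OF _ hc]) (use h in auto)
      moreover have "\<delta> (Suc i mod n) (\<theta> i (1 - h x / \<epsilon>)) = f x" if x: "x \<in> ?W i" for x
      proof -
        obtain s where s: "s \<in> {0..\<epsilon>}" "x = k i s" using x by auto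
        then have "x = \<kappa> i (1 - s / \<epsilon>)" "1 - s / \<epsilon> \<in> {0..1}" using \<epsilon> by (auto simp: \<kappa>_def)
        then show ?thesis using f\<kappa>[OF i] h[OF s(1)] s(2) by metis
      qed
      ultimately show ?thesis by (simp cong: continuous_on_cong)
    qed
    have "closed X"
    proof -
      obtain E where "finite E" "\<forall>g\<in>E. arc g" "X = (\<Union>g\<in>E. path_image g)"
        using tree unfolding topological_tree_def topological_graph_def by blast
      then show ?thesis
        by (auto intro!: closed_UN compact_imp_closed compact_path_image simp: arc_imp_path)
    qed
    moreover have "closedin (top_of_set X) ?Z"
      using kopen by (intro closedin_diff openin_Union) (auto simp: closedin_subtopology_refl)
    ultimately have "closed ?Z" by (rule closedin_closed_trans[rotated])
    moreover have "continuous_on ?Z f"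
    proof -
      have "f x = c" if "x \<in> ?Z" for x using f_dead that by (simp add: live_eq)
      then show ?thesis using continuous_on_cong[of ?Z ?Z f "\<lambda>_. c"] by simp
    qed
    moreover have "continuous_on (\<Union>i<n. ?W i) f" "closed (\<Union>i<n. ?W i)"
      using W contW by (auto intro!: continuous_on_closed_Union closed_UN)
    ultimately have "continuous_on ((\<Union>i<n. ?W i) \<union> ?Z) f" by (intro continuous_on_closed_Un)
    moreover have "X \<subseteq> (\<Union>i<n. ?W i) \<union> ?Z" by force
    ultimately show ?thesis by (rule continuous_on_subset)
  qed
  have "cycle_periods X f = {1} \<union> {n * k | k. k \<in> cycle_periods {0..1} g}"
  proof (rule conveyor_cycle_periods[where \<kappa> = \<kappa> and T = T and c = c and n = n and f = f
        and X = X and g = g, folded live_def])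
    show "1 \<le> n" "f \<in> X \<rightarrow> X" "c \<in> X" "c \<notin> live" using n maps c c_live by auto
    show "f c = c" using f_dead c_live by blast
    have "k i ` {0..<\<epsilon>} \<subseteq> X" if "i < n" for i using openin_imp_subset[OF kopen[OF that]] .
    then show "live \<subseteq> X" by (auto simp: live_eq)
    show "i = j \<and> s = t" if "i < n" "j < n" "s \<in> {0<..1}" "t \<in> {0<..1}" "\<kappa> i s = \<kappa> j t" for i j s t
      using \<kappa>_inj[of i j s t] that by auto
    show "f x = c" if "x \<notin> live" for x using f_dead that .
    show "T i t \<le> 1 \<and> f (\<kappa> i t) = \<kappa> (Suc i mod n) (T i t)"
      if "i < n" "t \<in> {0<..1}" "0 < T i t" for i t
    proof -
      have \<theta>: "\<theta> i t \<in> {0..1}" using \<theta>_range that by auto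
      then have "0 \<le> (2 - 2 * \<theta> i t) / \<epsilon>" using \<epsilon> by simp
      then have "T i t \<le> 1" by (simp add: T_def \<tau>_def)
      then show ?thesis using f\<kappa>[of i t] \<delta>_pos[OF mod_n \<theta>] that by (simp add: T_def)
    qed
    show "f (\<kappa> i t) \<notin> live" if "i < n" "t \<in> {0<..1}" "\<not> 0 < T i t" for i t
      using f\<kappa>[of i t] \<delta>_zero[OF mod_n \<theta>_range[of t i]] that by (simp add: T_def)
    show "T i t = t" if "Suc i < n" "t \<in> {1/2..1}" for i t
    proof -
      have "G i t = t" using that by (simp add: G_def)
      then show ?thesis using \<theta>_half[OF that(2)] \<tau>\<rho>[of t] that(2) by (simp add: T_def)
    qed
    show "T (n - 1) ((1 + t) / 2) = (1 + g t) / 2" if "t \<in> {0..1}" for t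
    proof -
      have t: "(1 + t) / 2 \<in> {1/2..1}" using that by auto
      have "2 * ((1 + t) / 2) - 1 = t" by (simp add: field_simps)
      then have "G (n - 1) ((1 + t) / 2) = (1 + g t) / 2"
        using n by (simp add: G_def)
      moreover from this have "(1 + g t) / 2 \<in> {0..1}" using G[OF t, of "n - 1"] by auto
      ultimately show ?thesis using \<theta>_half[OF t] \<tau>\<rho> by (simp add: T_def)
    qed
    show "T i s \<le> T i t" if "i < n" "0 < s" "s \<le> t" "t < 1/2" for i s t
    proof -
      have "0 \<le> \<rho> (G i (1/2))" using \<rho>_range[of "G i (1/2)"] G[of "1/2" i] \<epsilon> by auto
      then have "\<theta> i s \<le> \<theta> i t" using that by (auto simp: \<theta>_def intro: mult_right_mono)
      then have "(2 - 2 * \<theta> i t) / \<epsilon> \<le> (2 - 2 * \<theta> i s) / \<epsilon>" using \<epsilon> by (intro divide_right_mono) auto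
      then show ?thesis by (simp add: T_def \<tau>_def)
    qed
    show "g \<in> {0..1} \<rightarrow> {0..1}" by (rule g(2))
    show "1 \<in> cycle_periods {0..1} g" using interval_map_fixpoint[OF g] .
  qed
  then show ?thesis using cont maps by blast
qed

end

theorem theorem1:
  fixes X :: "'a::t2_space set"
  assumes "topological_tree X"
  shows "(\<forall>(n::nat) f.
      1 < n \<and> (\<forall>p. prime p \<and> p dvd n \<longrightarrow> \<not> p < End X + 1) \<and>
      continuous_on X f \<and> f \<in> X \<rightarrow> X \<and> n \<in> cycle_periods X f \<longrightarrow>
        (\<forall>m. m > 2 * End X * (n - 1) \<longrightarrow> m \<in> cycle_periods X f) \<and>
        topological_entropy X f \<ge> ereal (ln 2 / (real n * real (End X) - 1)))
    \<and> (\<forall>(n::nat) (g :: real \<Rightarrow> real) E.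
      1 \<le> n \<and> n \<le> End X \<and>
      continuous_on {0..1} g \<and> g \<in> {0..1} \<rightarrow> {0..1} \<and> E = cycle_periods {0..1} g \<longrightarrow>
        (\<exists>f. continuous_on X f \<and> f \<in> X \<rightarrow> X \<and>
          cycle_periods X f = {1} \<union> {n * k | k. k \<in> E}))"
proof (intro conjI allI impI)
  interpret tree X by (rule tree.intro[OF assms])
  fix n f
  assume A: "1 < n \<and> (\<forall>p. prime p \<and> p dvd n \<longrightarrow> \<not> p < End X + 1) \<and>
      continuous_on X f \<and> f \<in> X \<rightarrow> X \<and> n \<in> cycle_periods X f"
  then interpret tree_map X f by unfold_locales auto
  have n: "1 < n" "\<forall>p. prime p \<and> p dvd n \<longrightarrow> \<not> p < End X + 1" "n \<in> cycle_periods X f"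
    using A by auto
  show "m \<in> cycle_periods X f" if "m > 2 * End X * (n - 1)" for m
    using all_large_periods[OF n that] .
  obtain p q l D0 D1 where l: "1 \<le> l" "l \<le> End X" "double_loop l n p q D0 D1"
    using germ_loop_and_excursion[OF n] by metis
  have "l \<le> n" using l(2) period_gt_End[OF n(1,2)] by simp
  then have "ereal (ln 2 / real n) \<le> topological_entropy X f"
    using double_loop_entropy[OF l(3,1)] n(1) by blast
  moreover have "ln 2 / (real n * real (End X) - 1) \<le> ln 2 / real n"
  proof (rule divide_left_mono)
    have "real n * 2 \<le> real n * real (End X)" using two_endpoints by (intro mult_left_mono) auto
    then show "real n \<le> real n * real (End X) - 1" using n(1) by linarith
    then show "0 < (real n * real (End X) - 1) * real n" using n(1) by (intro mult_pos_pos) auto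
  qed simp
  ultimately show "topological_entropy X f \<ge> ereal (ln 2 / (real n * real (End X) - 1))"
    by (meson ereal_less_eq(3) order_trans)
next
  interpret tree X by (rule tree.intro[OF assms])
  fix n g E
  assume A: "1 \<le> n \<and> n \<le> End X \<and>
      continuous_on {0..1} g \<and> g \<in> {0..1} \<rightarrow> {0..1} \<and> E = cycle_periods {0..1} (g :: real \<Rightarrow> real)"
  then show "\<exists>f. continuous_on X f \<and> f \<in> X \<rightarrow> X \<and> cycle_periods X f = {1} \<union> {n * k | k. k \<in> E}"
    using multiplied_periods by blast
qed

end
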